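(* Let $K$ be a finite set. For each $k\in K$ let $\mathcal{H}_k$ be a Hilbert space, $H_k$ a self-adjoint operator on $\mathcal{H}_k$ with discrete spectrum, and $\beta_k>0$ such that $Z_k:=\mathrm{Tr}\,e^{-\beta_kH_k}<\infty$. Let $\mathcal{H}_{\mathrm S}$ be a Hilbert space of finite dimension $d$, and let $H_\lambda$ be a self-adjoint operator on $\mathcal{H}=\mathcal{H}_{\mathrm S}\otimes\bigotimes_{k\in K}\mathcal{H}_k$ of the form $H_\lambda=H_{\mathrm S}+\sum_kH_k+\lambda\sum_kH^{\mathrm I}_{\mathrm S-k}$, where $\lambda\in\mathbb{R}$, $H_{\mathrm S}$ is a self-adjoint operator on $\mathcal{H}_{\mathrm S}$ and each $H^{\mathrm I}_{\mathrm S-k}$ is a self-adjoint operator on $\mathcal{H}_{\mathrm S}\otimes\mathcal{H}_k$. Put $U^\lambda_t=e^{-itH_\lambda}$. Assume there is an anti-unitary operator $T$ on $\mathcal{H}$ with $TT=1$, $[T,H_k]=0$ for all $k\in K$, $[T,H_\lambda]=0$, and $TU^\lambda_tT=U^\lambda_{-t}$ for all $t\in\mathbb{R}$. Let the initial state be $$\rho_0=\frac1d\otimes\Big[\bigotimes_{k\in K}\frac{e^{-\beta_kH_k}}{Z_k}\Big].$$ Let $F(\kappa,t,\lambda,\rho_0)$ denote the Laplace transform of the two-time-measurement distribution of entropy production, $$F(\kappa,t,\lambda,\rho_0)=\sum_{x,y\in X}\mathrm{Tr}\big[\rho_0P_xU^\lambda_{-t}P_yU^\lambda_tP_x\big]\,e^{-\kappa\sum_k\beta_k(H_k(y)-H_k(x))}\in[0,\infty].$$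 Then for all $t\in\mathbb{R}$ and all $\kappa\in\mathbb{R}$, $$F(\kappa,t,\lambda,\rho_0)=F(1-\kappa,t,\lambda,\rho_0).$$
   Context: Operators on a tensor factor are identified with their extensions to $\mathcal{H}$ by the identity on the other factors. $X$ labels a complete orthonormal set of joint eigenvectors $|x\rangle$ of the commuting operators $(H_k)_{k\in K}$ on $\bigotimes_k\mathcal{H}_k$, with $H_k(x)$ the corresponding eigenvalue of $H_k$, and $P_x=1\otimes|x\rangle\langle x|$, with $1$ the identity on $\mathcal{H}_{\mathrm S}$. The probability of measuring an entropy production $r$ is $\sum_{x,y:\ \sum_k\beta_k(H_k(y)-H_k(x))=r}\mathrm{Tr}[\rho_0P_xU^\lambda_{-t}P_yU^\lambda_tP_x]$, obtained by measuring the $H_k$ at time $0$, evolving for time $t$, and measuring the $H_k$ again. Formally, $F(\kappa,t,\lambda,\rho_0)=\mathrm{Tr}\big[\rho_0\,U^\lambda_{-t}e^{-\kappa\sum_k\beta_kH_k}U^\lambda_te^{\kappa\sum_k\beta_kH_k}\big]$. An anti-unitary operator is an antilinear bijection $T$ with $\langle T\phi,T\psi\rangle=\overline{\langle\phi,\psi\rangle}$. *)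

theory Defs
  imports "HOL-Analysis.Analysis"
begin

section \<open>Complex Hilbert spaces\<close>

class scaleC =
  fixes scaleC :: "complex \<Rightarrow> 'a \<Rightarrow> 'a"  (infixr \<open>*\<^sub>C\<close> 75)

class complex_vector = scaleC + real_vector +
  assumes scaleC_add_right: "a *\<^sub>C (x + y) = a *\<^sub>C x + a *\<^sub>C y"
    and scaleC_add_left: "(a + b) *\<^sub>C x = a *\<^sub>C x + b *\<^sub>C x"
    and scaleC_scaleC: "a *\<^sub>C b *\<^sub>C x = (a * b) *\<^sub>C x"
    and scaleC_one: "1 *\<^sub>C x = x"
    and scaleC_of_real: "complex_of_real r *\<^sub>C x = r *\<^sub>R x"

global_interpretation complex_vec: vector_space "scaleC :: complex \<Rightarrow> 'a \<Rightarrow> 'a::complex_vector"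
  defines cspan = complex_vec.span
    and csubspace = complex_vec.subspace
    and cdim = complex_vec.dim
    and cdependent = complex_vec.dependent
    and cextend_basis = complex_vec.extend_basis
    and crepresentation = complex_vec.representation
  by unfold_locales
    (simp_all add: scaleC_add_right scaleC_add_left scaleC_scaleC scaleC_one)

text \<open>The inner product is linear in its second argument. Norm and topology are those of the
  underlying real inner product space, whose inner product is the real part of the complex one.\<close>

class chilbert_space = complex_vector + real_inner + complete_space +
  fixes cinner :: "'a \<Rightarrow> 'a \<Rightarrow> complex"
  assumes cinner_commute: "cinner x y = cnj (cinner y x)"
    and cinner_add_right: "cinner x (y + z) = cinner x y + cinner x z"
    and cinner_scaleC_right: "cinner x (a *\<^sub>C y) = a * cinner x y"
    and Re_cinner: "Re (cinner x y) = inner x y"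

instantiation complex :: chilbert_space
begin

definition scaleC_complex :: "complex \<Rightarrow> complex \<Rightarrow> complex" where
  "scaleC_complex a x = a * x"

definition cinner_complex :: "complex \<Rightarrow> complex \<Rightarrow> complex" where
  "cinner_complex x y = cnj x * y"

instance
  by standard
    (simp_all add: scaleC_complex_def cinner_complex_def inner_complex_def scaleR_conv_of_real
      algebra_simps)

end

instantiation prod :: (complex_vector, complex_vector) complex_vector
begin

definition scaleC_prod :: "complex \<Rightarrow> 'a \<times> 'b \<Rightarrow> 'a \<times> 'b" where
  "scaleC_prod a p = (a *\<^sub>C fst p, a *\<^sub>C snd p)"

instance
  by standard
    (simp_all add: scaleC_prod_def scaleC_add_right scaleC_add_left scaleC_scaleC scaleC_one
      scaleC_of_real prod_eq_iff)

end

text \<open>A family of Hilbert spaces that need not be isomorphic is a family of closed subspaces of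
  one ambient Hilbert space (for instance, of its Hilbert sum). Hence the notions below are
  relative to a carrier \<open>V\<close>.\<close>

definition closed_csubspace :: "'a::chilbert_space set \<Rightarrow> bool" where
  "closed_csubspace V \<longleftrightarrow> csubspace V \<and> closed V"

definition is_onb :: "'a::chilbert_space set \<Rightarrow> 'a set \<Rightarrow> bool" where
  "is_onb V B \<longleftrightarrow> B \<subseteq> V \<and> (\<forall>b\<in>B. norm b = 1) \<and>
     (\<forall>b\<in>B. \<forall>c\<in>B. b \<noteq> c \<longrightarrow> cinner b c = 0) \<and> closure (cspan B) = V"

definition antiunitary :: "('h::chilbert_space \<Rightarrow> 'h) \<Rightarrow> bool" where
  "antiunitary T \<longleftrightarrow> bij T \<and> (\<forall>x y. T (x + y) = T x + T y) \<and>
     (\<forall>a x. T (a *\<^sub>C x) = cnj a *\<^sub>C T x) \<and>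
     (\<forall>x y. cinner (T x) (T y) = cnj (cinner x y))"


section \<open>Unbounded operators\<close>

text \<open>An operator is represented by its graph; its domain is the \<^const>\<open>Domain\<close> of the graph.
  Sums, multiples and products carry the usual natural domains.\<close>

type_synonym 'a operator = "('a \<times> 'a) set"

definition op_app :: "'a operator \<Rightarrow> 'a \<Rightarrow> 'a" where
  "op_app A x = (THE y. (x, y) \<in> A)"

definition op_mult :: "'a operator \<Rightarrow> 'a operator \<Rightarrow> 'a operator"  (infixr \<open>\<odot>\<close> 75) where
  "A \<odot> B = {(x, z). \<exists>y. (x, y) \<in> B \<and> (y, z) \<in> A}"

definition op_scale :: "complex \<Rightarrow> 'a::complex_vector operator \<Rightarrow> 'a operator" where
  "op_scale c A = {(x, c *\<^sub>C y) | x y. (x, y) \<in> A}"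

definition op_add :: "'a::complex_vector operator \<Rightarrow> 'a operator \<Rightarrow> 'a operator" where
  "op_add A B = {(x, y + z) | x y z. (x, y) \<in> A \<and> (x, z) \<in> B}"

definition op_sum :: "'k set \<Rightarrow> ('k \<Rightarrow> 'a::complex_vector operator) \<Rightarrow> 'a operator" where
  "op_sum K A = {(x, \<Sum>k\<in>K. y k) | x y. \<forall>k\<in>K. (x, y k) \<in> A k}"

definition op_of :: "('a \<Rightarrow> 'a) \<Rightarrow> 'a operator" where
  "op_of f = {(x, f x) | x. True}"

definition op_commutes :: "'a operator \<Rightarrow> 'a operator \<Rightarrow> bool" where
  "op_commutes A B \<longleftrightarrow> A \<odot> B = B \<odot> A"

definition linear_operator :: "'a::chilbert_space set \<Rightarrow> 'a operator \<Rightarrow> bool" where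
  "linear_operator V A \<longleftrightarrow> A \<subseteq> V \<times> V \<and> csubspace A \<and> single_valued A"

definition adjoint_op :: "'a::chilbert_space set \<Rightarrow> 'a operator \<Rightarrow> 'a operator" where
  "adjoint_op V A = {(x, y) \<in> V \<times> V. \<forall>(u, v)\<in>A. cinner x v = cinner y u}"

definition self_adjoint :: "'a::chilbert_space set \<Rightarrow> 'a operator \<Rightarrow> bool" where
  "self_adjoint V A \<longleftrightarrow>
     linear_operator V A \<and> closure (Domain A) = V \<and> adjoint_op V A = A"

definition resolvent_set :: "'a::chilbert_space set \<Rightarrow> 'a operator \<Rightarrow> complex set" where
  "resolvent_set V A = {z.
     (\<forall>y\<in>V. \<exists>!x. (x, y + z *\<^sub>C x) \<in> A) \<and>
     (\<exists>C. \<forall>(x, w)\<in>A. norm x \<le> C * norm (w - z *\<^sub>C x))}"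

definition op_spectrum :: "'a::chilbert_space set \<Rightarrow> 'a operator \<Rightarrow> complex set" where
  "op_spectrum V A = - resolvent_set V A"

definition eigenspace :: "'a::chilbert_space operator \<Rightarrow> complex \<Rightarrow> 'a set" where
  "eigenspace A z = {x. (x, z *\<^sub>C x) \<in> A}"

text \<open>The spectrum consists of isolated eigenvalues of finite multiplicity.\<close>

definition discrete_spectrum :: "'a::chilbert_space set \<Rightarrow> 'a operator \<Rightarrow> bool" where
  "discrete_spectrum V A \<longleftrightarrow> (\<forall>z\<in>op_spectrum V A.
     z isolated_in op_spectrum V A \<and> eigenspace A z \<noteq> {0} \<and>
     (\<exists>B. finite B \<and> eigenspace A z = cspan B))"


section \<open>Trace\<close>

text \<open>The trace is basis independent, so it is computed in an arbitrary orthonormal basis.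
  A positive operator that is not defined on all of \<open>V\<close> is unbounded and has infinite trace.\<close>

definition op_trace :: "'a::chilbert_space set \<Rightarrow> 'a operator \<Rightarrow> complex" where
  "op_trace V A = (\<Sum>\<^sub>\<infinity>b\<in>(SOME B. is_onb V B). cinner b (op_app A b))"

definition positive_trace :: "'a::chilbert_space set \<Rightarrow> 'a operator \<Rightarrow> ennreal" where
  "positive_trace V A =
     (if Domain A = V
      then \<Sum>\<^sub>\<infinity>b\<in>(SOME B. is_onb V B). ennreal (Re (cinner b (op_app A b)))
      else \<infinity>)"


section \<open>Functional calculus\<close>

definition orth_projection :: "'a::chilbert_space set \<Rightarrow> ('a \<Rightarrow> 'a) \<Rightarrow> bool" where
  "orth_projection V P \<longleftrightarrow> (\<exists>M. closed_csubspace M \<and> M \<subseteq> V \<and>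
     (\<forall>x\<in>V. P x \<in> M \<and> (\<forall>m\<in>M. cinner m (x - P x) = 0)))"

definition projection_valued_measure ::
    "'a::chilbert_space set \<Rightarrow> (real set \<Rightarrow> 'a \<Rightarrow> 'a) \<Rightarrow> bool" where
  "projection_valued_measure V E \<longleftrightarrow>
     (\<forall>A\<in>sets borel. orth_projection V (E A)) \<and>
     (\<forall>x\<in>V. E UNIV x = x) \<and>
     (\<forall>A\<in>sets borel. \<forall>B\<in>sets borel. \<forall>x\<in>V. E (A \<inter> B) x = E A (E B x)) \<and>
     (\<forall>A::nat \<Rightarrow> real set. range A \<subseteq> sets borel \<longrightarrow> disjoint_family A \<longrightarrow>
        (\<forall>x\<in>V. (\<lambda>n. E (A n) x) sums E (\<Union>n. A n) x))"

definition scalar_measure :: "(real set \<Rightarrow> 'a::chilbert_space \<Rightarrow> 'a) \<Rightarrow> 'a \<Rightarrow> real measure" where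
  "scalar_measure E x = measure_of UNIV (sets borel) (\<lambda>A. ennreal ((norm (E A x))\<^sup>2))"

text \<open>The operator \<open>\<integral> f dE\<close>: \<open>x\<close> is in its domain iff \<open>f\<close> is square integrable with respect to
  the scalar measure of \<open>x\<close>, and the value is the limit of the integrals of simple functions
  converging to \<open>f\<close> in mean square.\<close>

definition spectral_integral ::
    "'a::chilbert_space set \<Rightarrow> (real set \<Rightarrow> 'a \<Rightarrow> 'a) \<Rightarrow> (real \<Rightarrow> complex) \<Rightarrow> 'a operator" where
  "spectral_integral V E f = {(x, y). x \<in> V \<and> (\<exists>g :: nat \<Rightarrow> real \<Rightarrow> complex.
     (\<forall>n. simple_function borel (g n)) \<and>
     (\<lambda>n. \<integral>\<^sup>+s. ennreal ((norm (f s - g n s))\<^sup>2) \<partial>scalar_measure E x) \<longlonglongrightarrow> 0 \<and>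
     (\<lambda>n. \<Sum>c\<in>range (g n). c *\<^sub>C E (g n -` {c}) x) \<longlonglongrightarrow> y)}"

text \<open>By the spectral theorem every self-adjoint operator has exactly one spectral measure \<open>E\<close>;
  then \<open>f(A)\<close> is \<open>spectral_integral V E f\<close>.\<close>

definition spectral_measure_of ::
    "'a::chilbert_space set \<Rightarrow> 'a operator \<Rightarrow> (real set \<Rightarrow> 'a \<Rightarrow> 'a) \<Rightarrow> bool" where
  "spectral_measure_of V A E \<longleftrightarrow>
     projection_valued_measure V E \<and> A = spectral_integral V E complex_of_real"


section \<open>Tensor products\<close>

text \<open>\<open>\<tau> x\<close> is the elementary tensor of the vectors \<open>x i\<close> for \<open>i \<in> I\<close>. The inner product formula
  makes \<open>\<tau>\<close> multilinear and independent of the values of \<open>x\<close> outside \<open>I\<close>; together with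
  density it determines \<open>(\<tau>, W)\<close> up to a unique unitary.\<close>

definition tensor_product ::
    "'i set \<Rightarrow> ('i \<Rightarrow> 'a::chilbert_space set) \<Rightarrow> (('i \<Rightarrow> 'a) \<Rightarrow> 'b::chilbert_space) \<Rightarrow> 'b set \<Rightarrow> bool"
  where
  "tensor_product I V \<tau> W \<longleftrightarrow>
     (\<forall>x\<in>Pi I V. \<forall>y\<in>Pi I V. cinner (\<tau> x) (\<tau> y) = (\<Prod>i\<in>I. cinner (x i) (y i))) \<and>
     closure (cspan (\<tau> ` Pi I V)) = W"

definition tensor_operator ::
    "'i set \<Rightarrow> ('i \<Rightarrow> 'a::chilbert_space set) \<Rightarrow> (('i \<Rightarrow> 'a) \<Rightarrow> 'b::chilbert_space) \<Rightarrow>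
     ('i \<Rightarrow> 'a operator) \<Rightarrow> 'b operator" where
  "tensor_operator I V \<tau> A = closure (cspan
     {(\<tau> x, \<tau> y) | x y. x \<in> Pi I V \<and> y \<in> Pi I V \<and> (\<forall>i\<in>I. (x i, y i) \<in> A i)})"

text \<open>For \<open>J \<subseteq> I\<close> and \<open>\<sigma>\<close> the tensor map of the factors in \<open>J\<close>: the graph of the bounded operator
  that tensors with the fixed vectors \<open>y i\<close>, \<open>i \<in> I - J\<close>.\<close>

definition tensor_with ::
    "'i set \<Rightarrow> ('i \<Rightarrow> 'a::chilbert_space set) \<Rightarrow> (('i \<Rightarrow> 'a) \<Rightarrow> 'b::chilbert_space) \<Rightarrow>
     'i set \<Rightarrow> (('i \<Rightarrow> 'a) \<Rightarrow> 'c::chilbert_space) \<Rightarrow> ('i \<Rightarrow> 'a) \<Rightarrow> ('c \<times> 'b) set" where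
  "tensor_with I V \<tau> J \<sigma> y =
     closure (cspan {(\<sigma> x, \<tau> (override_on y x J)) | x. x \<in> Pi J V})"

text \<open>The extension of an operator on the tensor product of the factors in \<open>J\<close> by the identity on
  the factors in \<open>I - J\<close>: the closure of the algebraic tensor product.\<close>

definition ampliation ::
    "'i set \<Rightarrow> ('i \<Rightarrow> 'a::chilbert_space set) \<Rightarrow> (('i \<Rightarrow> 'a) \<Rightarrow> 'b::chilbert_space) \<Rightarrow>
     'i set \<Rightarrow> (('i \<Rightarrow> 'a) \<Rightarrow> 'c::chilbert_space) \<Rightarrow> 'c operator \<Rightarrow> 'b operator" where
  "ampliation I V \<tau> J \<sigma> A = closure (cspan
     {(w, w'). \<exists>y\<in>Pi I V. \<exists>(u, v)\<in>A.
        (u, w) \<in> tensor_with I V \<tau> J \<sigma> y \<and> (v, w') \<in> tensor_with I V \<tau> J \<sigma> y})"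

text \<open>A single factor is its own tensor product, with tensor map \<open>\<lambda>x. x i\<close>.\<close>

definition factor_ampliation ::
    "'i set \<Rightarrow> ('i \<Rightarrow> 'a::chilbert_space set) \<Rightarrow> (('i \<Rightarrow> 'a) \<Rightarrow> 'b::chilbert_space) \<Rightarrow>
     'i \<Rightarrow> 'a operator \<Rightarrow> 'b operator" where
  "factor_ampliation I V \<tau> i A = ampliation I V \<tau> {i} (\<lambda>x. x i) A"

definition rank_one_projection :: "'a::chilbert_space \<Rightarrow> 'a operator" where
  "rank_one_projection v = op_of (\<lambda>u. cinner v u *\<^sub>C v)"


section \<open>Two-time measurement of entropy production\<close>

text \<open>\<open>e k x\<close> is the eigenvalue \<open>H\<^sub>k(x)\<close>.\<close>

definition entropy_production ::
    "'k set \<Rightarrow> ('k \<Rightarrow> real) \<Rightarrow> ('k \<Rightarrow> 'x \<Rightarrow> real) \<Rightarrow> 'x \<Rightarrow> 'x \<Rightarrow> real" where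
  "entropy_production K \<beta> e x y = (\<Sum>k\<in>K. \<beta> k * (e k y - e k x))"

text \<open>The traces below are nonnegative real numbers if \<open>\<rho>\<close> is a state commuting with all \<open>P x\<close>,
  so that taking real parts only changes the type.\<close>

definition tpm_probability ::
    "'h::chilbert_space operator \<Rightarrow> ('x \<Rightarrow> 'h operator) \<Rightarrow> (real \<Rightarrow> 'h operator) \<Rightarrow>
     real \<Rightarrow> 'x \<Rightarrow> 'x \<Rightarrow> ennreal" where
  "tpm_probability \<rho> P U t x y =
     ennreal (Re (op_trace UNIV (\<rho> \<odot> P x \<odot> U (- t) \<odot> P y \<odot> U t \<odot> P x)))"

definition tpm_laplace ::
    "'x set \<Rightarrow> ('x \<Rightarrow> 'x \<Rightarrow> real) \<Rightarrow> 'h::chilbert_space operator \<Rightarrow> ('x \<Rightarrow> 'h operator) \<Rightarrow>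
     (real \<Rightarrow> 'h operator) \<Rightarrow> real \<Rightarrow> real \<Rightarrow> ennreal" where
  "tpm_laplace X S \<rho> P U \<kappa> t =
     (\<Sum>\<^sub>\<infinity>(x, y)\<in>X \<times> X. tpm_probability \<rho> P U t x y * ennreal (exp (- \<kappa> * S x y)))"

end

(* Expand F in an orthonormal basis b(f, x) = f \<otimes> |x>, with f in an orthonormal basis of the system
   space. With s(x) = \<Sum>k. \<beta>_k H_k(x), the initial state has eigenvalue C exp (- s(x)) there, and
     F \<kappa> = \<Sum> over i, j of C exp (- (1 - \<kappa>) s_i) exp (- \<kappa> s_j) |<b_j, U_t b_i>|^2.
   Exchanging i and j turns \<kappa> into 1 - \<kappa> and U_t into its adjoint U_-t = T U_t T, that is, b into
   T b. Since T commutes with every H_k, T b is another basis of joint eigenvectors with the same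
   eigenvalues, and the sum does not depend on which such basis is used. The vectors |x> need
   not be product vectors or T-invariant; they are limits of combinations of products of eigenvectors. *)

theory Submission
  imports Defs
begin

section \<open>The complex inner product\<close>

text \<open>The ampliations and \<open>\<rho>0\<close> are closures of algebraic tensor
  constructions, so even single-valuedness has to be proved. Symmetry of a graph survives the closed
  linear span, and a symmetric graph with dense domain is single-valued; this turns
  \<open>P x\<close> into a finite-rank projection and makes \<open>\<rho>0\<close> a function.
  Eigenvector relations of closed graphs pass to closed spans of product eigenvectors. These reach
  an entangled |x> because each H_k is its own adjoint: pairing |x> with a product vector, seen as a
  functional of one factor, is represented by an eigenvector of H_k. The change of basis rests on
  Parseval with a defect: the sum of |<b_i, z>|^2 over any orthonormal family is |z|^2 minus the
  squared distance of z to its span. So only the closed span of each level set of s counts, and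
  different levels are orthogonal because the H_k are symmetric. Grouping by s suffices since the
  weights are functions of s. As F may be infinite, all reordering takes place in
  \<open>ennreal\<close>. The constant C is 1/d times the product of the 1/Z_k.\<close>

lemma csubspaceI:
  assumes "0 \<in> S" "\<And>x y. x \<in> S \<Longrightarrow> y \<in> S \<Longrightarrow> x + y \<in> S" "\<And>c x. x \<in> S \<Longrightarrow> c *\<^sub>C x \<in> S"
  shows "csubspace S"
  using assms by (auto simp: complex_vec.subspace_def)

lemma cinner_add_left: "cinner (x + y) z = cinner x z + cinner y z"
  for x y z :: "'a::chilbert_space"
  by (metis cinner_add_right cinner_commute complex_cnj_add)

lemma cinner_scaleC_left: "cinner (a *\<^sub>C x) y = cnj a * cinner x y"
  for x y :: "'a::chilbert_space"
  by (metis cinner_commute cinner_scaleC_right complex_cnj_mult)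

lemma scaleR_eq_scaleC: "r *\<^sub>R x = complex_of_real r *\<^sub>C x" for x :: "'a::complex_vector"
  by (simp add: scaleC_of_real)

lemma cinner_self: "cinner x x = complex_of_real ((norm x)\<^sup>2)" for x :: "'a::chilbert_space"
proof -
  have "Im (cinner x x) = 0"
    by (metis cinner_commute complex_cnj_cancel_iff Reals_cnj_iff complex_is_Real_iff)
  then show ?thesis
    by (simp add: complex_eq_iff Re_cinner power2_norm_eq_inner)
qed

lemma norm_scaleC: "norm (a *\<^sub>C x) = cmod a * norm x" for x :: "'a::chilbert_space"
proof -
  have "complex_of_real ((norm (a *\<^sub>C x))\<^sup>2) = cinner (a *\<^sub>C x) (a *\<^sub>C x)"
    by (simp add: cinner_self)
  also have "\<dots> = (cnj a * a) * cinner x x"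
    by (simp add: cinner_scaleC_left cinner_scaleC_right)
  also have "cnj a * a = complex_of_real ((cmod a)\<^sup>2)"
    by (metis complex_norm_square mult.commute)
  also have "complex_of_real ((cmod a)\<^sup>2) * cinner x x = complex_of_real ((cmod a * norm x)\<^sup>2)"
    by (simp add: cinner_self power_mult_distrib)
  finally have "(norm (a *\<^sub>C x))\<^sup>2 = (cmod a * norm x)\<^sup>2"
    using of_real_eq_iff by blast
  then show ?thesis by (simp add: power2_eq_iff_nonneg)
qed

text \<open>A phase \<open>a\<close> rotates the inner product onto the nonnegative real axis, where
  the real Cauchy-Schwarz inequality applies.\<close>

lemma cinner_bound: "cmod (cinner x y) \<le> norm x * norm y" for x y :: "'a::chilbert_space"
proof (cases "cinner x y = 0")
  case False
  define a where "a = cnj (cinner x y) / cmod (cinner x y)"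
  have a: "cmod a = 1" using False by (simp add: a_def norm_divide)
  have "a * cinner x y = cmod (cinner x y)"
    using False by (simp add: a_def field_simps flip: complex_norm_square)
      (simp add: power2_eq_square)
  then have "cmod (cinner x y) = Re (cinner x (a *\<^sub>C y))"
    by (simp add: cinner_scaleC_right)
  also have "\<dots> \<le> norm x * norm (a *\<^sub>C y)"
    by (simp add: Re_cinner norm_cauchy_schwarz)
  finally show ?thesis by (simp add: norm_scaleC a)
qed simp

lemma bounded_bilinear_cinner: "bounded_bilinear (cinner :: 'a::chilbert_space \<Rightarrow> 'a \<Rightarrow> complex)"
  by standard (auto simp: cinner_add_left cinner_add_right scaleR_eq_scaleC cinner_scaleC_left
      cinner_scaleC_right scaleC_complex_def intro!: exI[of _ 1] cinner_bound)

lemma bounded_bilinear_scaleC: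
  "bounded_bilinear (scaleC :: complex \<Rightarrow> 'a::chilbert_space \<Rightarrow> 'a)"
  by standard (auto simp: scaleC_add_left scaleC_add_right scaleR_eq_scaleC scaleC_scaleC
      scaleC_complex_def mult.commute norm_scaleC intro!: exI[of _ 1])

lemmas tendsto_cinner [tendsto_intros] = bounded_bilinear.tendsto[OF bounded_bilinear_cinner]
  and continuous_on_cinner [continuous_intros] =
    bounded_bilinear.continuous_on[OF bounded_bilinear_cinner]
  and cinner_diff_left = bounded_bilinear.diff_left[OF bounded_bilinear_cinner]
  and cinner_diff_right = bounded_bilinear.diff_right[OF bounded_bilinear_cinner]
  and cinner_zero_left [simp] = bounded_bilinear.zero_left[OF bounded_bilinear_cinner]
  and cinner_zero_right [simp] = bounded_bilinear.zero_right[OF bounded_bilinear_cinner]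
  and cinner_sum_left = bounded_bilinear.sum_left[OF bounded_bilinear_cinner]
  and cinner_sum_right = bounded_bilinear.sum_right[OF bounded_bilinear_cinner]

lemmas tendsto_scaleC [tendsto_intros] = bounded_bilinear.tendsto[OF bounded_bilinear_scaleC]
  and continuous_on_scaleC [continuous_intros] =
    bounded_bilinear.continuous_on[OF bounded_bilinear_scaleC]

lemma cinner_eqI: "x = y" if "\<And>z. cinner z x = cinner z y" for x y :: "'a::chilbert_space"
proof -
  have "cinner (x - y) (x - y) = 0" using that by (simp add: cinner_diff_right)
  then show ?thesis by (simp add: cinner_self)
qed

text \<open>The form of every density argument below: a condition defining a closed subspace is
  checked on generators.\<close>

lemma cspan_closure_induct:
  assumes "x \<in> closure (cspan S)" "csubspace C" "closed C" "S \<subseteq> C"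
  shows "x \<in> C"
  using assms by (meson closure_minimal complex_vec.span_minimal subsetD)

text \<open>Product types carry no \<open>chilbert_space\<close> structure here, so continuity of
  scaling is an assumption; this serves both sets of vectors and graphs of operators.\<close>

lemma csubspace_closure_aux:
  fixes S :: "'a::{complex_vector,real_normed_vector} set"
  assumes "csubspace S" and cont: "\<And>c. continuous_on UNIV (\<lambda>x::'a. c *\<^sub>C x)"
  shows "csubspace (closure S)"
proof (rule csubspaceI)
  show "0 \<in> closure S" using assms(1) closure_subset complex_vec.subspace_0 by blast
next
  fix x y assume "x \<in> closure S" "y \<in> closure S"
  then obtain f g where fg: "\<And>n. f n \<in> S" "f \<longlonglongrightarrow> x" "\<And>n. g n \<in> S" "g \<longlonglongrightarrow> y"
    unfolding closure_sequential by blast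
  have "(\<lambda>n. f n + g n) \<longlonglongrightarrow> x + y" by (intro tendsto_intros fg)
  moreover have "\<forall>n. f n + g n \<in> S" using fg assms(1) complex_vec.subspace_add by blast
  ultimately show "x + y \<in> closure S" unfolding closure_sequential by (intro exI conjI)
next
  fix c x assume "x \<in> closure S"
  moreover have "(*\<^sub>C) c ` closure S \<subseteq> closure ((*\<^sub>C) c ` S)"
    by (intro image_closure_subset continuous_on_subset[OF cont]) (auto intro: closure_subset[THEN subsetD])
  moreover have "(*\<^sub>C) c ` S \<subseteq> S" using assms(1) complex_vec.subspace_scale by blast
  ultimately show "c *\<^sub>C x \<in> closure S" using closure_mono by blast
qed

lemma csubspace_closure: "csubspace S \<Longrightarrow> csubspace (closure S)" for S :: "'a::chilbert_space set"
  by (rule csubspace_closure_aux) (auto intro!: continuous_intros)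

lemma csubspace_closure_prod: "csubspace S \<Longrightarrow> csubspace (closure S)"
  for S :: "('a::chilbert_space \<times> 'b::chilbert_space) set"
  by (rule csubspace_closure_aux) (auto simp: scaleC_prod_def intro!: continuous_intros)

text \<open>The representing vector minimises \<open>\<parallel>x\<parallel>\<^sup>2 / 2 - Re (\<phi> x)\<close>; by the parallelogram law a
  minimising sequence is Cauchy.\<close>

lemma riesz_representation:
  fixes M :: "'a::chilbert_space set" and \<phi> :: "'a \<Rightarrow> complex"
  assumes M: "csubspace M" "closed M"
    and add: "\<And>x y. x \<in> M \<Longrightarrow> y \<in> M \<Longrightarrow> \<phi> (x + y) = \<phi> x + \<phi> y"
    and scale: "\<And>a x. x \<in> M \<Longrightarrow> \<phi> (a *\<^sub>C x) = a * \<phi> x"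
    and bound: "\<And>x. x \<in> M \<Longrightarrow> cmod (\<phi> x) \<le> C * norm x"
  obtains v where "v \<in> M" "\<And>z. z \<in> M \<Longrightarrow> cinner v z = \<phi> z"
proof -
  define J where "J x = (norm x)\<^sup>2 / 2 - Re (\<phi> x)" for x
  have zero: "0 \<in> M" using M(1) complex_vec.subspace_0 by blast
  have scaleR: "r *\<^sub>R x \<in> M" "\<phi> (r *\<^sub>R x) = r * \<phi> x" if "x \<in> M" for r x
    using that scale M(1) by (auto simp: scaleR_eq_scaleC complex_vec.subspace_scale)
  have J_bound: "J x \<ge> - C\<^sup>2 / 2" if "x \<in> M" for x
  proof -
    have "Re (\<phi> x) \<le> C * norm x" using bound[OF that] complex_Re_le_cmod order_trans by blast
    moreover have "0 \<le> (norm x - C)\<^sup>2" by simp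
    ultimately show ?thesis unfolding J_def by (simp add: power2_diff algebra_simps)
  qed
  define m where "m = Inf (J ` M)"
  have bdd: "bdd_below (J ` M)" using J_bound by (auto intro!: bdd_belowI2)
  have m_le: "m \<le> J x" if "x \<in> M" for x
    unfolding m_def by (rule cINF_lower[OF bdd that])
  have "\<exists>x\<in>M. J x < m + 1 / real (Suc n)" for n
  proof -
    have "Inf (J ` M) < m + 1 / real (Suc n)" unfolding m_def by simp
    then show ?thesis using cInf_lessD[of "J ` M"] zero by blast
  qed
  then obtain x where x: "\<And>n. x n \<in> M" "\<And>n. J (x n) < m + 1 / real (Suc n)" by metis
  have mid: "(norm (u - w))\<^sup>2 \<le> 4 * (J u + J w - 2 * m)" if "u \<in> M" "w \<in> M" for u w
  proof -
    have uw: "u + w \<in> M" using that M(1) complex_vec.subspace_add by blast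
    have "m \<le> J ((1/2) *\<^sub>R (u + w))" using m_le scaleR(1) uw by blast
    also have "\<dots> = (norm (u + w))\<^sup>2 / 8 - (Re (\<phi> u) + Re (\<phi> w)) / 2"
      using arg_cong[OF scaleR(2)[OF uw, of "1/2"], of Re] add[OF that]
      by (simp add: J_def power_divide del: of_real_divide)
    finally have "m \<le> (norm (u + w))\<^sup>2 / 8 - (Re (\<phi> u) + Re (\<phi> w)) / 2" .
    moreover have "(norm (u + w))\<^sup>2 + (norm (u - w))\<^sup>2 = 2 * (norm u)\<^sup>2 + 2 * (norm w)\<^sup>2"
      by (simp add: power2_norm_eq_inner inner_add_left inner_add_right inner_diff_left
          inner_diff_right)
    ultimately show ?thesis by (simp add: J_def field_simps)
  qed
  have "Cauchy x"
  proof (rule metric_CauchyI)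
    fix \<epsilon> :: real assume "\<epsilon> > 0"
    \<comment> \<open>By \<open>mid\<close>, two terms of the sequence whose \<open>J\<close> values
      exceed the infimum by at most \<open>\<delta>\<close> have squared distance at most 8
      \<open>\<delta>\<close>.\<close>
    obtain N where N: "8 / real (Suc N) < \<epsilon>\<^sup>2"
    proof -
      have "0 < \<epsilon>\<^sup>2 / 8" using \<open>\<epsilon> > 0\<close> by simp
      then obtain n where "inverse (real (Suc n)) < \<epsilon>\<^sup>2 / 8" using reals_Archimedean by blast
      then have "8 * inverse (real (Suc n)) < \<epsilon>\<^sup>2" by linarith
      then show ?thesis using that[of n] by (simp only: divide_inverse)
    qed
    define \<delta> where "\<delta> = 1 / real (Suc N)"
    have "dist (x p) (x q) < \<epsilon>" if "p \<ge> N" "q \<ge> N" for p q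
    proof -
      have JN: "J (x n) \<le> m + \<delta>" if "n \<ge> N" for n
        unfolding \<delta>_def
        by (rule order_trans[OF less_imp_le[OF x(2)]]) (use that in \<open>auto intro!: divide_left_mono\<close>)
      have "(norm (x p - x q))\<^sup>2 \<le> 4 * (J (x p) + J (x q) - 2 * m)" using mid x(1) by blast
      also have "\<dots> \<le> 8 * \<delta>" using JN[OF that(1)] JN[OF that(2)] by simp
      also have "\<dots> < \<epsilon>\<^sup>2" using N by (simp add: \<delta>_def)
      finally show ?thesis using \<open>\<epsilon> > 0\<close> by (simp add: dist_norm power2_less_imp_less)
    qed
    then show "\<exists>N. \<forall>p\<ge>N. \<forall>q\<ge>N. dist (x p) (x q) < \<epsilon>" by blast
  qed
  then obtain v where v: "x \<longlonglongrightarrow> v" using Cauchy_convergent convergent_def by blast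
  have vM: "v \<in> M" using closed_sequentially[OF M(2)] x(1) v by blast
  have Jv: "J v \<le> m"
  proof -
    have phi: "(\<lambda>n. \<phi> (x n)) \<longlonglongrightarrow> \<phi> v"
    proof (rule Lim_null_comparison[THEN LIM_zero_cancel])
      show "\<forall>\<^sub>F n in sequentially. norm (\<phi> (x n) - \<phi> v) \<le> C * norm (x n - v)"
      proof (rule always_eventually, rule allI)
        fix n
        have "x n - v \<in> M" using x(1) vM M(1) complex_vec.subspace_diff by blast
        moreover have "\<phi> (x n) - \<phi> v = \<phi> (x n - v)"
          using add[OF \<open>x n - v \<in> M\<close> vM] by simp
        ultimately show "norm (\<phi> (x n) - \<phi> v) \<le> C * norm (x n - v)" using bound by simp
      qed
      have "(\<lambda>n. C * norm (x n - v)) \<longlonglongrightarrow> C * norm (v - v)" by (intro tendsto_intros v)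
      then show "(\<lambda>n. C * norm (x n - v)) \<longlonglongrightarrow> 0" by simp
    qed
    have "(\<lambda>n. J (x n)) \<longlonglongrightarrow> J v" unfolding J_def by (intro tendsto_intros v phi) auto
    moreover have "(\<lambda>n. m + 1 / real (Suc n)) \<longlonglongrightarrow> m + 0"
      by (intro tendsto_intros) (use LIMSEQ_Suc[OF lim_1_over_n] in simp)
    ultimately show ?thesis using x(2) LIMSEQ_le less_imp_le
      by (metis (no_types, lifting) add.right_neutral)
  qed
  \<comment> \<open>First-order condition at the minimiser:
    \<open>J (v + r *\<^sub>R z) - J v\<close> is a quadratic in \<open>r\<close> that is never
    negative, so its linear coefficient \<open>A\<close> vanishes.\<close>
  have Re_eq: "Re (cinner v z) = Re (\<phi> z)" if z: "z \<in> M" for z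
  proof -
    have "0 \<le> r * (inner v z - Re (\<phi> z)) + r\<^sup>2 * ((norm z)\<^sup>2 / 2)" for r
    proof -
      have rz: "r *\<^sub>R z \<in> M" using scaleR z by blast
      then have "v + r *\<^sub>R z \<in> M" using vM M(1) complex_vec.subspace_add by blast
      then have "J v \<le> J (v + r *\<^sub>R z)" using Jv m_le order_trans by blast
      moreover have "(norm (v + r *\<^sub>R z))\<^sup>2 = (norm v)\<^sup>2 + 2 * r * inner v z + r\<^sup>2 * (norm z)\<^sup>2"
        unfolding power2_norm_eq_inner
        by (simp add: inner_add_left inner_add_right inner_commute power2_eq_square algebra_simps)
      ultimately show ?thesis
        using add[OF vM rz] scaleR(2)[OF z, of r] by (simp add: J_def algebra_simps)
    qed
    note q = this
    define A where "A = inner v z - Re (\<phi> z)"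
    define B where "B = (norm z)\<^sup>2 / 2"
    have q': "0 \<le> r * A + r\<^sup>2 * B" for r using q[of r] by (simp add: A_def B_def)
    have "A = 0"
    proof (rule ccontr)
      assume "A \<noteq> 0"
      have B0: "B \<ge> 0" by (simp add: B_def)
      \<comment> \<open>\<open>B\<close> may be zero, so the test point is \<open>- A / D\<close>
        with \<open>D = B + 1\<close>; the quadratic there equals
        \<open>- (A\<^sup>2 / D\<^sup>2)\<close>.\<close>
      define D where "D = B + 1"
      have D: "D > 0" "B = D - 1" using B0 by (auto simp: D_def)
      have "0 \<le> (- A / D) * A + (- A / D)\<^sup>2 * B" by (rule q')
      also have "\<dots> = - (A\<^sup>2 / D\<^sup>2)"
        using D(1) unfolding D(2) by (simp add: field_simps power2_eq_square)
      finally show False using \<open>A \<noteq> 0\<close> D(1) by (simp add: divide_le_0_iff)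
    qed
    then show ?thesis by (simp add: A_def Re_cinner)
  qed
  have "cinner v z = \<phi> z" if z: "z \<in> M" for z
  proof (rule complex_eqI)
    show "Re (cinner v z) = Re (\<phi> z)" by (rule Re_eq[OF z])
    \<comment> \<open>Multiplication by \<open>- \<i>\<close> turns an imaginary part into a real
      part.\<close>
    have "(- \<i>) *\<^sub>C z \<in> M" using z M(1) complex_vec.subspace_scale by blast
    from Re_eq[OF this] show "Im (cinner v z) = Im (\<phi> z)"
      using scale[OF z, of "- \<i>"] by (simp add: cinner_scaleC_right del: complex_vec.scale_minus_left)
  qed
  with vM that show ?thesis by blast
qed

text \<open>The Riesz vector of the functional \<open>cinner x\<close> restricted to
  \<open>M\<close>.\<close>

lemma orthogonal_projection_exists:
  fixes M :: "'a::chilbert_space set"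
  assumes "csubspace M" "closed M"
  obtains p where "p \<in> M" "\<And>z. z \<in> M \<Longrightarrow> cinner p z = cinner x z"
  by (rule riesz_representation[OF assms, of "cinner x" "norm x"])
    (auto simp: cinner_add_right cinner_scaleC_right cinner_bound)

section \<open>Orthonormal families\<close>

text \<open>Indexed instead of a set, so that \<open>b\<close> and its time reversal share the index
  set on which the weights live.\<close>

definition orthonormal_family :: "'i set \<Rightarrow> ('i \<Rightarrow> 'a::chilbert_space) \<Rightarrow> bool" where
  "orthonormal_family I b \<longleftrightarrow> (\<forall>i\<in>I. \<forall>j\<in>I. cinner (b i) (b j) = (if i = j then 1 else 0))"

lemma orthonormal_familyD:
  "orthonormal_family I b \<Longrightarrow> i \<in> I \<Longrightarrow> j \<in> I \<Longrightarrow> cinner (b i) (b j) = (if i = j then 1 else 0)"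
  by (simp add: orthonormal_family_def)

lemma orthonormal_family_subset: "orthonormal_family I b \<Longrightarrow> J \<subseteq> I \<Longrightarrow> orthonormal_family J b"
  unfolding orthonormal_family_def by blast

lemma orthonormal_family_norm: "orthonormal_family I b \<Longrightarrow> i \<in> I \<Longrightarrow> norm (b i) = 1"
  by (simp add: norm_eq_1 orthonormal_familyD flip: Re_cinner)

text \<open>\<open>p z\<close> is the orthogonal projection to the span. Pythagoras gives the length
  of the residual and shows that no other \<open>y\<close> in the span is closer to
  \<open>z\<close>.\<close>

lemma orthonormal_residual:
  assumes b: "orthonormal_family F b" and F: "finite F"
  defines "p \<equiv> \<lambda>z. \<Sum>i\<in>F. cinner (b i) z *\<^sub>C b i"
  shows "y \<in> cspan (b ` F) \<Longrightarrow> cinner y (z - p z) = 0"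
    and "(norm (z - p z))\<^sup>2 = (norm z)\<^sup>2 - (\<Sum>i\<in>F. (cmod (cinner (b i) z))\<^sup>2)"
    and "y \<in> cspan (b ` F) \<Longrightarrow> (norm z)\<^sup>2 - (\<Sum>i\<in>F. (cmod (cinner (b i) z))\<^sup>2) \<le> (dist z y)\<^sup>2"
    and "p z \<in> cspan (b ` F)"
proof -
  have bp: "cinner (b j) (p z) = cinner (b j) z" if "j \<in> F" for j
  proof -
    have "cinner (b j) (p z) = (\<Sum>i\<in>F. cinner (b i) z * (if j = i then 1 else 0))"
      unfolding p_def cinner_sum_right cinner_scaleC_right
      using b that by (intro sum.cong) (auto simp: orthonormal_family_def)
    also have "\<dots> = (\<Sum>i\<in>F. if j = i then cinner (b i) z else 0)" by (intro sum.cong) auto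
    finally show ?thesis using F that by simp
  qed
  show orth: "cinner y (z - p z) = 0" if "y \<in> cspan (b ` F)" for y
    using that
    by (induction rule: complex_vec.span_induct_alt)
      (auto simp: cinner_add_left cinner_scaleC_left cinner_diff_right bp)
  show pz: "p z \<in> cspan (b ` F)"
    unfolding p_def by (intro complex_vec.span_sum complex_vec.span_scale complex_vec.span_base) auto
  have "complex_of_real ((norm (z - p z))\<^sup>2) = cinner z (z - p z)"
    using orth[OF pz] unfolding cinner_self[symmetric] cinner_diff_left by simp
  also have "\<dots> = complex_of_real ((norm z)\<^sup>2) - (\<Sum>i\<in>F. cinner (b i) z * cinner z (b i))"
    by (simp add: cinner_diff_right cinner_self p_def cinner_sum_right cinner_scaleC_right)
  also have "(\<Sum>i\<in>F. cinner (b i) z * cinner z (b i))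
      = (\<Sum>i\<in>F. complex_of_real ((cmod (cinner (b i) z))\<^sup>2))"
    by (intro sum.cong refl) (metis cinner_commute complex_norm_square)
  finally have "complex_of_real ((norm (z - p z))\<^sup>2)
      = complex_of_real ((norm z)\<^sup>2 - (\<Sum>i\<in>F. (cmod (cinner (b i) z))\<^sup>2))"
    by simp
  then show eq: "(norm (z - p z))\<^sup>2 = (norm z)\<^sup>2 - (\<Sum>i\<in>F. (cmod (cinner (b i) z))\<^sup>2)"
    using of_real_eq_iff by blast
  show "(norm z)\<^sup>2 - (\<Sum>i\<in>F. (cmod (cinner (b i) z))\<^sup>2) \<le> (dist z y)\<^sup>2"
    if y: "y \<in> cspan (b ` F)"
  proof -
    have "p z - y \<in> cspan (b ` F)" using pz y complex_vec.span_diff by blast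
    then have "Re (cinner (p z - y) (z - p z)) = 0" using orth by simp
    then have "inner (p z - y) (z - p z) = 0" by (simp add: Re_cinner)
    moreover have "z - y = (z - p z) + (p z - y)" by simp
    ultimately have "(norm (z - y))\<^sup>2 = (norm (z - p z))\<^sup>2 + (norm (p z - y))\<^sup>2"
      by (simp only: power2_norm_eq_inner inner_add_left inner_add_right inner_commute)
    then show ?thesis using eq by (simp add: dist_norm)
  qed
qed

lemma cspan_image_finite:
  assumes "y \<in> cspan (b ` I)"
  obtains F where "finite F" "F \<subseteq> I" "y \<in> cspan (b ` F)"
proof -
  from assms obtain t r where t: "finite t" "t \<subseteq> b ` I" "y = (\<Sum>a\<in>t. r a *\<^sub>C a)"
    unfolding complex_vec.span_explicit by blast
  obtain F where "F \<subseteq> I" "finite F" "t = b ` F" using finite_subset_image[OF t(1,2)] by blast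
  moreover have "y \<in> cspan t"
    unfolding t(3) by (intro complex_vec.span_sum complex_vec.span_scale complex_vec.span_base)
  ultimately show ?thesis using that by blast
qed

text \<open>Parseval with a defect, valid for incomplete families. Finite sums are bounded above
  because their residual is at least as long as the distance; a nearly closest point of the span
  involves finitely many indices, which gives the lower bound. The right-hand side depends on the
  family through its span alone.\<close>

lemma orthonormal_has_sum:
  assumes b: "orthonormal_family I b"
  shows "((\<lambda>i. (cmod (cinner (b i) z))\<^sup>2) has_sum (norm z)\<^sup>2 - (infdist z (cspan (b ` I)))\<^sup>2) I"
proof -
  define f where "f i = (cmod (cinner (b i) z))\<^sup>2" for i
  define D where "D = infdist z (cspan (b ` I))"
  have ne: "cspan (b ` I) \<noteq> {}" using complex_vec.span_zero by blast
  have upper: "sum f F \<le> (norm z)\<^sup>2 - D\<^sup>2" if F: "finite F" "F \<subseteq> I" for F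
  proof -
    define p where "p = (\<Sum>i\<in>F. cinner (b i) z *\<^sub>C b i)"
    note r = orthonormal_residual[OF orthonormal_family_subset[OF b F(2)] F(1), where z = z,
        folded p_def]
    have "p \<in> cspan (b ` I)"
      using r(4) complex_vec.span_mono[of "b ` F" "b ` I"] F(2) by blast
    then have "D \<le> norm (z - p)" unfolding D_def dist_norm[symmetric] by (rule infdist_le)
    then have "D\<^sup>2 \<le> (norm (z - p))\<^sup>2" by (intro power_mono) (auto simp: D_def infdist_nonneg)
    then show ?thesis using r(2) by (simp add: f_def)
  qed
  have "bdd_above (sum f ` {F. F \<subseteq> I \<and> finite F})"
    using upper by (intro bdd_aboveI2) auto
  then have summable: "f summable_on I"
    by (intro nonneg_bdd_above_summable_on) (auto simp: f_def)
  have le: "infsum f I \<le> (norm z)\<^sup>2 - D\<^sup>2"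
    by (rule infsum_le_finite_sums[OF summable upper])
  have lower: "(norm z)\<^sup>2 - (D + \<epsilon>)\<^sup>2 \<le> infsum f I" if "\<epsilon> > 0" for \<epsilon>
  proof -
    have "(INF a\<in>cspan (b ` I). dist z a) < D + \<epsilon>"
      using that ne by (simp add: D_def infdist_notempty)
    then obtain y where y: "y \<in> cspan (b ` I)" "dist z y < D + \<epsilon>"
      using cInf_lessD[of "dist z ` cspan (b ` I)"] ne by blast
    obtain F where F: "finite F" "F \<subseteq> I" "y \<in> cspan (b ` F)" using cspan_image_finite[OF y(1)] .
    have "(norm z)\<^sup>2 - sum f F \<le> (dist z y)\<^sup>2"
      using orthonormal_residual(3)[OF orthonormal_family_subset[OF b F(2)] F(1,3)]
      by (simp add: f_def)
    also have "\<dots> \<le> (D + \<epsilon>)\<^sup>2" using y(2) by (intro power_mono) auto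
    finally have "(norm z)\<^sup>2 - (D + \<epsilon>)\<^sup>2 \<le> sum f F" by linarith
    also have "\<dots> \<le> infsum f I"
      by (rule finite_sum_le_infsum[OF summable F(1,2)]) (simp add: f_def)
    finally show ?thesis .
  qed
  have "(\<lambda>n. (norm z)\<^sup>2 - (D + inverse (real (Suc n)))\<^sup>2) \<longlonglongrightarrow> (norm z)\<^sup>2 - (D + 0)\<^sup>2"
    by (intro tendsto_intros LIMSEQ_inverse_real_of_nat)
  then have "(norm z)\<^sup>2 - (D + 0)\<^sup>2 \<le> infsum f I"
    by (rule LIMSEQ_le_const2) (use lower in auto)
  then have "infsum f I = (norm z)\<^sup>2 - D\<^sup>2" using le by simp
  then show ?thesis using has_sum_infsum[OF summable] by (simp add: f_def[abs_def] D_def)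
qed

lemma parseval_has_sum:
  assumes "orthonormal_family I b" "z \<in> closure (cspan (b ` I))"
  shows "((\<lambda>i. (cmod (cinner (b i) z))\<^sup>2) has_sum (norm z)\<^sup>2) I"
proof -
  have "infdist z (cspan (b ` I)) = 0"
    using assms(2) in_closure_iff_infdist_zero complex_vec.span_zero by blast
  then show ?thesis using orthonormal_has_sum[OF assms(1), of z] by simp
qed

text \<open>No part of the norm is missing, so the distance in \<open>orthonormal_has_sum\<close>
  must vanish.\<close>

lemma in_closure_if_parseval:
  assumes "orthonormal_family I b" "((\<lambda>i. (cmod (cinner (b i) z))\<^sup>2) has_sum (norm z)\<^sup>2) I"
  shows "z \<in> closure (cspan (b ` I))"
proof -
  have "(norm z)\<^sup>2 = (norm z)\<^sup>2 - (infdist z (cspan (b ` I)))\<^sup>2"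
    using has_sum_unique[OF assms(2) orthonormal_has_sum[OF assms(1)]] .
  then have "infdist z (cspan (b ` I)) = 0" by simp
  then show ?thesis using in_closure_iff_infdist_zero complex_vec.span_zero by blast
qed

text \<open>Both sums are determined by the distance of \<open>z\<close> to the closed span of the subfamily, and
  the two closed spans agree since each basis vector is orthogonal to the other classes of the
  other basis.\<close>

lemma parseval_class_independent:
  assumes b: "orthonormal_family I b" "closure (cspan (b ` I)) = UNIV"
    and c: "orthonormal_family I c" "closure (cspan (c ` I)) = UNIV"
    and orth: "\<And>i j. i \<in> I \<Longrightarrow> j \<in> I \<Longrightarrow> s i \<noteq> s j \<Longrightarrow> cinner (b i) (c j) = 0"
  shows "((\<lambda>i. (cmod (cinner (b i) z))\<^sup>2) has_sum a) {i\<in>I. s i = \<sigma>} \<longleftrightarrow>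
    ((\<lambda>i. (cmod (cinner (c i) z))\<^sup>2) has_sum a) {i\<in>I. s i = \<sigma>}"
proof -
  define J where "J = {i\<in>I. s i = \<sigma>}"
  have JI: "J \<subseteq> I" by (auto simp: J_def)
  \<comment> \<open>\<open>b\<close> and \<open>c\<close> are generalised because the inclusion is
    used in both directions. Parseval for \<open>v\<close> over \<open>I\<close> loses nothing when
    cut down to \<open>J\<close>.\<close>
  have sub: "b ` J \<subseteq> closure (cspan (c ` J))"
    if b: "orthonormal_family I b" and c: "orthonormal_family I c" "closure (cspan (c ` I)) = UNIV"
    and orth: "\<And>i j. i \<in> I \<Longrightarrow> j \<in> I \<Longrightarrow> s i \<noteq> s j \<Longrightarrow> cinner (b i) (c j) = 0"
    for b c :: "'a \<Rightarrow> 'b"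
  proof
    fix v assume "v \<in> b ` J"
    then obtain i where i: "i \<in> J" "v = b i" by blast
    have "((\<lambda>j. (cmod (cinner (c j) v))\<^sup>2) has_sum (norm v)\<^sup>2) I"
      using parseval_has_sum[OF c(1)] c(2) by simp
    moreover have "cinner (c j) v = 0" if "j \<in> I - J" for j
      using orth[of i j] i that cinner_commute[of "c j" v] by (auto simp: J_def)
    ultimately have "((\<lambda>j. (cmod (cinner (c j) v))\<^sup>2) has_sum (norm v)\<^sup>2) J"
      using has_sum_cong_neutral[of J I "\<lambda>j. (cmod (cinner (c j) v))\<^sup>2"
          "\<lambda>j. (cmod (cinner (c j) v))\<^sup>2"] JI by auto
    then show "v \<in> closure (cspan (c ` J))"
      by (rule in_closure_if_parseval[OF orthonormal_family_subset[OF c(1) JI]])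
  qed
  have "b ` J \<subseteq> closure (cspan (c ` J))" by (rule sub[OF b(1) c orth])
  moreover have "c ` J \<subseteq> closure (cspan (b ` J))"
    by (rule sub[OF c(1) b]) (metis orth cinner_commute complex_cnj_zero)
  ultimately have "closure (cspan (b ` J)) = closure (cspan (c ` J))"
    by (intro equalityI subsetI)
      (erule cspan_closure_induct; simp add: csubspace_closure complex_vec.subspace_span)+
  then have "infdist z (cspan (b ` J)) = infdist z (cspan (c ` J))"
    by (metis infdist_eq_setdist setdist_closure_2)
  then show ?thesis
    using orthonormal_has_sum[OF orthonormal_family_subset[OF b(1) JI], of z]
      orthonormal_has_sum[OF orthonormal_family_subset[OF c(1) JI], of z]
    unfolding J_def[symmetric] by (metis has_sum_unique)
qed

section \<open>Unconditional sums of extended nonnegative reals\<close>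

lemma infsum_ennreal_has_sum:
  assumes "(f has_sum a) A" "\<And>x. x \<in> A \<Longrightarrow> f x \<ge> 0"
  shows "(\<Sum>\<^sub>\<infinity>x\<in>A. ennreal (f x)) = ennreal a"
proof -
  have "ennreal a = (SUP F\<in>{F. finite F \<and> F \<subseteq> A}. ennreal (sum f F))"
    using infsum_nonneg_is_SUPREMUM_ennreal[of f A] assms has_sum_imp_summable infsumI by blast
  also have "\<dots> = (SUP F\<in>{F. finite F \<and> F \<subseteq> A}. sum (\<lambda>x. ennreal (f x)) F)"
    using assms(2) by (intro SUP_cong refl) (subst sum_ennreal; auto)
  also have "\<dots> = (\<Sum>\<^sub>\<infinity>x\<in>A. ennreal (f x))"
    by (rule nonneg_infsum_complete[symmetric]) simp
  finally show ?thesis by simp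
qed

text \<open>Tonelli for sums. A finite subset meets finitely many fibres, and over finitely many
  fibres the identity is additivity on disjoint sets; monotonicity gives both inequalities.\<close>

lemma infsum_Sigma_ennreal:
  fixes f :: "'a \<times> 'b \<Rightarrow> ennreal"
  shows "infsum f (Sigma A B) = (\<Sum>\<^sub>\<infinity>x\<in>A. \<Sum>\<^sub>\<infinity>y\<in>B x. f (x, y))"
proof (rule antisym)
  have finite_part: "infsum f (Sigma G B) = (\<Sum>x\<in>G. \<Sum>\<^sub>\<infinity>y\<in>B x. f (x, y))" if "finite G" for G
    using that
  proof (induction G)
    case (insert x G)
    have "infsum f (Sigma (insert x G) B) = infsum f (Pair x ` B x \<union> Sigma G B)"
      by (intro arg_cong2[where f = infsum]) auto
    also have "\<dots> = infsum f (Pair x ` B x) + infsum f (Sigma G B)"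
      using insert.hyps by (intro infsum_Un_disjoint nonneg_summable_on_complete) auto
    also have "infsum f (Pair x ` B x) = (\<Sum>\<^sub>\<infinity>y\<in>B x. f (x, y))"
      by (subst infsum_reindex) (auto simp: inj_on_def o_def)
    finally show ?case using insert by simp
  qed simp
  have le: "infsum g C \<le> infsum g D" if "C \<subseteq> D" for g :: "'c \<Rightarrow> ennreal" and C D
    using that by (intro infsum_mono_neutral nonneg_summable_on_complete) auto
  show "infsum f (Sigma A B) \<le> (\<Sum>\<^sub>\<infinity>x\<in>A. \<Sum>\<^sub>\<infinity>y\<in>B x. f (x, y))"
  proof (rule infsum_le_finite_sums)
    fix F assume F: "finite F" "F \<subseteq> Sigma A B"
    have "F \<subseteq> Sigma (fst ` F) B" using F(2) by force
    from le[OF this, of f] have "sum f F \<le> infsum f (Sigma (fst ` F) B)" using F(1) by simp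
    also have "\<dots> = (\<Sum>x\<in>fst ` F. \<Sum>\<^sub>\<infinity>y\<in>B x. f (x, y))" using F by (intro finite_part) auto
    also have "\<dots> \<le> (\<Sum>\<^sub>\<infinity>x\<in>A. \<Sum>\<^sub>\<infinity>y\<in>B x. f (x, y))"
    proof -
      have "fst ` F \<subseteq> A" using F(2) by force
      from le[OF this, of "\<lambda>x. \<Sum>\<^sub>\<infinity>y\<in>B x. f (x, y)"] show ?thesis using F(1) by simp
    qed
    finally show "sum f F \<le> (\<Sum>\<^sub>\<infinity>x\<in>A. \<Sum>\<^sub>\<infinity>y\<in>B x. f (x, y))" .
  qed (simp add: nonneg_summable_on_complete)
  show "(\<Sum>\<^sub>\<infinity>x\<in>A. \<Sum>\<^sub>\<infinity>y\<in>B x. f (x, y)) \<le> infsum f (Sigma A B)"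
  proof (rule infsum_le_finite_sums)
    fix G assume "finite G" "G \<subseteq> A"
    then show "(\<Sum>x\<in>G. \<Sum>\<^sub>\<infinity>y\<in>B x. f (x, y)) \<le> infsum f (Sigma A B)"
      by (subst finite_part[symmetric]) (auto intro!: le)
  qed (simp add: nonneg_summable_on_complete)
qed

lemma infsum_swap_ennreal:
  fixes f :: "'a \<Rightarrow> 'b \<Rightarrow> ennreal"
  shows "(\<Sum>\<^sub>\<infinity>x\<in>A. \<Sum>\<^sub>\<infinity>y\<in>B. f x y) = (\<Sum>\<^sub>\<infinity>y\<in>B. \<Sum>\<^sub>\<infinity>x\<in>A. f x y)"
proof -
  have "(\<Sum>\<^sub>\<infinity>x\<in>A. \<Sum>\<^sub>\<infinity>y\<in>B. f x y) = infsum (\<lambda>(x, y). f x y) (A \<times> B)"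
    by (subst infsum_Sigma_ennreal) simp
  also have "\<dots> = infsum ((\<lambda>(x, y). f x y) \<circ> prod.swap) (B \<times> A)"
    by (subst infsum_reindex[symmetric]) (auto simp: inj_on_def product_swap)
  also have "\<dots> = (\<Sum>\<^sub>\<infinity>y\<in>B. \<Sum>\<^sub>\<infinity>x\<in>A. f x y)"
    by (subst infsum_Sigma_ennreal) simp
  finally show ?thesis .
qed

text \<open>The weight is constant on each level set of \<open>s\<close>, so it comes out of the sum
  over that class, whose unweighted value is the same for both bases.\<close>

lemma weighted_parseval_independent:
  assumes b: "orthonormal_family I b" "closure (cspan (b ` I)) = UNIV"
    and c: "orthonormal_family I c" "closure (cspan (c ` I)) = UNIV"
    and orth: "\<And>i j. i \<in> I \<Longrightarrow> j \<in> I \<Longrightarrow> s i \<noteq> s j \<Longrightarrow> cinner (b i) (c j) = 0"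
    and g: "\<And>\<sigma>. g \<sigma> \<ge> 0"
  shows "(\<Sum>\<^sub>\<infinity>i\<in>I. ennreal (g (s i) * (cmod (cinner (b i) z))\<^sup>2))
    = (\<Sum>\<^sub>\<infinity>i\<in>I. ennreal (g (s i) * (cmod (cinner (c i) z))\<^sup>2))"
proof -
  have split: "infsum f I = (\<Sum>\<^sub>\<infinity>\<sigma>\<in>s ` I. infsum f {i\<in>I. s i = \<sigma>})" for f :: "'a \<Rightarrow> ennreal"
  proof -
    have "infsum f I = infsum (f \<circ> snd) (SIGMA \<sigma>:s ` I. {i\<in>I. s i = \<sigma>})"
      by (rule infsum_reindex_bij_betw[of snd _ I f, symmetric, unfolded o_def[symmetric]])
        (auto simp: bij_betw_def inj_on_def image_iff)
    then show ?thesis by (simp add: infsum_Sigma_ennreal)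
  qed
  have "(\<Sum>\<^sub>\<infinity>i\<in>{i\<in>I. s i = \<sigma>}. ennreal (g (s i) * (cmod (cinner (b i) z))\<^sup>2))
      = (\<Sum>\<^sub>\<infinity>i\<in>{i\<in>I. s i = \<sigma>}. ennreal (g (s i) * (cmod (cinner (c i) z))\<^sup>2))" for \<sigma>
  proof -
    have sub: "{i\<in>I. s i = \<sigma>} \<subseteq> I" by auto
    define a where "a = (norm z)\<^sup>2 - (infdist z (cspan (b ` {i\<in>I. s i = \<sigma>})))\<^sup>2"
    have hb: "((\<lambda>i. (cmod (cinner (b i) z))\<^sup>2) has_sum a) {i\<in>I. s i = \<sigma>}"
      unfolding a_def by (rule orthonormal_has_sum[OF orthonormal_family_subset[OF b(1) sub]])
    then have hc: "((\<lambda>i. (cmod (cinner (c i) z))\<^sup>2) has_sum a) {i\<in>I. s i = \<sigma>}"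
      by (subst parseval_class_independent[OF b c, symmetric]) (use orth in blast)+
    have *: "(\<Sum>\<^sub>\<infinity>i\<in>{i\<in>I. s i = \<sigma>}. ennreal (g (s i) * (cmod (cinner (u i) z))\<^sup>2)) = ennreal (g \<sigma> * a)"
      if "((\<lambda>i. (cmod (cinner (u i) z))\<^sup>2) has_sum a) {i\<in>I. s i = \<sigma>}" for u
    proof -
      have "(\<Sum>\<^sub>\<infinity>i\<in>{i\<in>I. s i = \<sigma>}. ennreal (g (s i) * (cmod (cinner (u i) z))\<^sup>2))
          = (\<Sum>\<^sub>\<infinity>i\<in>{i\<in>I. s i = \<sigma>}. ennreal (g \<sigma> * (cmod (cinner (u i) z))\<^sup>2))"
        by (rule infsum_cong) simp
      also have "\<dots> = ennreal (g \<sigma> * a)"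
        by (rule infsum_ennreal_has_sum[OF has_sum_cmult_right[OF that]]) (simp add: g)
      finally show ?thesis .
    qed
    show ?thesis using *[OF hb] *[OF hc] by simp
  qed
  then show ?thesis
    unfolding split[of "\<lambda>i. ennreal (g (s i) * (cmod (cinner (b i) z))\<^sup>2)"]
      split[of "\<lambda>i. ennreal (g (s i) * (cmod (cinner (c i) z))\<^sup>2)"] by simp
qed

section \<open>Spectral integrals\<close>

text \<open>The inequality (p + q)^2 <= 2 p^2 + 2 q^2 stands in for Minkowski and keeps square roots
  out of \<open>ennreal\<close>.\<close>

lemma ennreal_norm_diff_square:
  "ennreal ((norm (a - c))\<^sup>2) \<le> 2 * ennreal ((norm (a - b))\<^sup>2) + 2 * ennreal ((norm (b - c))\<^sup>2)"
  for a b c :: "'a::real_normed_vector"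
proof -
  have "norm (a - c) \<le> norm (a - b) + norm (b - c)" using norm_triangle_ineq[of "a - b" "b - c"] by simp
  then have "(norm (a - c))\<^sup>2 \<le> (norm (a - b) + norm (b - c))\<^sup>2" by (intro power_mono) auto
  also have "\<dots> \<le> 2 * (norm (a - b))\<^sup>2 + 2 * (norm (b - c))\<^sup>2"
    using sum_squares_bound[of "norm (a - b)" "norm (b - c)"] by (simp add: power2_sum)
  finally have "ennreal ((norm (a - c))\<^sup>2) \<le> ennreal (2 * (norm (a - b))\<^sup>2 + 2 * (norm (b - c))\<^sup>2)"
    by (rule ennreal_leI)
  then show ?thesis by (simp add: ennreal_plus ennreal_mult)
qed

lemma nn_integral_norm_diff_square:
  fixes f g h :: "'s \<Rightarrow> complex"
  assumes [measurable]: "f \<in> borel_measurable M" "g \<in> borel_measurable M" "h \<in> borel_measurable M"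
  shows "(\<integral>\<^sup>+s. ennreal ((norm (f s - h s))\<^sup>2) \<partial>M)
    \<le> 2 * (\<integral>\<^sup>+s. ennreal ((norm (f s - g s))\<^sup>2) \<partial>M) + 2 * (\<integral>\<^sup>+s. ennreal ((norm (g s - h s))\<^sup>2) \<partial>M)"
proof -
  have "(\<integral>\<^sup>+s. ennreal ((norm (f s - h s))\<^sup>2) \<partial>M)
      \<le> (\<integral>\<^sup>+s. 2 * ennreal ((norm (f s - g s))\<^sup>2) + 2 * ennreal ((norm (g s - h s))\<^sup>2) \<partial>M)"
    by (intro nn_integral_mono ennreal_norm_diff_square)
  also have "\<dots> = 2 * (\<integral>\<^sup>+s. ennreal ((norm (f s - g s))\<^sup>2) \<partial>M)
      + 2 * (\<integral>\<^sup>+s. ennreal ((norm (g s - h s))\<^sup>2) \<partial>M)"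
    by (simp add: nn_integral_add nn_integral_cmult)
  finally show ?thesis .
qed

lemma tendsto_ennreal_norm_square:
  "(\<lambda>n. ennreal ((norm (d n))\<^sup>2)) \<longlonglongrightarrow> 0 \<longleftrightarrow> d \<longlonglongrightarrow> 0" for d :: "nat \<Rightarrow> 'a::real_normed_vector"
proof -
  have "(\<lambda>n. ennreal ((norm (d n))\<^sup>2)) \<longlonglongrightarrow> ennreal 0 \<longleftrightarrow> (\<lambda>n. (norm (d n))\<^sup>2) \<longlonglongrightarrow> 0"
    by (intro tendsto_ennreal_iff) auto
  also have "\<dots> \<longleftrightarrow> (\<lambda>n. norm (d n)) \<longlonglongrightarrow> 0"
  proof
    assume "(\<lambda>n. (norm (d n))\<^sup>2) \<longlonglongrightarrow> 0"
    from tendsto_real_sqrt[OF this] show "(\<lambda>n. norm (d n)) \<longlonglongrightarrow> 0" by simp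
  next
    assume "(\<lambda>n. norm (d n)) \<longlonglongrightarrow> 0"
    from tendsto_power[OF this, of 2] show "(\<lambda>n. (norm (d n))\<^sup>2) \<longlonglongrightarrow> 0" by simp
  qed
  finally show ?thesis by (simp add: tendsto_norm_zero_iff)
qed

definition simple_spectral_integral ::
    "(real set \<Rightarrow> 'a::chilbert_space \<Rightarrow> 'a) \<Rightarrow> (real \<Rightarrow> complex) \<Rightarrow> 'a \<Rightarrow> 'a" where
  "simple_spectral_integral E g x = (\<Sum>c\<in>range g. c *\<^sub>C E (g -` {c}) x)"

lemma sets_scalar_measure [simp, measurable_cong]: "sets (scalar_measure E x) = sets borel"
  unfolding scalar_measure_def using sets.sigma_sets_eq[of "borel :: real measure"]
  by (subst sets_measure_of) auto

lemma space_scalar_measure [simp]: "space (scalar_measure E x) = UNIV"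
  unfolding scalar_measure_def by (subst space_measure_of) auto

locale pvm =
  fixes V :: "'a::chilbert_space set" and E :: "real set \<Rightarrow> 'a \<Rightarrow> 'a"
  assumes pvm: "projection_valued_measure V E"
begin

lemma E_closed: "A \<in> sets borel \<Longrightarrow> x \<in> V \<Longrightarrow> E A x \<in> V"
  using pvm unfolding projection_valued_measure_def orth_projection_def by blast

lemma E_UNIV: "x \<in> V \<Longrightarrow> E UNIV x = x"
  using pvm unfolding projection_valued_measure_def by blast

lemma E_Int: "A \<in> sets borel \<Longrightarrow> B \<in> sets borel \<Longrightarrow> x \<in> V \<Longrightarrow> E A (E B x) = E (A \<inter> B) x"
  using pvm unfolding projection_valued_measure_def by metis

lemma E_sums:
  "range A \<subseteq> sets borel \<Longrightarrow> disjoint_family A \<Longrightarrow> x \<in> V \<Longrightarrow> (\<lambda>n::nat. E (A n) x) sums E (\<Union>n. A n) x"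
  using pvm unfolding projection_valued_measure_def by blast

text \<open>\<open>E A x\<close> and \<open>E A y\<close> lie in the range \<open>M\<close>, and
  both residuals are orthogonal to it.\<close>

lemma E_adjoint:
  assumes "A \<in> sets borel" "x \<in> V" "y \<in> V"
  shows "cinner (E A x) y = cinner x (E A y)"
proof -
  obtain M where M: "\<And>z. z \<in> V \<Longrightarrow> E A z \<in> M" "\<And>z m. z \<in> V \<Longrightarrow> m \<in> M \<Longrightarrow> cinner m (z - E A z) = 0"
    using pvm assms(1) unfolding projection_valued_measure_def orth_projection_def by meson
  have "cinner (E A x) (y - E A y) = 0" using M assms by blast
  moreover have "cinner (E A y) (x - E A x) = 0" using M assms by blast
  then have "cinner (x - E A x) (E A y) = 0" by (metis cinner_commute complex_cnj_zero)
  ultimately show ?thesis by (simp add: cinner_diff_left cinner_diff_right)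
qed

text \<open>Infinitely many copies of the empty set are disjoint, and a convergent series with
  constant terms has terms zero.\<close>

lemma E_empty: assumes "x \<in> V" shows "E {} x = 0"
proof -
  have "(\<lambda>n::nat. E {} x) sums E (\<Union>n::nat. {}) x"
    using assms by (intro E_sums) (auto simp: disjoint_family_on_def)
  then have "(\<lambda>n::nat. E {} x) \<longlonglongrightarrow> 0" using summable_LIMSEQ_zero sums_summable by blast
  then show ?thesis by (simp add: LIMSEQ_const_iff)
qed

lemma E_Un:
  assumes AB: "A \<in> sets borel" "B \<in> sets borel" "A \<inter> B = {}" and x: "x \<in> V"
  shows "E (A \<union> B) x = E A x + E B x"
proof -
  define F where "F n = (if n = 0 then A else if n = 1 then B else {})" for n :: nat
  have "(\<lambda>n. E (F n) x) sums E (\<Union>n. F n) x"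
    using AB x by (intro E_sums) (auto simp: F_def disjoint_family_on_def)
  moreover have "(\<Union>n. F n) = A \<union> B"
    by (auto simp: F_def split: if_splits intro: exI[of _ "0::nat"] exI[of _ "1::nat"])
  moreover have "(\<lambda>n. E (F n) x) sums (\<Sum>n\<in>{0, 1}. E (F n) x)"
    by (intro sums_finite) (auto simp: F_def E_empty x)
  ultimately show ?thesis using sums_unique2 by (fastforce simp: F_def)
qed

lemma E_UN_finite:
  assumes "finite I" "\<And>i. i \<in> I \<Longrightarrow> F i \<in> sets borel" "disjoint_family_on F I" and x: "x \<in> V"
  shows "E (\<Union>i\<in>I. F i) x = (\<Sum>i\<in>I. E (F i) x)"
  using assms(1-3)
proof (induction I)
  case (insert i I)
  have "F i \<inter> (\<Union>j\<in>I. F j) = {}" using insert by (auto simp: disjoint_family_on_def)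
  moreover have "(\<Union>j\<in>I. F j) \<in> sets borel" using insert by (intro sets.finite_UN) auto
  ultimately have "E (F i \<union> (\<Union>j\<in>I. F j)) x = E (F i) x + E (\<Union>j\<in>I. F j) x"
    using insert x by (intro E_Un) auto
  moreover have "disjoint_family_on F I" using insert by (auto simp: disjoint_family_on_def)
  ultimately show ?case using insert by simp
qed (simp add: E_empty x)

lemma E_orthogonal:
  assumes "A \<in> sets borel" "B \<in> sets borel" "A \<inter> B = {}" "x \<in> V" "y \<in> V"
  shows "cinner (E A x) (E B y) = 0"
  using E_adjoint[OF assms(1,4) E_closed[OF assms(2,5)]] E_Int[OF assms(1,2,5)] assms E_empty
  by simp

lemma norm_sum_E:
  assumes "finite I" "\<And>i. i \<in> I \<Longrightarrow> F i \<in> sets borel" "disjoint_family_on F I" and x: "x \<in> V"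
  shows "(norm (\<Sum>i\<in>I. c i *\<^sub>C E (F i) x))\<^sup>2 = (\<Sum>i\<in>I. (cmod (c i))\<^sup>2 * (norm (E (F i) x))\<^sup>2)"
proof -
  have "complex_of_real ((norm (\<Sum>i\<in>I. c i *\<^sub>C E (F i) x))\<^sup>2)
      = (\<Sum>i\<in>I. \<Sum>j\<in>I. cnj (c j) * (c i * cinner (E (F j) x) (E (F i) x)))"
    unfolding cinner_self[symmetric]
    by (simp add: cinner_sum_left cinner_sum_right cinner_scaleC_left cinner_scaleC_right
        sum_distrib_left mult.left_commute)
  also have "\<dots> = (\<Sum>i\<in>I. \<Sum>j\<in>I. if i = j then complex_of_real ((cmod (c i))\<^sup>2 * (norm (E (F i) x))\<^sup>2) else 0)"
  proof (intro sum.cong refl)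
    fix i j assume ij: "i \<in> I" "j \<in> I"
    show "cnj (c j) * (c i * cinner (E (F j) x) (E (F i) x)) =
      (if i = j then complex_of_real ((cmod (c i))\<^sup>2 * (norm (E (F i) x))\<^sup>2) else 0)"
    proof (cases "i = j")
      case True
      have "cnj (c i) * c i = complex_of_real ((cmod (c i))\<^sup>2)"
        by (metis complex_norm_square mult.commute)
      then show ?thesis using True by (simp add: cinner_self mult.assoc[symmetric])
    next
      case False
      then have "F j \<inter> F i = {}" using assms(3) ij by (auto simp: disjoint_family_on_def)
      then show ?thesis using False E_orthogonal[of "F j" "F i" x x] ij assms by simp
    qed
  qed
  also have "\<dots> = complex_of_real (\<Sum>i\<in>I. (cmod (c i))\<^sup>2 * (norm (E (F i) x))\<^sup>2)"
    using assms(1) by simp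
  finally show ?thesis using of_real_eq_iff by blast
qed

text \<open>\<open>measure_of\<close> returns the prescribed values once the set function is
  countably additive. This is Pythagoras for the partial sums of orthogonal vectors, followed by
  continuity of the norm.\<close>

lemma emeasure_scalar_measure:
  assumes x: "x \<in> V" and A: "A \<in> sets borel"
  shows "emeasure (scalar_measure E x) A = ennreal ((norm (E A x))\<^sup>2)"
proof (rule emeasure_measure_of[OF scalar_measure_def])
  show "sets borel \<subseteq> Pow (UNIV :: real set)" by simp
  show "A \<in> sets (scalar_measure E x)" using A by simp
  show "positive (sets (scalar_measure E x)) (\<lambda>A. ennreal ((norm (E A x))\<^sup>2))"
    by (simp add: positive_def E_empty x)
  show "countably_additive (sets (scalar_measure E x)) (\<lambda>A. ennreal ((norm (E A x))\<^sup>2))"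
  proof (rule countably_additiveI)
    fix F :: "nat \<Rightarrow> real set"
    assume "range F \<subseteq> sets (scalar_measure E x)" and disj: "disjoint_family F"
    then have F: "range F \<subseteq> sets borel" by simp
    have "(\<lambda>n. E (F n) x) sums E (\<Union>n. F n) x" by (rule E_sums[OF F disj x])
    then have "(\<lambda>n. (norm (\<Sum>i<n. E (F i) x))\<^sup>2) \<longlonglongrightarrow> (norm (E (\<Union>n. F n) x))\<^sup>2"
      unfolding sums_def by (intro tendsto_intros)
    moreover have "(norm (\<Sum>i<n. E (F i) x))\<^sup>2 = (\<Sum>i<n. (norm (E (F i) x))\<^sup>2)" for n
      using norm_sum_E[of "{..<n}" F x "\<lambda>_. 1"] F disj x
      by (auto simp: scaleC_one disjoint_family_on_def)
    ultimately have "(\<lambda>n. (norm (E (F n) x))\<^sup>2) sums (norm (E (\<Union>n. F n) x))\<^sup>2"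
      unfolding sums_def by simp
    then show "(\<Sum>n. ennreal ((norm (E (F n) x))\<^sup>2)) = ennreal ((norm (E (\<Union>n. F n) x))\<^sup>2)"
      by (intro suminf_ennreal_eq) auto
  qed
qed

text \<open>The level sets of \<open>p\<close> may be finer than those of the composite, so one
  partition can serve several simple functions at once.\<close>

lemma simple_spectral_integral_comp:
  assumes p: "simple_function borel p" and x: "x \<in> V"
  shows "simple_spectral_integral E (\<lambda>s. h (p s)) x = (\<Sum>r\<in>range p. h r *\<^sub>C E (p -` {r}) x)"
proof -
  have fin: "finite (range p)" using simple_functionD(1)[OF p] by simp
  have meas: "p -` {r} \<in> sets borel" for r using simple_functionD(2)[OF p, of "{r}"] by simp
  have "(\<Sum>r\<in>range p. h r *\<^sub>C E (p -` {r}) x)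
      = (\<Sum>c\<in>h ` range p. \<Sum>r\<in>{r\<in>range p. h r = c}. h r *\<^sub>C E (p -` {r}) x)"
    by (rule sum.image_gen[OF fin])
  also have "\<dots> = (\<Sum>c\<in>range (\<lambda>s. h (p s)). c *\<^sub>C E ((\<lambda>s. h (p s)) -` {c}) x)"
  proof (rule sum.cong)
    show "h ` range p = range (\<lambda>s. h (p s))" by auto
    fix c
    have "(\<lambda>s. h (p s)) -` {c} = (\<Union>r\<in>{r\<in>range p. h r = c}. p -` {r})" by auto
    then have "E ((\<lambda>s. h (p s)) -` {c}) x = (\<Sum>r\<in>{r\<in>range p. h r = c}. E (p -` {r}) x)"
      using E_UN_finite[of "{r\<in>range p. h r = c}" "\<lambda>r. p -` {r}" x] fin meas x
      by (auto simp: disjoint_family_on_def)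
    then show "(\<Sum>r\<in>{r\<in>range p. h r = c}. h r *\<^sub>C E (p -` {r}) x) = c *\<^sub>C E ((\<lambda>s. h (p s)) -` {c}) x"
      by (simp add: complex_vec.scale_sum_right)
  qed
  finally show ?thesis by (simp add: simple_spectral_integral_def)
qed

text \<open>The isometry between mean-square distance and distance of vectors, the engine of this
  section. The pair \<open>p\<close> provides a common refinement of the level sets of
  \<open>g\<close> and \<open>h\<close>, on which the spectral pieces are orthogonal.\<close>

lemma norm_simple_spectral_integral_diff:
  assumes g: "simple_function borel g" and h: "simple_function borel h" and x: "x \<in> V"
  shows "ennreal ((norm (simple_spectral_integral E g x - simple_spectral_integral E h x))\<^sup>2)
    = (\<integral>\<^sup>+s. ennreal ((norm (g s - h s))\<^sup>2) \<partial>scalar_measure E x)"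
proof -
  define p where "p s = (g s, h s)" for s
  have p: "simple_function borel p" unfolding p_def by (intro simple_function_Pair g h)
  have fin: "finite (range p)" using simple_functionD(1)[OF p] by simp
  have meas: "p -` {r} \<in> sets borel" for r using simple_functionD(2)[OF p, of "{r}"] by simp
  have "simple_spectral_integral E g x - simple_spectral_integral E h x
      = (\<Sum>r\<in>range p. (fst r - snd r) *\<^sub>C E (p -` {r}) x)"
    using simple_spectral_integral_comp[OF p x, of fst] simple_spectral_integral_comp[OF p x, of snd]
    by (simp add: p_def[abs_def] complex_vec.scale_left_diff_distrib sum_subtractf)
  moreover have "disjoint_family_on (\<lambda>r. p -` {r}) (range p)" by (auto simp: disjoint_family_on_def)
  ultimately have "(norm (simple_spectral_integral E g x - simple_spectral_integral E h x))\<^sup>2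
      = (\<Sum>r\<in>range p. (cmod (fst r - snd r))\<^sup>2 * (norm (E (p -` {r}) x))\<^sup>2)"
    using norm_sum_E[of "range p" "\<lambda>r. p -` {r}" x "\<lambda>r. fst r - snd r"] fin meas x by simp
  then have "ennreal ((norm (simple_spectral_integral E g x - simple_spectral_integral E h x))\<^sup>2)
      = (\<Sum>r\<in>range p. ennreal ((cmod (fst r - snd r))\<^sup>2) * emeasure (scalar_measure E x) (p -` {r}))"
    by (simp add: emeasure_scalar_measure x meas sum_ennreal flip: ennreal_mult)
  also have "\<dots> = (\<Sum>r\<in>range p. \<integral>\<^sup>+s. ennreal ((cmod (fst r - snd r))\<^sup>2) * indicator (p -` {r}) s
      \<partial>scalar_measure E x)"
    by (intro sum.cong refl nn_integral_cmult_indicator[symmetric]) (simp add: meas)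
  also have "\<dots> = (\<integral>\<^sup>+s. (\<Sum>r\<in>range p. ennreal ((cmod (fst r - snd r))\<^sup>2) * indicator (p -` {r}) s)
      \<partial>scalar_measure E x)"
    using meas
    by (intro nn_integral_sum[symmetric] borel_measurable_times_ennreal borel_measurable_indicator) auto
  also have "\<dots> = (\<integral>\<^sup>+s. ennreal ((norm (g s - h s))\<^sup>2) \<partial>scalar_measure E x)"
  proof (rule nn_integral_cong)
    fix s
    have "(\<Sum>r\<in>range p. ennreal ((cmod (fst r - snd r))\<^sup>2) * indicator (p -` {r}) s)
        = (\<Sum>r\<in>range p. if p s = r then ennreal ((cmod (fst r - snd r))\<^sup>2) else 0)"
      by (intro sum.cong) (auto simp: indicator_def)
    then show "(\<Sum>r\<in>range p. ennreal ((cmod (fst r - snd r))\<^sup>2) * indicator (p -` {r}) s)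
        = ennreal ((norm (g s - h s))\<^sup>2)"
      using fin by (simp add: p_def)
  qed
  finally show ?thesis .
qed

lemma simple_spectral_integral_const: "x \<in> V \<Longrightarrow> simple_spectral_integral E (\<lambda>_. c) x = c *\<^sub>C x"
  by (simp add: simple_spectral_integral_def E_UNIV)

lemma mem_spectral_integral_iff:
  "(x, y) \<in> spectral_integral V E f \<longleftrightarrow> x \<in> V \<and> (\<exists>g :: nat \<Rightarrow> real \<Rightarrow> complex.
     (\<forall>n. simple_function borel (g n)) \<and>
     (\<lambda>n. \<integral>\<^sup>+s. ennreal ((norm (f s - g n s))\<^sup>2) \<partial>scalar_measure E x) \<longlonglongrightarrow> 0 \<and>
     (\<lambda>n. simple_spectral_integral E (g n) x) \<longlonglongrightarrow> y)"
  by (simp add: spectral_integral_def simple_spectral_integral_def)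

lemma finite_nn_integral_simple:
  assumes g: "simple_function borel (g :: real \<Rightarrow> complex)" and x: "x \<in> V"
  shows "(\<integral>\<^sup>+s. ennreal ((norm (g s))\<^sup>2) \<partial>scalar_measure E x) < \<infinity>"
  using norm_simple_spectral_integral_diff[OF g simple_function_const x, of 0]
  by (metis (no_types, lifting) diff_zero ennreal_less_top infinity_ennreal_def nn_integral_cong)

lemma measurable_scalar [measurable (raw)]:
  "f \<in> borel_measurable borel \<Longrightarrow> f \<in> borel_measurable (scalar_measure E x)"
  by (simp add: measurable_cong_sets[OF sets_scalar_measure refl])

lemma spectral_integral_square_integrable:
  assumes xy: "(x, y) \<in> spectral_integral V E f" and [measurable]: "f \<in> borel_measurable borel"
  shows "(\<integral>\<^sup>+s. ennreal ((norm (f s))\<^sup>2) \<partial>scalar_measure E x) < \<infinity>"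
proof -
  let ?M = "scalar_measure E x"
  obtain g :: "nat \<Rightarrow> real \<Rightarrow> complex" where x: "x \<in> V" and g: "\<And>n. simple_function borel (g n)"
    and lim: "(\<lambda>n. \<integral>\<^sup>+s. ennreal ((norm (f s - g n s))\<^sup>2) \<partial>?M) \<longlonglongrightarrow> 0"
    using xy unfolding mem_spectral_integral_iff by blast
  have [measurable]: "g n \<in> borel_measurable borel" for n using g borel_measurable_simple_function by blast
  have "\<forall>\<^sub>F n in sequentially. (\<integral>\<^sup>+s. ennreal ((norm (f s - g n s))\<^sup>2) \<partial>?M) < 1"
    by (rule order_tendstoD[OF lim]) simp
  then obtain n where n: "(\<integral>\<^sup>+s. ennreal ((norm (f s - g n s))\<^sup>2) \<partial>?M) < 1"
    by (meson eventually_happens trivial_limit_sequentially)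
  have "(\<integral>\<^sup>+s. ennreal ((norm (f s - 0))\<^sup>2) \<partial>?M) \<le> 2 * (\<integral>\<^sup>+s. ennreal ((norm (f s - g n s))\<^sup>2) \<partial>?M)
      + 2 * (\<integral>\<^sup>+s. ennreal ((norm (g n s - 0))\<^sup>2) \<partial>?M)"
    by (rule nn_integral_norm_diff_square) measurable
  also have "\<dots> < \<infinity>"
    using n finite_nn_integral_simple[OF g x, of n]
    by (auto simp: less_top[symmetric] ennreal_mult_eq_top_iff)
  finally show ?thesis by simp
qed

text \<open>The approximating sequence does not depend on \<open>x\<close>, so the same one can be
  used for several vectors.\<close>

lemma dominated_simple_approximation:
  assumes [measurable]: "f \<in> borel_measurable borel" and F: "\<And>n. simple_function borel (F n)"
    and lim: "\<And>s. (\<lambda>n. F n s) \<longlonglongrightarrow> f s" and dom: "\<And>n s. norm (F n s) \<le> 2 * norm (f s)"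
    and fin: "(\<integral>\<^sup>+s. ennreal ((norm (f s))\<^sup>2) \<partial>scalar_measure E x) < \<infinity>"
  shows "(\<lambda>n. \<integral>\<^sup>+s. ennreal ((norm (f s - F n s :: complex))\<^sup>2) \<partial>scalar_measure E x) \<longlonglongrightarrow> 0"
proof -
  let ?M = "scalar_measure E x"
  have [measurable]: "F n \<in> borel_measurable borel" for n using F borel_measurable_simple_function by blast
  have "(\<lambda>n. \<integral>\<^sup>+s. ennreal ((norm (f s - F n s))\<^sup>2) \<partial>?M) \<longlonglongrightarrow> (\<integral>\<^sup>+s. 0 \<partial>?M)"
  \<comment> \<open>The distance of \<open>f s\<close> to \<open>F n s\<close> is at most three
    times the modulus of \<open>f s\<close>; hence the factor 9.\<close>
  proof (rule nn_integral_dominated_convergence[where w = "\<lambda>s. 9 * ennreal ((norm (f s))\<^sup>2)"])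
    show "AE s in ?M. ennreal ((norm (f s - F n s))\<^sup>2) \<le> 9 * ennreal ((norm (f s))\<^sup>2)" for n
    proof (rule AE_I2)
      fix s
      have "norm (f s - F n s) \<le> 3 * norm (f s)"
        using norm_triangle_ineq4[of "f s" "F n s"] dom[of n s] by linarith
      then have "(norm (f s - F n s))\<^sup>2 \<le> (3 * norm (f s))\<^sup>2" by (intro power_mono) auto
      then have "ennreal ((norm (f s - F n s))\<^sup>2) \<le> ennreal (9 * (norm (f s))\<^sup>2)"
        by (intro ennreal_leI) (simp add: power_mult_distrib)
      then show "ennreal ((norm (f s - F n s))\<^sup>2) \<le> 9 * ennreal ((norm (f s))\<^sup>2)"
        by (simp add: ennreal_mult)
    qed
    show "(\<integral>\<^sup>+s. 9 * ennreal ((norm (f s))\<^sup>2) \<partial>?M) < \<infinity>"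
      using fin by (simp add: nn_integral_cmult ennreal_mult_eq_top_iff less_top[symmetric])
    show "AE s in ?M. (\<lambda>n. ennreal ((norm (f s - F n s))\<^sup>2)) \<longlonglongrightarrow> 0"
    proof (rule AE_I2)
      fix s
      have "(\<lambda>n. f s - F n s) \<longlonglongrightarrow> f s - f s" by (intro tendsto_intros lim)
      then show "(\<lambda>n. ennreal ((norm (f s - F n s))\<^sup>2)) \<longlonglongrightarrow> 0"
        by (simp add: tendsto_ennreal_norm_square)
    qed
  qed measurable
  then show ?thesis by simp
qed

text \<open>The definition only promises some approximating sequence. By the isometry, any other
  mean-square approximation has the same limit.\<close>

lemma spectral_integral_limit:
  assumes xy: "(x, y) \<in> spectral_integral V E f" and [measurable]: "f \<in> borel_measurable borel"
    and F: "\<And>n. simple_function borel (F n)"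
    and lim: "(\<lambda>n. \<integral>\<^sup>+s. ennreal ((norm (f s - F n s))\<^sup>2) \<partial>scalar_measure E x) \<longlonglongrightarrow> 0"
  shows "(\<lambda>n. simple_spectral_integral E (F n) x) \<longlonglongrightarrow> y"
proof -
  let ?M = "scalar_measure E x"
  obtain g :: "nat \<Rightarrow> real \<Rightarrow> complex" where x: "x \<in> V" and g: "\<And>n. simple_function borel (g n)"
    and glim: "(\<lambda>n. \<integral>\<^sup>+s. ennreal ((norm (f s - g n s))\<^sup>2) \<partial>?M) \<longlonglongrightarrow> 0"
    and y: "(\<lambda>n. simple_spectral_integral E (g n) x) \<longlonglongrightarrow> y"
    using xy unfolding mem_spectral_integral_iff by blast
  have [measurable]: "g n \<in> borel_measurable borel" "F n \<in> borel_measurable borel" for n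
    using g F borel_measurable_simple_function by blast+
  have "(\<lambda>n. ennreal ((norm (simple_spectral_integral E (F n) x - simple_spectral_integral E (g n) x))\<^sup>2)) \<longlonglongrightarrow> 0"
  proof (rule tendsto_sandwich[OF always_eventually always_eventually tendsto_const])
    show "\<forall>n. ennreal ((norm (simple_spectral_integral E (F n) x - simple_spectral_integral E (g n) x))\<^sup>2)
        \<le> 2 * (\<integral>\<^sup>+s. ennreal ((norm (f s - F n s))\<^sup>2) \<partial>?M)
          + 2 * (\<integral>\<^sup>+s. ennreal ((norm (f s - g n s))\<^sup>2) \<partial>?M)"
    proof
      fix n
      have "(\<integral>\<^sup>+s. ennreal ((norm (F n s - g n s))\<^sup>2) \<partial>?M)
          \<le> 2 * (\<integral>\<^sup>+s. ennreal ((norm (F n s - f s))\<^sup>2) \<partial>?M)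
            + 2 * (\<integral>\<^sup>+s. ennreal ((norm (f s - g n s))\<^sup>2) \<partial>?M)"
        by (rule nn_integral_norm_diff_square) measurable
      then show "ennreal ((norm (simple_spectral_integral E (F n) x - simple_spectral_integral E (g n) x))\<^sup>2)
        \<le> 2 * (\<integral>\<^sup>+s. ennreal ((norm (f s - F n s))\<^sup>2) \<partial>?M)
          + 2 * (\<integral>\<^sup>+s. ennreal ((norm (f s - g n s))\<^sup>2) \<partial>?M)"
        by (simp add: norm_simple_spectral_integral_diff F g x norm_minus_commute)
    qed
    have "(\<lambda>n. 2 * (\<integral>\<^sup>+s. ennreal ((norm (f s - F n s))\<^sup>2) \<partial>?M)
          + 2 * (\<integral>\<^sup>+s. ennreal ((norm (f s - g n s))\<^sup>2) \<partial>?M)) \<longlonglongrightarrow> 2 * 0 + 2 * 0"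
      by (intro tendsto_add ennreal_tendsto_cmult lim glim) auto
    then show "(\<lambda>n. 2 * (\<integral>\<^sup>+s. ennreal ((norm (f s - F n s))\<^sup>2) \<partial>?M)
          + 2 * (\<integral>\<^sup>+s. ennreal ((norm (f s - g n s))\<^sup>2) \<partial>?M)) \<longlonglongrightarrow> 0" by simp
  qed simp
  then have "(\<lambda>n. simple_spectral_integral E (F n) x - simple_spectral_integral E (g n) x) \<longlonglongrightarrow> 0"
    by (simp add: tendsto_ennreal_norm_square)
  from tendsto_add[OF this y] show ?thesis by simp
qed

text \<open>A single pointwise approximation with \<open>\<bar>F n\<bar> \<le> 2 \<bar>f\<bar>\<close> converges in mean square for the scalar
  measures of all vectors of the domain at once, so it can be used for both sides.\<close>

lemma spectral_integral_adjoint: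
  assumes [measurable]: "f \<in> borel_measurable borel"
    and xy: "(x, y) \<in> spectral_integral V E f"
    and xy': "(x', y') \<in> spectral_integral V E (\<lambda>s. cnj (f s))"
  shows "cinner y x' = cinner x y'"
proof -
  obtain F where F: "\<And>n. simple_function borel (F n)" "\<And>s. (\<lambda>n. F n s) \<longlonglongrightarrow> f s"
    "\<And>n s. norm (F n s) \<le> 2 * norm (f s)"
    using borel_measurable_implies_sequence_metric[of f borel 0] by auto
  have cnj: "(\<lambda>s. cnj (f s)) \<in> borel_measurable borel"
    by (intro measurable_compose[OF assms(1)] borel_measurable_continuous_onI continuous_intros)
  have x: "x \<in> V" "x' \<in> V" using xy xy' by (auto simp: mem_spectral_integral_iff)
  have F': "simple_function borel (\<lambda>s. cnj (F n s))" for n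
    using simple_function_compose1[OF F(1), of cnj] .
  have "(\<lambda>n. simple_spectral_integral E (F n) x) \<longlonglongrightarrow> y"
    using F spectral_integral_square_integrable[OF xy]
    by (intro spectral_integral_limit[OF xy] dominated_simple_approximation) auto
  then have "(\<lambda>n. cinner (simple_spectral_integral E (F n) x) x') \<longlonglongrightarrow> cinner y x'"
    by (intro tendsto_intros)
  moreover have "(\<lambda>n. simple_spectral_integral E (\<lambda>s. cnj (F n s)) x') \<longlonglongrightarrow> y'"
    using F F' cnj spectral_integral_square_integrable[OF xy' cnj]
    by (intro spectral_integral_limit[OF xy'] dominated_simple_approximation)
      (auto intro!: tendsto_cnj)
  then have "(\<lambda>n. cinner x (simple_spectral_integral E (\<lambda>s. cnj (F n s)) x')) \<longlonglongrightarrow> cinner x y'"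
    by (intro tendsto_intros)
  moreover have "cinner (simple_spectral_integral E (F n) x) x'
      = cinner x (simple_spectral_integral E (\<lambda>s. cnj (F n s)) x')" for n
    using simple_functionD(2)[OF F(1)] x
    by (subst simple_spectral_integral_comp[OF F(1) x(2), of cnj])
      (simp add: simple_spectral_integral_def cinner_sum_left cinner_sum_right cinner_scaleC_left
        cinner_scaleC_right E_adjoint)
  ultimately show ?thesis using LIMSEQ_unique by auto
qed

text \<open>The scalar measures are finite, so a bounded function is square integrable; the isometry
  makes the simple integrals Cauchy.\<close>

lemma spectral_integral_total:
  assumes [measurable]: "f \<in> borel_measurable borel" and bounded: "\<And>s. cmod (f s) \<le> C" and x: "x \<in> V"
  shows "\<exists>y. (x, y) \<in> spectral_integral V E f"
proof -
  let ?M = "scalar_measure E x"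
  obtain F where F: "\<And>n. simple_function borel (F n)" "\<And>s. (\<lambda>n. F n s) \<longlonglongrightarrow> f s"
    "\<And>n s. norm (F n s) \<le> 2 * norm (f s)"
    using borel_measurable_implies_sequence_metric[of f borel 0] by auto
  have [measurable]: "F n \<in> borel_measurable borel" for n using F borel_measurable_simple_function by blast
  have "(\<integral>\<^sup>+s. ennreal ((norm (f s))\<^sup>2) \<partial>?M) \<le> (\<integral>\<^sup>+s. ennreal (C\<^sup>2) \<partial>?M)"
    using bounded by (intro nn_integral_mono ennreal_leI power_mono) auto
  also have "\<dots> < \<infinity>"
    using emeasure_scalar_measure[OF x, of UNIV] by (simp add: ennreal_mult_less_top)
  finally have lim: "(\<lambda>n. \<integral>\<^sup>+s. ennreal ((norm (f s - F n s))\<^sup>2) \<partial>?M) \<longlonglongrightarrow> 0"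
    using F by (intro dominated_simple_approximation) auto
  have "Cauchy (\<lambda>n. simple_spectral_integral E (F n) x)"
  proof (rule metric_CauchyI)
    fix \<epsilon> :: real assume \<epsilon>: "\<epsilon> > 0"
    \<comment> \<open>Two errors, each counted with the factor 2, add up to half of
      \<open>\<epsilon>\<^sup>2\<close>.\<close>
    have "\<forall>\<^sub>F n in sequentially. (\<integral>\<^sup>+s. ennreal ((norm (f s - F n s))\<^sup>2) \<partial>?M) < ennreal (\<epsilon>\<^sup>2 / 8)"
      using \<epsilon> by (intro order_tendstoD[OF lim]) simp
    then obtain N where N: "\<And>n. n \<ge> N \<Longrightarrow> (\<integral>\<^sup>+s. ennreal ((norm (f s - F n s))\<^sup>2) \<partial>?M) < ennreal (\<epsilon>\<^sup>2 / 8)"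
      unfolding eventually_sequentially by blast
    have "dist (simple_spectral_integral E (F m) x) (simple_spectral_integral E (F n) x) < \<epsilon>"
      if mn: "m \<ge> N" "n \<ge> N" for m n
    proof -
      have "(\<integral>\<^sup>+s. ennreal ((norm (F m s - F n s))\<^sup>2) \<partial>?M)
          \<le> 2 * (\<integral>\<^sup>+s. ennreal ((norm (F m s - f s))\<^sup>2) \<partial>?M)
            + 2 * (\<integral>\<^sup>+s. ennreal ((norm (f s - F n s))\<^sup>2) \<partial>?M)"
        by (rule nn_integral_norm_diff_square) measurable
      also have "\<dots> \<le> 2 * ennreal (\<epsilon>\<^sup>2 / 8) + 2 * ennreal (\<epsilon>\<^sup>2 / 8)"
        using N[OF mn(1)] N[OF mn(2)]
        by (intro add_mono mult_left_mono less_imp_le) (auto simp: norm_minus_commute)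
      also have "\<dots> = ennreal (2 * (\<epsilon>\<^sup>2 / 8) + 2 * (\<epsilon>\<^sup>2 / 8))"
      proof -
        have "2 * ennreal (\<epsilon>\<^sup>2 / 8) = ennreal (2 * (\<epsilon>\<^sup>2 / 8))"
          using ennreal_mult[of 2 "\<epsilon>\<^sup>2 / 8"] by simp
        moreover have "ennreal (2 * (\<epsilon>\<^sup>2 / 8) + 2 * (\<epsilon>\<^sup>2 / 8))
            = ennreal (2 * (\<epsilon>\<^sup>2 / 8)) + ennreal (2 * (\<epsilon>\<^sup>2 / 8))"
          by (rule ennreal_plus) auto
        ultimately show ?thesis by (simp only:)
      qed
      also have "\<dots> < ennreal (\<epsilon>\<^sup>2)" using \<epsilon> by (intro ennreal_lessI) auto
      finally have "(norm (simple_spectral_integral E (F m) x - simple_spectral_integral E (F n) x))\<^sup>2 < \<epsilon>\<^sup>2"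
        by (simp add: ennreal_less_iff flip: norm_simple_spectral_integral_diff[OF F(1) F(1) x])
      then show ?thesis using \<epsilon> by (simp add: dist_norm power2_less_imp_less)
    qed
    then show "\<exists>N. \<forall>m\<ge>N. \<forall>n\<ge>N. dist (simple_spectral_integral E (F m) x)
        (simple_spectral_integral E (F n) x) < \<epsilon>" by blast
  qed
  then obtain y where "(\<lambda>n. simple_spectral_integral E (F n) x) \<longlonglongrightarrow> y"
    using Cauchy_convergent convergent_def by blast
  then show ?thesis unfolding mem_spectral_integral_iff using x F(1) lim by blast
qed

text \<open>Applied against the constant function \<open>e\<close>, the isometry shows that the
  integral of (s - e)^2 vanishes. The scalar measure of \<open>v\<close> therefore sits at the point
  \<open>e\<close>, where \<open>f\<close> cannot be told from the constant
  \<open>f e\<close>.\<close>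

lemma spectral_integral_eigenvector:
  assumes v: "(v, complex_of_real e *\<^sub>C v) \<in> spectral_integral V E complex_of_real"
  shows "(v, f e *\<^sub>C v) \<in> spectral_integral V E f"
proof -
  let ?M = "scalar_measure E v"
  obtain g :: "nat \<Rightarrow> real \<Rightarrow> complex" where vV: "v \<in> V" and g: "\<And>n. simple_function borel (g n)"
    and glim: "(\<lambda>n. \<integral>\<^sup>+s. ennreal ((norm (complex_of_real s - g n s))\<^sup>2) \<partial>?M) \<longlonglongrightarrow> 0"
    and y: "(\<lambda>n. simple_spectral_integral E (g n) v) \<longlonglongrightarrow> complex_of_real e *\<^sub>C v"
    using v unfolding mem_spectral_integral_iff by blast
  have [measurable]: "g n \<in> borel_measurable borel" for n using g borel_measurable_simple_function by blast
  have "(\<lambda>n. simple_spectral_integral E (g n) v - complex_of_real e *\<^sub>C v) \<longlonglongrightarrow> 0"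
    using y by (simp add: LIM_zero)
  then have lim: "(\<lambda>n. ennreal ((norm (simple_spectral_integral E (g n) v - complex_of_real e *\<^sub>C v))\<^sup>2)) \<longlonglongrightarrow> 0"
    by (simp add: tendsto_ennreal_norm_square)
  have "(\<lambda>n. 2 * (\<integral>\<^sup>+s. ennreal ((norm (complex_of_real s - g n s))\<^sup>2) \<partial>?M)
      + 2 * ennreal ((norm (simple_spectral_integral E (g n) v - complex_of_real e *\<^sub>C v))\<^sup>2)) \<longlonglongrightarrow> 2 * 0 + 2 * 0"
    by (intro tendsto_add ennreal_tendsto_cmult lim glim) auto
  moreover have "(\<integral>\<^sup>+s. ennreal ((norm (complex_of_real s - complex_of_real e))\<^sup>2) \<partial>?M)
      \<le> 2 * (\<integral>\<^sup>+s. ennreal ((norm (complex_of_real s - g n s))\<^sup>2) \<partial>?M)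
      + 2 * ennreal ((norm (simple_spectral_integral E (g n) v - complex_of_real e *\<^sub>C v))\<^sup>2)" for n
    unfolding simple_spectral_integral_const[OF vV, symmetric]
      norm_simple_spectral_integral_diff[OF g simple_function_const vV]
    by (rule nn_integral_norm_diff_square) measurable
  ultimately have "(\<integral>\<^sup>+s. ennreal ((norm (complex_of_real s - complex_of_real e))\<^sup>2) \<partial>?M) \<le> 2 * 0 + 2 * 0"
    by (intro LIMSEQ_le_const) auto
  then have "AE s in ?M. ennreal ((norm (complex_of_real s - complex_of_real e))\<^sup>2) = 0"
    by (subst nn_integral_0_iff_AE[symmetric]) auto
  then have "AE s in ?M. s = e" by (rule AE_mp) auto
  then have "(\<integral>\<^sup>+s. ennreal ((norm (f s - f e))\<^sup>2) \<partial>?M) = (\<integral>\<^sup>+s. 0 \<partial>?M)"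
    by (intro nn_integral_cong_AE) auto
  then show ?thesis
    unfolding mem_spectral_integral_iff using vV
    by (intro conjI exI[of _ "\<lambda>_ _. f e"]) (auto simp: simple_spectral_integral_const)
qed

end

lemma (in pvm) spectral_integral_subset:
  assumes "closed_csubspace V" "(x, y) \<in> spectral_integral V E f"
  shows "x \<in> V" "y \<in> V"
proof -
  obtain g :: "nat \<Rightarrow> real \<Rightarrow> complex" where x: "x \<in> V" and g: "\<And>n. simple_function borel (g n)"
    and lim: "(\<lambda>n. simple_spectral_integral E (g n) x) \<longlonglongrightarrow> y"
    using assms(2) unfolding mem_spectral_integral_iff by blast
  have sub: "csubspace V" "closed V" using assms(1) by (auto simp: closed_csubspace_def)
  have "g n -` {c} \<in> sets borel" for n c using simple_functionD(2)[OF g[of n], of "{c}"] by simp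
  then have "simple_spectral_integral E (g n) x \<in> V" for n
    unfolding simple_spectral_integral_def
    by (intro complex_vec.subspace_sum complex_vec.subspace_scale sub E_closed x)
  then show "x \<in> V" "y \<in> V" using x closed_sequentially[OF sub(2) _ lim] by auto
qed

text \<open>What the symmetry needs from the group is that \<open>U (- t)\<close> is adjoint to
  \<open>U t\<close>: conjugating the exponential reverses the time. Together with totality, this
  relation also makes each \<open>U t\<close> single-valued.\<close>

lemma unitary_group_functions:
  fixes U :: "real \<Rightarrow> 'h::chilbert_space operator"
  assumes "projection_valued_measure UNIV E"
    and U: "\<And>t. U t = spectral_integral UNIV E (\<lambda>s. exp (- \<i> * of_real t * of_real s))"
  obtains u where "\<And>t. U t = op_of (u t)" "\<And>t v w. cinner (u t v) w = cinner v (u (- t) w)"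
proof -
  interpret pvm UNIV E by unfold_locales fact
  have meas: "(\<lambda>s. exp (- \<i> * of_real t * of_real s)) \<in> borel_measurable borel" for t
    by (intro borel_measurable_continuous_onI continuous_intros)
  have cnj: "(\<lambda>s. cnj (exp (- \<i> * of_real t * of_real s))) = (\<lambda>s. exp (- \<i> * of_real (- t) * of_real s))" for t
    by (simp add: exp_cnj)
  have adj: "cinner y w = cinner v z" if "(v, y) \<in> U t" "(w, z) \<in> U (- t)" for t v w y z
    using spectral_integral_adjoint[OF meas, of v y t w z] that unfolding U cnj by blast
  have total: "\<exists>y. (v, y) \<in> U t" for t v
    unfolding U by (rule spectral_integral_total[OF meas, of t 1]) auto
  define u where "u t v = (SOME y. (v, y) \<in> U t)" for t v
  have u: "(v, u t v) \<in> U t" for t v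
    unfolding u_def by (rule someI_ex[OF total])
  have u_adj: "cinner (u t v) w = cinner v (u (- t) w)" for t v w by (rule adj[OF u u])
  have "y = u t v" if "(v, y) \<in> U t" for t v y
  proof (rule cinner_eqI)
    fix w
    have "cinner y w = cinner (u t v) w" using adj[OF that u] u_adj by simp
    then show "cinner w y = cinner w (u t v)" by (metis cinner_commute)
  qed
  then have "U t = op_of (u t)" for t
    using u unfolding op_of_def by (intro set_eqI) auto
  with u_adj that show ?thesis by blast
qed

section \<open>Symmetric operators\<close>

text \<open>Imposed on arbitrary relations, without density or single-valuedness, so that it can be
  checked on generating pairs and then carried to closed spans.\<close>

definition symmetric_operator :: "'a::chilbert_space operator \<Rightarrow> bool" where
  "symmetric_operator A \<longleftrightarrow> (\<forall>(x, y)\<in>A. \<forall>(u, v)\<in>A. cinner x v = cinner y u)"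

lemma symmetric_operatorI:
  "(\<And>x y u v. (x, y) \<in> A \<Longrightarrow> (u, v) \<in> A \<Longrightarrow> cinner x v = cinner y u) \<Longrightarrow> symmetric_operator A"
  unfolding symmetric_operator_def by blast

lemma symmetric_operatorD:
  "symmetric_operator A \<Longrightarrow> (x, y) \<in> A \<Longrightarrow> (u, v) \<in> A \<Longrightarrow> cinner x v = cinner y u"
  unfolding symmetric_operator_def by blast

lemma fst_scaleC [simp]: "fst (a *\<^sub>C p) = a *\<^sub>C fst p" and snd_scaleC [simp]: "snd (a *\<^sub>C p) = a *\<^sub>C snd p"
  for p :: "'a::complex_vector \<times> 'b::complex_vector"
  by (simp_all add: scaleC_prod_def)

text \<open>Both sides are sesquilinear and continuous, so the identity extends one variable at a
  time. The maps will be the two projections of a graph; the factor \<open>c\<close> accommodates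
  tensoring with fixed vectors.\<close>

lemma sesquilinear_closure_cspan:
  fixes S :: "('a::chilbert_space \<times> 'b::chilbert_space) set"
    and S' :: "('c::chilbert_space \<times> 'd::chilbert_space) set"
    and f :: "'a \<times> 'b \<Rightarrow> 'e::chilbert_space" and f' :: "'c \<times> 'd \<Rightarrow> 'e"
    and g :: "'a \<times> 'b \<Rightarrow> 'k::chilbert_space" and g' :: "'c \<times> 'd \<Rightarrow> 'k"
  assumes f: "\<And>p q. f (p + q) = f p + f q" "\<And>a p. f (a *\<^sub>C p) = a *\<^sub>C f p" "continuous_on UNIV f"
    and f': "\<And>p q. f' (p + q) = f' p + f' q" "\<And>a p. f' (a *\<^sub>C p) = a *\<^sub>C f' p" "continuous_on UNIV f'"
    and g: "\<And>p q. g (p + q) = g p + g q" "\<And>a p. g (a *\<^sub>C p) = a *\<^sub>C g p" "continuous_on UNIV g"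
    and g': "\<And>p q. g' (p + q) = g' p + g' q" "\<And>a p. g' (a *\<^sub>C p) = a *\<^sub>C g' p" "continuous_on UNIV g'"
    and eq: "\<And>p q. p \<in> S \<Longrightarrow> q \<in> S' \<Longrightarrow> cinner (f p) (f' q) = c * cinner (g p) (g' q)"
    and p: "p \<in> closure (cspan S)" and q: "q \<in> closure (cspan S')"
  shows "cinner (f p) (f' q) = c * cinner (g p) (g' q)"
proof -
  have zero: "f 0 = 0" "f' 0 = 0" "g 0 = 0" "g' 0 = 0"
    using f(2)[of 0 0] f'(2)[of 0 0] g(2)[of 0 0] g'(2)[of 0 0] by auto
  have 1: "q \<in> {q. cinner (f p) (f' q) = c * cinner (g p) (g' q)}" if "p \<in> S" for p
  proof (rule cspan_closure_induct[OF q])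
    show "csubspace {q. cinner (f p) (f' q) = c * cinner (g p) (g' q)}"
      by (rule csubspaceI) (auto simp: f' g' zero cinner_add_right cinner_scaleC_right algebra_simps)
    show "closed {q. cinner (f p) (f' q) = c * cinner (g p) (g' q)}"
      by (intro closed_Collect_eq continuous_intros f' g')
  qed (intro subsetI CollectI eq that)
  have "p \<in> {p. cinner (f p) (f' q) = c * cinner (g p) (g' q)}"
  proof (rule cspan_closure_induct[OF p])
    show "csubspace {p. cinner (f p) (f' q) = c * cinner (g p) (g' q)}"
      by (rule csubspaceI) (auto simp: f g zero cinner_add_left cinner_scaleC_left algebra_simps)
    show "closed {p. cinner (f p) (f' q) = c * cinner (g p) (g' q)}"
      by (intro closed_Collect_eq continuous_intros f g)
  qed (rule subsetI, rule CollectI, rule 1[unfolded mem_Collect_eq])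
  then show ?thesis by simp
qed

lemma symmetric_operator_closure_cspan:
  assumes "symmetric_operator S" shows "symmetric_operator (closure (cspan S))"
proof -
  have "cinner (fst p) (snd q) = 1 * cinner (snd p) (fst q)"
    if "p \<in> closure (cspan S)" "q \<in> closure (cspan S)" for p q
    using symmetric_operatorD[OF assms, of "fst _" "snd _" "fst _" "snd _"] that
    by (intro sesquilinear_closure_cspan[of fst snd snd fst S S 1 p q]) (auto intro!: continuous_intros)
  then show ?thesis unfolding symmetric_operator_def by fastforce
qed

text \<open>By symmetry, \<open>y\<close> and \<open>y'\<close> have the same inner products with
  every \<open>u\<close> in \<open>D\<close>, so their difference is orthogonal to a total
  set.\<close>

lemma symmetric_operator_unique:
  assumes A: "symmetric_operator A" and dense: "D \<subseteq> Domain A" "closure (cspan D) = UNIV"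
    and "(x, y) \<in> A" "(x, y') \<in> A"
  shows "y = y'"
proof -
  have "y - y' \<in> {u. cinner (y - y') u = 0}"
  proof (rule cspan_closure_induct[of _ D])
    show "csubspace {u. cinner (y - y') u = 0}"
      by (rule csubspaceI) (auto simp: cinner_add_right cinner_scaleC_right)
    show "closed {u. cinner (y - y') u = 0}" by (intro closed_Collect_eq continuous_intros)
    show "D \<subseteq> {u. cinner (y - y') u = 0}"
    proof
      fix u assume "u \<in> D"
      then obtain v where "(u, v) \<in> A" using dense by blast
      then show "u \<in> {u. cinner (y - y') u = 0}"
        using symmetric_operatorD[OF A] assms(4,5) by (simp add: cinner_diff_left) metis
    qed
  qed (use dense in simp)
  then show ?thesis by (simp add: cinner_self)
qed

text \<open>Identifies an operator defined as a closure. The relation contains the graph of the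
  projection since it does so on a basis and is closed and linear; being symmetric and then
  everywhere defined, it contains nothing more.\<close>

lemma symmetric_operator_finite_projection:
  assumes R: "symmetric_operator R" "csubspace R" "closed R"
    and b: "orthonormal_family I b" "closure (cspan (b ` I)) = UNIV" and F: "finite F" "F \<subseteq> I"
    and bR: "\<And>i. i \<in> I \<Longrightarrow> (b i, if i \<in> F then b i else 0) \<in> R"
  shows "R = op_of (\<lambda>z. \<Sum>i\<in>F. cinner (b i) z *\<^sub>C b i)"
proof -
  define p where "p z = (\<Sum>i\<in>F. cinner (b i) z *\<^sub>C b i)" for z
  have graph: "(z, p z) \<in> R" for z
  proof -
    have "z \<in> {z. (z, p z) \<in> R}"
    proof (rule cspan_closure_induct[of _ "b ` I"])
      have "p (x + y) = p x + p y" "p (c *\<^sub>C x) = c *\<^sub>C p x" "p 0 = 0" for x y c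
        by (simp_all add: p_def cinner_add_right scaleC_add_left sum.distrib cinner_scaleC_right
            complex_vec.scale_sum_right)
      then show "csubspace {z. (z, p z) \<in> R}"
        using complex_vec.subspace_0[OF R(2)] complex_vec.subspace_add[OF R(2), of "(_, _)" "(_, _)"]
          complex_vec.subspace_scale[OF R(2), of "(_, _)"]
        by (intro csubspaceI) (auto simp: scaleC_prod_def zero_prod_def)
      have "continuous_on UNIV (\<lambda>z. (z, p z))" unfolding p_def by (intro continuous_intros)
      then show "closed {z. (z, p z) \<in> R}"
        using continuous_closed_vimage[OF R(3), of "\<lambda>z. (z, p z)"]
        by (simp add: vimage_def continuous_on_eq_continuous_at)
      show "b ` I \<subseteq> {z. (z, p z) \<in> R}"
      proof
        fix z assume "z \<in> b ` I"
        then obtain j where j: "j \<in> I" "z = b j" by blast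
        have "p z = (\<Sum>i\<in>F. if i = j then b j else 0)"
          unfolding p_def j(2) using F(2) j(1)
          by (intro sum.cong refl) (auto simp: orthonormal_familyD[OF b(1)] subset_iff scaleC_one)
        then have "p z = (if j \<in> F then b j else 0)" using F(1) by simp
        then show "z \<in> {z. (z, p z) \<in> R}" using bR[OF j(1)] j(2) by simp
      qed
    qed (use b(2) in simp)
    then show ?thesis by simp
  qed
  have unique: "w = p z" if "(z, w) \<in> R" for z w
    by (rule symmetric_operator_unique[OF R(1), of UNIV]) (use graph that in \<open>auto simp: complex_vec.span_UNIV\<close>)
  show ?thesis
    unfolding p_def[symmetric] op_of_def using graph unique by auto
qed

lemma symmetric_operator_scale:
  "symmetric_operator A \<Longrightarrow> symmetric_operator (op_scale (complex_of_real r) A)"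
  unfolding op_scale_def
  by (rule symmetric_operatorI)
    (auto simp: cinner_scaleC_left cinner_scaleC_right dest: symmetric_operatorD)

lemma symmetric_rank_one_projection: "symmetric_operator (rank_one_projection v)"
proof -
  have "cinner x (cinner v y *\<^sub>C v) = cinner (cinner v x *\<^sub>C v) y" for x y
    by (simp add: cinner_scaleC_left cinner_scaleC_right)
      (metis cinner_commute mult.commute)
  then show ?thesis
    unfolding rank_one_projection_def op_of_def by (intro symmetric_operatorI) auto
qed

lemma (in pvm) symmetric_real_spectral_integral:
  fixes f :: "real \<Rightarrow> complex"
  assumes "f \<in> borel_measurable borel" "\<And>s. cnj (f s) = f s"
  shows "symmetric_operator (spectral_integral V E f)"
proof (rule symmetric_operatorI)
  fix x y v w assume "(x, y) \<in> spectral_integral V E f" "(v, w) \<in> spectral_integral V E f"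
  then show "cinner x w = cinner y v"
    using spectral_integral_adjoint[OF assms(1), of x y v w] assms(2) by simp
qed

section \<open>Tensor products\<close>

locale tensor =
  fixes I :: "'i set" and V :: "'i \<Rightarrow> 'a::chilbert_space set" and \<tau> :: "('i \<Rightarrow> 'a) \<Rightarrow> 'b::chilbert_space"
  assumes finite_I: "finite I"
    and V_subspace: "\<And>i. i \<in> I \<Longrightarrow> csubspace (V i)"
    and cinner_tensor: "\<And>x y. x \<in> Pi I V \<Longrightarrow> y \<in> Pi I V \<Longrightarrow> cinner (\<tau> x) (\<tau> y) = (\<Prod>i\<in>I. cinner (x i) (y i))"
begin

text \<open>Source of multilinearity: the map \<open>\<tau>\<close> is known only through inner
  products, and these separate linear combinations of elementary tensors.\<close>

lemma tensor_combination_eqI: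
  assumes "v \<in> cspan (\<tau> ` Pi I V)" "w \<in> cspan (\<tau> ` Pi I V)"
    and "\<And>z. z \<in> Pi I V \<Longrightarrow> cinner v (\<tau> z) = cinner w (\<tau> z)"
  shows "v = w"
proof -
  have "cinner (v - w) d = 0" if "d \<in> cspan (\<tau> ` Pi I V)" for d
    using that
    by (induction rule: complex_vec.span_induct_alt)
      (auto simp: cinner_add_right cinner_scaleC_right cinner_diff_left assms(3))
  moreover have "v - w \<in> cspan (\<tau> ` Pi I V)" using assms complex_vec.span_diff by blast
  ultimately have "cinner (v - w) (v - w) = 0" by blast
  then show ?thesis by (simp add: cinner_self)
qed

lemma tensor_in_cspan: "x \<in> Pi I V \<Longrightarrow> \<tau> x \<in> cspan (\<tau> ` Pi I V)"
  by (intro complex_vec.span_base imageI)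

lemma tensor_cong:
  assumes "x \<in> Pi I V" "\<And>i. i \<in> I \<Longrightarrow> x i = y i" shows "\<tau> x = \<tau> y"
proof -
  have "y \<in> Pi I V" using assms by (auto simp: Pi_iff)
  then show ?thesis
    using assms by (intro tensor_combination_eqI tensor_in_cspan) (auto simp: cinner_tensor)
qed

lemma tensor_scale_all:
  assumes "x \<in> Pi I V" shows "\<tau> (\<lambda>i. c i *\<^sub>C x i) = (\<Prod>i\<in>I. c i) *\<^sub>C \<tau> x"
proof -
  have "(\<lambda>i. c i *\<^sub>C x i) \<in> Pi I V"
    using assms V_subspace complex_vec.subspace_scale by (fastforce simp: Pi_iff)
  then show ?thesis
    using assms
    by (intro tensor_combination_eqI tensor_in_cspan complex_vec.span_scale)
      (auto simp: cinner_tensor cinner_scaleC_left prod.distrib)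
qed

lemma fun_upd_Pi: "y \<in> Pi I V \<Longrightarrow> u \<in> V i \<Longrightarrow> y(i := u) \<in> Pi I V"
  by (auto simp: Pi_iff)

lemma cinner_tensor_fun_upd:
  assumes "i \<in> I" "y \<in> Pi I V" "u \<in> V i" "z \<in> Pi I V"
  shows "cinner (\<tau> (y(i := u))) (\<tau> z) = cinner u (z i) * (\<Prod>j\<in>I - {i}. cinner (y j) (z j))"
  using assms finite_I by (subst cinner_tensor) (auto simp: prod.remove fun_upd_Pi)

lemma tensor_slot_sum:
  assumes i: "i \<in> I" and y: "y \<in> Pi I V" and F: "finite F" "\<And>j. j \<in> F \<Longrightarrow> u j \<in> V i"
  shows "\<tau> (y(i := \<Sum>j\<in>F. c j *\<^sub>C u j)) = (\<Sum>j\<in>F. c j *\<^sub>C \<tau> (y(i := u j)))"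
proof (rule tensor_combination_eqI)
  have u: "(\<Sum>j\<in>F. c j *\<^sub>C u j) \<in> V i"
    using F V_subspace[OF i] by (intro complex_vec.subspace_sum complex_vec.subspace_scale) auto
  then show "\<tau> (y(i := \<Sum>j\<in>F. c j *\<^sub>C u j)) \<in> cspan (\<tau> ` Pi I V)"
    using y by (intro tensor_in_cspan fun_upd_Pi)
  show "(\<Sum>j\<in>F. c j *\<^sub>C \<tau> (y(i := u j))) \<in> cspan (\<tau> ` Pi I V)"
    using y F by (intro complex_vec.span_sum complex_vec.span_scale tensor_in_cspan fun_upd_Pi) auto
  fix z assume z: "z \<in> Pi I V"
  show "cinner (\<tau> (y(i := \<Sum>j\<in>F. c j *\<^sub>C u j))) (\<tau> z) = cinner (\<Sum>j\<in>F. c j *\<^sub>C \<tau> (y(i := u j))) (\<tau> z)"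
    using F(2) by (simp add: cinner_tensor_fun_upd[OF i y u z] cinner_sum_left cinner_scaleC_left
        sum_distrib_right cinner_tensor_fun_upd[OF i y _ z] mult.assoc)
qed

lemma tensor_slot_add:
  assumes "i \<in> I" "y \<in> Pi I V" "u \<in> V i" "v \<in> V i"
  shows "\<tau> (y(i := u + v)) = \<tau> (y(i := u)) + \<tau> (y(i := v))"
  using tensor_slot_sum[of i y UNIV "\<lambda>b. if b then u else v" "\<lambda>_. 1"] assms
  by (simp add: UNIV_bool scaleC_one add.commute)

lemma tensor_slot_scale:
  assumes "i \<in> I" "y \<in> Pi I V" "u \<in> V i"
  shows "\<tau> (y(i := a *\<^sub>C u)) = a *\<^sub>C \<tau> (y(i := u))"
  using tensor_slot_sum[of i y "{()}" "\<lambda>_. u" "\<lambda>_. a"] assms by simp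

lemma norm_tensor_slot:
  assumes "i \<in> I" "y \<in> Pi I V" "u \<in> V i"
  shows "norm (\<tau> (y(i := u))) = (\<Prod>j\<in>I - {i}. norm (y j)) * norm u"
proof -
  have "complex_of_real ((norm (\<tau> (y(i := u))))\<^sup>2)
      = cinner u u * (\<Prod>j\<in>I - {i}. cinner (y j) (y j))"
    unfolding cinner_self[symmetric] cinner_tensor_fun_upd[OF assms fun_upd_Pi[OF assms(2,3)]]
    by (simp cong: prod.cong_simp)
  also have "\<dots> = complex_of_real (((\<Prod>j\<in>I - {i}. norm (y j)) * norm u)\<^sup>2)"
    by (simp add: cinner_self power_mult_distrib prod_power_distrib)
  finally have "(norm (\<tau> (y(i := u))))\<^sup>2 = ((\<Prod>j\<in>I - {i}. norm (y j)) * norm u)\<^sup>2"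
    using of_real_eq_iff by blast
  then show ?thesis by (simp add: power2_eq_iff_nonneg prod_nonneg)
qed

lemma symmetric_tensor_operator:
  assumes "\<And>i. i \<in> I \<Longrightarrow> symmetric_operator (A i)"
  shows "symmetric_operator (tensor_operator I V \<tau> A)"
  unfolding tensor_operator_def
proof (rule symmetric_operator_closure_cspan)
  show "symmetric_operator {(\<tau> x, \<tau> y) | x y. x \<in> Pi I V \<and> y \<in> Pi I V \<and> (\<forall>i\<in>I. (x i, y i) \<in> A i)}"
  proof (rule symmetric_operatorI)
    fix p q r s
    assume "(p, q) \<in> {(\<tau> x, \<tau> y) | x y. x \<in> Pi I V \<and> y \<in> Pi I V \<and> (\<forall>i\<in>I. (x i, y i) \<in> A i)}"
    then obtain x y where xy: "p = \<tau> x" "q = \<tau> y" "x \<in> Pi I V" "y \<in> Pi I V" "\<forall>i\<in>I. (x i, y i) \<in> A i"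
      by blast
    assume "(r, s) \<in> {(\<tau> x, \<tau> y) | x y. x \<in> Pi I V \<and> y \<in> Pi I V \<and> (\<forall>i\<in>I. (x i, y i) \<in> A i)}"
    then obtain u v where uv: "r = \<tau> u" "s = \<tau> v" "u \<in> Pi I V" "v \<in> Pi I V" "\<forall>i\<in>I. (u i, v i) \<in> A i"
      by blast
    have "(\<Prod>i\<in>I. cinner (x i) (v i)) = (\<Prod>i\<in>I. cinner (y i) (u i))"
      using xy(5) uv(5) symmetric_operatorD[OF assms] by (intro prod.cong refl) blast
    then show "cinner p s = cinner q r" using xy uv by (simp add: cinner_tensor)
  qed
qed

end

section \<open>Tensoring with fixed vectors, and ampliations\<close>

locale tensor_subset = tensor I V \<tau> for I V \<tau> +
  fixes J :: "'i set" and \<sigma> :: "('i \<Rightarrow> 'a::chilbert_space) \<Rightarrow> 'c::chilbert_space"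
  assumes J: "J \<subseteq> I"
    and cinner_sub: "\<And>x y. x \<in> Pi J V \<Longrightarrow> y \<in> Pi J V \<Longrightarrow> cinner (\<sigma> x) (\<sigma> y) = (\<Prod>i\<in>J. cinner (x i) (y i))"
begin

abbreviation TW where "TW \<equiv> tensor_with I V \<tau> J \<sigma>"

lemma override_Pi: "y \<in> Pi I V \<Longrightarrow> x \<in> Pi J V \<Longrightarrow> override_on y x J \<in> Pi I V"
  by (auto simp: Pi_iff override_on_def)

lemma csubspace_tensor_with: "csubspace (TW y)"
  unfolding tensor_with_def by (intro csubspace_closure_prod complex_vec.subspace_span)

lemma tensor_with_elementary: "x \<in> Pi J V \<Longrightarrow> (\<sigma> x, \<tau> (override_on y x J)) \<in> TW y"
  unfolding tensor_with_def
  by (intro closure_subset[THEN subsetD] complex_vec.span_base) auto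

lemma tensor_with_add: "(u, w) \<in> TW y \<Longrightarrow> (u', w') \<in> TW y \<Longrightarrow> (u + u', w + w') \<in> TW y"
  using complex_vec.subspace_add[OF csubspace_tensor_with, of "(u, w)" _ "(u', w')"] by simp

lemma tensor_with_diff: "(u, w) \<in> TW y \<Longrightarrow> (u', w') \<in> TW y \<Longrightarrow> (u - u', w - w') \<in> TW y"
  using complex_vec.subspace_diff[OF csubspace_tensor_with, of "(u, w)" _ "(u', w')"] by simp

lemma tensor_with_scale: "(u, w) \<in> TW y \<Longrightarrow> (a *\<^sub>C u, a *\<^sub>C w) \<in> TW y"
  using complex_vec.subspace_scale[OF csubspace_tensor_with, of "(u, w)"] by (simp add: scaleC_prod_def)

text \<open>Tensoring with fixed factors is an isometry up to a constant. Single-valuedness,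
  transfer of limits and symmetry of ampliations all follow from this identity.\<close>

lemma cinner_tensor_with:
  assumes y: "y \<in> Pi I V" "y' \<in> Pi I V" and "(u, w) \<in> TW y" "(u', w') \<in> TW y'"
  shows "cinner w w' = (\<Prod>i\<in>I - J. cinner (y i) (y' i)) * cinner u u'"
proof -
  have "cinner (\<tau> (override_on y x J)) (\<tau> (override_on y' x' J))
      = (\<Prod>i\<in>I - J. cinner (y i) (y' i)) * cinner (\<sigma> x) (\<sigma> x')"
    if "x \<in> Pi J V" "x' \<in> Pi J V" for x x'
  proof -
    have "(\<Prod>i\<in>I - J. cinner (override_on y x J i) (override_on y' x' J i)) = (\<Prod>i\<in>I - J. cinner (y i) (y' i))"
      "(\<Prod>i\<in>J. cinner (override_on y x J i) (override_on y' x' J i)) = (\<Prod>i\<in>J. cinner (x i) (x' i))"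
      by (intro prod.cong; simp)+
    then show ?thesis
      using that y by (simp add: cinner_tensor override_Pi cinner_sub prod.subset_diff[OF J finite_I])
  qed
  then have "cinner (snd (u, w)) (snd (u', w')) = (\<Prod>i\<in>I - J. cinner (y i) (y' i)) * cinner (fst (u, w)) (fst (u', w'))"
    using assms(3,4) unfolding tensor_with_def
    by (intro sesquilinear_closure_cspan[where f = snd and f' = snd and g = fst and g' = fst
          and p = "(u, w)" and q = "(u', w')"])
      (auto intro!: continuous_intros)
  then show ?thesis by simp
qed

lemma norm_tensor_with:
  assumes "y \<in> Pi I V" "(u, w) \<in> TW y"
  shows "norm w = (\<Prod>i\<in>I - J. norm (y i)) * norm u"
proof -
  have "complex_of_real ((norm w)\<^sup>2) = complex_of_real (((\<Prod>i\<in>I - J. norm (y i)) * norm u)\<^sup>2)"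
    using cinner_tensor_with[OF assms(1,1,2,2)]
    by (simp add: cinner_self power_mult_distrib prod_power_distrib)
  then have "(norm w)\<^sup>2 = ((\<Prod>i\<in>I - J. norm (y i)) * norm u)\<^sup>2"
    using of_real_eq_iff by blast
  then show ?thesis by (simp add: power2_eq_iff_nonneg prod_nonneg)
qed

lemma tensor_with_unique:
  assumes "y \<in> Pi I V" "(u, w) \<in> TW y" "(u, w') \<in> TW y" shows "w = w'"
  using norm_tensor_with[OF assms(1) tensor_with_diff[OF assms(2,3)]] by simp

lemma tensor_with_Cauchy:
  assumes y: "y \<in> Pi I V" and uw: "\<And>n. (u n, w n) \<in> TW y" and u: "u \<longlonglongrightarrow> a"
  obtains z where "w \<longlonglongrightarrow> z" "(a, z) \<in> TW y"
proof -
  define C where "C = (\<Prod>i\<in>I - J. norm (y i))"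
  have C: "C \<ge> 0" unfolding C_def by (intro prod_nonneg) auto
  have dist: "dist (w m) (w n) = C * dist (u m) (u n)" for m n
    using norm_tensor_with[OF y tensor_with_diff[OF uw uw]] by (simp add: C_def dist_norm)
  have "Cauchy w"
  proof (rule metric_CauchyI)
    fix \<epsilon> :: real assume \<epsilon>: "\<epsilon> > 0"
    \<comment> \<open>A fixed factor may be zero and then \<open>C\<close> vanishes, so
      \<open>C + 1\<close> is used as the divisor.\<close>
    then have "\<epsilon> / (C + 1) > 0" using C by simp
    then obtain N where N: "\<And>m n. m \<ge> N \<Longrightarrow> n \<ge> N \<Longrightarrow> dist (u m) (u n) < \<epsilon> / (C + 1)"
      using metric_CauchyD[OF LIMSEQ_imp_Cauchy[OF u]] by blast
    have "dist (w m) (w n) < \<epsilon>" if "m \<ge> N" "n \<ge> N" for m n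
    proof -
      have "dist (w m) (w n) \<le> (C + 1) * dist (u m) (u n)" by (simp add: dist distrib_right)
      also have "\<dots> < (C + 1) * (\<epsilon> / (C + 1))" using N[OF that] C by (intro mult_strict_left_mono) auto
      finally show ?thesis using C by simp
    qed
    then show "\<exists>N. \<forall>m\<ge>N. \<forall>n\<ge>N. dist (w m) (w n) < \<epsilon>" by blast
  qed
  then obtain z where z: "w \<longlonglongrightarrow> z" using Cauchy_convergent convergent_def by blast
  have "closed (TW y)" by (simp add: tensor_with_def)
  from closed_sequentially[OF this _ tendsto_Pair[OF u z]] uw have "(a, z) \<in> TW y" by simp
  with z that show ?thesis by blast
qed

text \<open>The domain of the graph is a subspace, closed by \<open>tensor_with_Cauchy\<close>, and
  contains the elementary tensors.\<close>

lemma tensor_with_total: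
  assumes y: "y \<in> Pi I V" and total: "closure (cspan (\<sigma> ` Pi J V)) = UNIV"
  shows "\<exists>w. (u, w) \<in> TW y"
proof -
  have sub: "csubspace (Domain (TW y))"
  proof (rule csubspaceI)
    show "0 \<in> Domain (TW y)"
      using complex_vec.subspace_0[OF csubspace_tensor_with, of y] unfolding zero_prod_def by (rule DomainI)
  next
    fix u u' assume "u \<in> Domain (TW y)" "u' \<in> Domain (TW y)"
    then obtain w w' where "(u, w) \<in> TW y" "(u', w') \<in> TW y" by blast
    from tensor_with_add[OF this] show "u + u' \<in> Domain (TW y)" by blast
  next
    fix a u assume "u \<in> Domain (TW y)"
    then obtain w where "(u, w) \<in> TW y" by blast
    from tensor_with_scale[OF this] show "a *\<^sub>C u \<in> Domain (TW y)" by blast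
  qed
  have "closed (Domain (TW y))"
    unfolding closed_sequential_limits
  proof (intro allI impI, elim conjE)
    fix u a assume "\<forall>n. u n \<in> Domain (TW y)" "u \<longlonglongrightarrow> a"
    then have "\<forall>n. \<exists>w. (u n, w) \<in> TW y" by blast
    then obtain w where w: "\<And>n. (u n, w n) \<in> TW y" by metis
    obtain z where "(a, z) \<in> TW y" using tensor_with_Cauchy[OF y w \<open>u \<longlonglongrightarrow> a\<close>] .
    then show "a \<in> Domain (TW y)" by blast
  qed
  have "u \<in> Domain (TW y)"
  proof (rule cspan_closure_induct[of u "\<sigma> ` Pi J V", OF _ sub \<open>closed (Domain (TW y))\<close>])
    show "\<sigma> ` Pi J V \<subseteq> Domain (TW y)" by (rule image_subsetI) (rule DomainI[OF tensor_with_elementary])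
  qed (simp add: total)
  then show ?thesis by blast
qed

text \<open>Membership of the image in a closed subspace can be tested on generators of the
  argument. It serves twice: with kets as generators for completeness of the product basis, and with
  products of eigenvectors for the eigenvalue relations.\<close>

lemma tensor_with_closure_cspan:
  assumes y: "y \<in> Pi I V" and total: "closure (cspan (\<sigma> ` Pi J V)) = UNIV"
    and N: "csubspace N" "closed N" and S: "\<And>u w. u \<in> S \<Longrightarrow> (u, w) \<in> TW y \<Longrightarrow> w \<in> N"
    and u: "u \<in> closure (cspan S)" and w: "(u, w) \<in> TW y"
  shows "w \<in> N"
proof -
  define D where "D = {u. \<exists>w\<in>N. (u, w) \<in> TW y}"
  have "csubspace D"
  proof (rule csubspaceI)
    show "0 \<in> D"
      using complex_vec.subspace_0[OF csubspace_tensor_with] complex_vec.subspace_0[OF N(1)]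
      by (auto simp: D_def zero_prod_def)
  next
    fix u u' assume "u \<in> D" "u' \<in> D"
    then show "u + u' \<in> D"
      unfolding D_def using tensor_with_add complex_vec.subspace_add[OF N(1)] by blast
  next
    fix a u assume "u \<in> D"
    then show "a *\<^sub>C u \<in> D"
      unfolding D_def using tensor_with_scale complex_vec.subspace_scale[OF N(1)] by blast
  qed
  moreover have "closed D"
    unfolding closed_sequential_limits
  proof (intro allI impI, elim conjE)
    fix u a assume "\<forall>n. u n \<in> D" and u: "u \<longlonglongrightarrow> a"
    then obtain w where w: "\<And>n. (u n, w n) \<in> TW y" "\<And>n. w n \<in> N" unfolding D_def by (simp, metis)
    obtain z where "w \<longlonglongrightarrow> z" "(a, z) \<in> TW y" using tensor_with_Cauchy[OF y w(1) u] .
    moreover have "z \<in> N" using closed_sequentially[OF N(2), of w z] w(2) \<open>w \<longlonglongrightarrow> z\<close> by blast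
    ultimately show "a \<in> D" unfolding D_def by blast
  qed
  moreover have "S \<subseteq> D" using S tensor_with_total[OF y total] by (fastforce simp: D_def)
  ultimately have "u \<in> D" using cspan_closure_induct[OF u] by blast
  then show ?thesis using tensor_with_unique[OF y w] by (auto simp: D_def)
qed

lemma symmetric_ampliation:
  assumes A: "symmetric_operator A" shows "symmetric_operator (ampliation I V \<tau> J \<sigma> A)"
  unfolding ampliation_def
proof (rule symmetric_operator_closure_cspan)
  show "symmetric_operator {(w, w'). \<exists>y\<in>Pi I V. \<exists>(u, v)\<in>A. (u, w) \<in> TW y \<and> (v, w') \<in> TW y}"
  proof (rule symmetric_operatorI)
    fix w w' z z'
    assume "(w, w') \<in> {(w, w'). \<exists>y\<in>Pi I V. \<exists>(u, v)\<in>A. (u, w) \<in> TW y \<and> (v, w') \<in> TW y}"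
    then obtain y u v where y: "y \<in> Pi I V" "(u, v) \<in> A" "(u, w) \<in> TW y" "(v, w') \<in> TW y" by blast
    assume "(z, z') \<in> {(w, w'). \<exists>y\<in>Pi I V. \<exists>(u, v)\<in>A. (u, w) \<in> TW y \<and> (v, w') \<in> TW y}"
    then obtain y' u' v' where y': "y' \<in> Pi I V" "(u', v') \<in> A" "(u', z) \<in> TW y'" "(v', z') \<in> TW y'" by blast
    show "cinner w z' = cinner w' z"
      using cinner_tensor_with[OF y(1) y'(1) y(3) y'(4)] cinner_tensor_with[OF y(1) y'(1) y(4) y'(3)]
        symmetric_operatorD[OF A y(2) y'(2)] by simp
  qed
qed

lemma ampliation_mem:
  "y \<in> Pi I V \<Longrightarrow> (u, v) \<in> A \<Longrightarrow> (u, w) \<in> TW y \<Longrightarrow> (v, w') \<in> TW y \<Longrightarrow>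
    (w, w') \<in> ampliation I V \<tau> J \<sigma> A"
  unfolding ampliation_def by (intro closure_subset[THEN subsetD] complex_vec.span_base) auto

end

lemma csubspace_ampliation: "csubspace (ampliation I V \<tau> J \<sigma> A)"
  unfolding ampliation_def by (intro csubspace_closure_prod complex_vec.subspace_span)

lemma closed_ampliation: "closed (ampliation I V \<tau> J \<sigma> A)"
  by (simp add: ampliation_def)

lemma csubspace_tensor_operator: "csubspace (tensor_operator I V \<tau> A)"
  unfolding tensor_operator_def by (intro csubspace_closure_prod complex_vec.subspace_span)

lemma closed_tensor_operator: "closed (tensor_operator I V \<tau> A)"
  by (simp add: tensor_operator_def)

lemma csubspace_eigenspace:
  assumes A: "csubspace A" shows "csubspace (eigenspace A z)"
proof (rule csubspaceI)
  show "0 \<in> eigenspace A z"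
    using complex_vec.subspace_0[OF A] by (simp add: eigenspace_def zero_prod_def)
  fix x y assume "x \<in> eigenspace A z" "y \<in> eigenspace A z"
  then show "x + y \<in> eigenspace A z"
    using complex_vec.subspace_add[OF A, of "(x, z *\<^sub>C x)" "(y, z *\<^sub>C y)"]
    by (simp add: eigenspace_def scaleC_add_right)
next
  fix c x assume "x \<in> eigenspace A z"
  then have "c *\<^sub>C (x, z *\<^sub>C x) \<in> A"
    unfolding eigenspace_def using complex_vec.subspace_scale[OF A] by blast
  then show "c *\<^sub>C x \<in> eigenspace A z"
    by (simp add: eigenspace_def scaleC_prod_def scaleC_scaleC mult.commute)
qed

lemma closed_eigenspace: "closed A \<Longrightarrow> closed (eigenspace A z)"
  using closed_vimage[of A "\<lambda>x. (x, z *\<^sub>C x)"]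
  by (simp add: eigenspace_def vimage_def continuous_intros)

lemma closed_adjoint_op: "closed V \<Longrightarrow> closed (adjoint_op V A)"
proof -
  assume V: "closed V"
  have "adjoint_op V A = V \<times> V \<inter> (\<Inter>(u, v)\<in>A. {p. cinner (fst p) v = cinner (snd p) u})"
    by (auto simp: adjoint_op_def)
  then show ?thesis
    by (auto intro!: closed_Int closed_Times V closed_INT closed_Collect_eq continuous_intros)
qed

lemma symmetric_self_adjoint: "self_adjoint V A \<Longrightarrow> symmetric_operator A"
  unfolding self_adjoint_def symmetric_operator_def adjoint_op_def by blast

context tensor
begin

lemma tensor_subset_singleton: "i \<in> I \<Longrightarrow> tensor_subset I V \<tau> {i} (\<lambda>x. x i)"
  by unfold_locales auto

lemma factor_ampliation_mem:
  assumes "i \<in> I" "y \<in> Pi I V" "(u, v) \<in> A" "u \<in> V i" "v \<in> V i"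
  shows "(\<tau> (y(i := u)), \<tau> (y(i := v))) \<in> factor_ampliation I V \<tau> i A"
proof -
  interpret S: tensor_subset I V \<tau> "{i}" "\<lambda>x. x i" by (rule tensor_subset_singleton) fact
  have *: "(u, \<tau> (y(i := u))) \<in> S.TW y" if "u \<in> V i" for u
  proof -
    have "override_on y (y(i := u)) {i} = y(i := u)" by (auto simp: override_on_def)
    then show ?thesis using S.tensor_with_elementary[of "y(i := u)" y] that by simp
  qed
  show ?thesis unfolding factor_ampliation_def
    by (rule S.ampliation_mem[OF assms(2,3) *[OF assms(4)] *[OF assms(5)]])
qed

lemma symmetric_factor_ampliation:
  assumes "i \<in> I" "symmetric_operator A" shows "symmetric_operator (factor_ampliation I V \<tau> i A)"
proof -
  interpret S: tensor_subset I V \<tau> "{i}" "\<lambda>x. x i" by (rule tensor_subset_singleton) fact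
  show ?thesis unfolding factor_ampliation_def by (rule S.symmetric_ampliation) fact
qed

text \<open>Pairing \<open>\<psi>\<close> with \<open>\<tau> (y(i := u))\<close> is a bounded functional of \<open>u\<close>, represented by an
  eigenvector of \<open>A i\<close> since \<open>A i\<close> is its own adjoint. Hence every factor \<open>u\<close> can be replaced by
  its projection to the eigenspace, and \<open>\<psi>\<close> equals its projection to the closed span of the
  products of eigenvectors.\<close>

lemma joint_eigenvector_in_product_eigenspace:
  assumes closed_V: "\<And>i. i \<in> I \<Longrightarrow> closed (V i)"
    and total: "closure (cspan (\<tau> ` Pi I V)) = UNIV"
    and A: "\<And>i. i \<in> I \<Longrightarrow> self_adjoint (V i) (A i)"
    and \<psi>: "\<And>i. i \<in> I \<Longrightarrow> (\<psi>, complex_of_real (a i) *\<^sub>C \<psi>) \<in> factor_ampliation I V \<tau> i (A i)"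
  shows "\<psi> \<in> closure (cspan (\<tau> ` (\<Pi> i\<in>I. eigenspace (A i) (complex_of_real (a i)))))"
proof -
  define G where "G i = eigenspace (A i) (complex_of_real (a i))" for i
  have GV: "G i \<subseteq> V i" if "i \<in> I" for i
    using A[OF that] by (auto simp: G_def eigenspace_def self_adjoint_def linear_operator_def)
  have G: "csubspace (G i)" "closed (G i)" if "i \<in> I" for i
  proof -
    show "csubspace (G i)"
      using A[OF that] by (simp add: G_def self_adjoint_def linear_operator_def csubspace_eigenspace)
    have "closed (A i)" using A[OF that] closed_adjoint_op[OF closed_V[OF that]]
      by (metis self_adjoint_def)
    then show "closed (G i)" by (simp add: G_def closed_eigenspace)
  qed
  define Q where "Q i u = (SOME p. p \<in> G i \<and> (\<forall>z\<in>G i. cinner p z = cinner u z))" for i u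
  have Q: "Q i u \<in> G i" "\<And>z. z \<in> G i \<Longrightarrow> cinner (Q i u) z = cinner u z" if i: "i \<in> I" for i u
  proof -
    obtain p where "p \<in> G i" "\<And>z. z \<in> G i \<Longrightarrow> cinner p z = cinner u z"
      using orthogonal_projection_exists[OF G[OF i]] by blast
    then have "\<exists>p. p \<in> G i \<and> (\<forall>z\<in>G i. cinner p z = cinner u z)" by blast
    from someI_ex[OF this] show "Q i u \<in> G i" "\<And>z. z \<in> G i \<Longrightarrow> cinner (Q i u) z = cinner u z"
      unfolding Q_def by blast+
  qed
  have QV: "Q i u \<in> V i" if "i \<in> I" for i u using Q GV that by blast
  have replace_one: "cinner \<psi> (\<tau> y) = cinner \<psi> (\<tau> (y(i := Q i (y i))))" if i: "i \<in> I" and y: "y \<in> Pi I V" for i y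
  proof -
    have yi: "y i \<in> V i" using i y by auto
    obtain v where v: "v \<in> V i" "\<And>u. u \<in> V i \<Longrightarrow> cinner v u = cinner \<psi> (\<tau> (y(i := u)))"
    proof (rule riesz_representation[OF V_subspace[OF i] closed_V[OF i],
          of "\<lambda>u. cinner \<psi> (\<tau> (y(i := u)))" "norm \<psi> * (\<Prod>j\<in>I - {i}. norm (y j))"])
      fix u assume "u \<in> V i"
      then show "cmod (cinner \<psi> (\<tau> (y(i := u)))) \<le> norm \<psi> * (\<Prod>j\<in>I - {i}. norm (y j)) * norm u"
        using cinner_bound[of \<psi> "\<tau> (y(i := u))"] norm_tensor_slot[OF i y] by (simp add: mult.assoc)
    qed (simp_all add: tensor_slot_add[OF i y] tensor_slot_scale[OF i y] cinner_add_right cinner_scaleC_right)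
    \<comment> \<open>For \<open>(u, w)\<close> in \<open>A i\<close>, symmetry of the ampliation
      moves the action from the slot of \<open>\<tau>\<close> onto \<open>\<psi>\<close>, where it
      becomes the scalar \<open>a i\<close>.\<close>
    have "(v, complex_of_real (a i) *\<^sub>C v) \<in> adjoint_op (V i) (A i)"
      unfolding adjoint_op_def
    proof (clarsimp, intro conjI ballI)
      show "v \<in> V i" "complex_of_real (a i) *\<^sub>C v \<in> V i"
        using v(1) V_subspace[OF i] complex_vec.subspace_scale by auto
      fix p assume p: "p \<in> A i"
      obtain u w where uw: "p = (u, w)" by (cases p)
      have V: "u \<in> V i" "w \<in> V i" using A[OF i] p uw by (auto simp: self_adjoint_def linear_operator_def)
      have "cinner \<psi> (\<tau> (y(i := w))) = cinner (complex_of_real (a i) *\<^sub>C \<psi>) (\<tau> (y(i := u)))"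
        using symmetric_operatorD[OF symmetric_factor_ampliation[OF i symmetric_self_adjoint[OF A[OF i]]]
            \<psi>[OF i] factor_ampliation_mem[OF i y _ V]] p uw by simp
      then show "case p of (u, w) \<Rightarrow> cinner v w = cinner (complex_of_real (a i) *\<^sub>C v) u"
        using v(2) V by (simp add: uw cinner_scaleC_left)
    qed
    then have "v \<in> G i" using A[OF i] by (simp add: G_def eigenspace_def self_adjoint_def)
    then have "cinner v (y i) = cinner v (Q i (y i))"
      using Q(2)[OF i] by (metis cinner_commute)
    then show ?thesis using v(2)[OF yi] v(2)[OF QV[OF i]] by simp
  qed
  have replace: "cinner \<psi> (\<tau> y) = cinner \<psi> (\<tau> (\<lambda>i. if i \<in> L then Q i (y i) else y i))"
    if "finite L" "L \<subseteq> I" and y: "y \<in> Pi I V" for L y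
    using that(1,2)
  proof (induction L)
    case (insert i L)
    let ?z = "\<lambda>i. if i \<in> L then Q i (y i) else y i"
    have "?z \<in> Pi I V" using y QV by auto
    moreover have "?z(i := Q i (?z i)) = (\<lambda>j. if j \<in> insert i L then Q j (y j) else y j)"
      using insert.hyps by auto
    ultimately show ?case using insert replace_one[of i ?z] by simp
  qed simp
  define M where "M = closure (cspan (\<tau> ` Pi I G))"
  obtain p where p: "p \<in> M" "\<And>z. z \<in> M \<Longrightarrow> cinner p z = cinner \<psi> z"
    using orthogonal_projection_exists[of M \<psi>]
    by (auto simp: M_def csubspace_closure complex_vec.subspace_span)
  have Qy: "(\<lambda>i. if i \<in> I then Q i (y i) else y i) \<in> Pi I G" for y using Q by auto
  have orth: "cinner (\<psi> - p) (\<tau> y) = 0" if y: "y \<in> Pi I V" for y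
  proof -
    let ?q = "\<lambda>i. if i \<in> I then Q i (y i) else y i"
    have qM: "\<tau> ?q \<in> M" unfolding M_def
      using Qy by (intro closure_subset[THEN subsetD] complex_vec.span_base imageI)
    \<comment> \<open>Like \<open>\<psi>\<close>, the projection \<open>p\<close> sees only the
      projected factors of \<open>y\<close>. So \<open>\<psi> - p\<close> pairs with
      \<open>\<tau> y\<close> as it does with \<open>\<tau> ?q\<close>, which lies in
      \<open>M\<close>, and that pairing is zero.\<close>
    have "p \<in> {p. cinner p (\<tau> y) = cinner p (\<tau> ?q)}"
    proof (rule cspan_closure_induct[OF p(1)[unfolded M_def]])
      show "csubspace {p. cinner p (\<tau> y) = cinner p (\<tau> ?q)}"
        by (rule csubspaceI) (auto simp: cinner_add_left cinner_scaleC_left)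
      show "closed {p. cinner p (\<tau> y) = cinner p (\<tau> ?q)}"
        by (intro closed_Collect_eq continuous_intros)
      show "\<tau> ` Pi I G \<subseteq> {p. cinner p (\<tau> y) = cinner p (\<tau> ?q)}"
      proof
        fix p assume "p \<in> \<tau> ` Pi I G"
        then obtain z where z: "z \<in> Pi I G" "p = \<tau> z" by blast
        have "cinner (z i) (y i) = cinner (z i) (?q i)" if "i \<in> I" for i
        proof -
          have "z i \<in> G i" using z(1) that by blast
          from Q(2)[OF that this, of "y i"] show ?thesis
            using that by (subst (1 2) cinner_commute) simp
        qed
        then show "p \<in> {p. cinner p (\<tau> y) = cinner p (\<tau> ?q)}"
          using z GV y Qy[of y] by (auto simp: cinner_tensor Pi_iff subset_iff intro!: prod.cong)
      qed
    qed
    then show ?thesis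
      using replace[OF finite_I subset_refl y] p(2)[OF qM] by (simp add: cinner_diff_left)
  qed
  have "\<psi> - p \<in> {z. cinner (\<psi> - p) z = 0}"
  proof (rule cspan_closure_induct[of _ "\<tau> ` Pi I V"])
    show "csubspace {z. cinner (\<psi> - p) z = 0}"
      by (rule csubspaceI) (auto simp: cinner_add_right cinner_scaleC_right)
    show "closed {z. cinner (\<psi> - p) z = 0}" by (intro closed_Collect_eq continuous_intros)
  qed (use total orth in auto)
  then have "\<psi> = p" by (simp add: cinner_self)
  then show ?thesis using p(1) by (simp add: M_def G_def[abs_def])
qed

end

section \<open>Two-time measurements in an orthonormal eigenbasis\<close>

lemma cmod_cinner_commute: "cmod (cinner x y) = cmod (cinner y x)" for x y :: "'a::chilbert_space"
  by (subst cinner_commute) simp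

text \<open>Gram-Schmidt, one vector per induction step; a vector equal to its projection adds
  nothing and is dropped.\<close>

lemma finite_orthonormal_basis:
  fixes B :: "'a::chilbert_space set"
  assumes "finite B"
  shows "\<exists>F. finite F \<and> orthonormal_family F (\<lambda>f. f) \<and> cspan F = cspan B"
  using assms
proof (induction B)
  case empty
  show ?case by (intro exI[of _ "{}"]) (simp add: orthonormal_family_def)
next
  case (insert x B)
  then obtain F where F: "finite F" "orthonormal_family F (\<lambda>f. f)" "cspan F = cspan B" by blast
  define p where "p = (\<Sum>f\<in>F. cinner f x *\<^sub>C f)"
  have orth: "\<And>y. y \<in> cspan F \<Longrightarrow> cinner y (x - p) = 0" and p: "p \<in> cspan F"
    using orthonormal_residual(1)[OF F(2,1), of _ x] orthonormal_residual(4)[OF F(2,1), of x]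
    by (simp_all add: p_def)
  show ?case
  proof (cases "x = p")
    case True
    then have "cspan (insert x B) = cspan B" using p F(3) complex_vec.span_redundant by metis
    then show ?thesis using F by metis
  next
    case False
    define r where "r = norm (x - p)"
    define u where "u = complex_of_real (1 / r) *\<^sub>C (x - p)"
    have r: "r > 0" using False by (simp add: r_def)
    have "norm u = (1 / r) * norm (x - p)" using r by (simp add: u_def norm_scaleC norm_divide)
    then have uu: "cinner u u = 1" using r by (simp add: cinner_self r_def)
    have fu: "cinner f u = 0" "cinner u f = 0" if "f \<in> F" for f
    proof -
      show *: "cinner f u = 0"
        using orth[OF complex_vec.span_base[OF that]] by (simp add: u_def cinner_scaleC_right)
      then show "cinner u f = 0" by (metis cinner_commute complex_cnj_zero)
    qed
    have x: "x = complex_of_real r *\<^sub>C u + p" using r by (simp add: u_def scaleC_scaleC scaleC_one)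
    have mono: "cspan B \<subseteq> cspan (insert x B)" "cspan F \<subseteq> cspan (insert u F)"
      by (intro complex_vec.span_mono; blast)+
    have "orthonormal_family (insert u F) (\<lambda>f. f)"
      using F(2) uu fu unfolding orthonormal_family_def by auto
    moreover have "cspan (insert u F) = cspan (insert x B)"
    proof (subst complex_vec.span_eq, intro conjI subsetI)
      fix v assume "v \<in> insert u F"
      moreover have "u \<in> cspan (insert x B)"
      proof -
        have "p \<in> cspan (insert x B)" "x \<in> cspan (insert x B)"
          using p F(3) mono(1) by (auto intro: complex_vec.span_base)
        then show ?thesis unfolding u_def by (intro complex_vec.span_scale complex_vec.span_diff)
      qed
      moreover have "F \<subseteq> cspan (insert x B)"
        using complex_vec.span_superset[of F] F(3) mono by blast
      ultimately show "v \<in> cspan (insert x B)" by blast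
    next
      fix v assume "v \<in> insert x B"
      moreover have "x \<in> cspan (insert u F)"
      proof -
        have "p \<in> cspan (insert u F)" "u \<in> cspan (insert u F)"
          using p mono(2) by (auto intro: complex_vec.span_base)
        then show ?thesis by (subst x) (intro complex_vec.span_add complex_vec.span_scale)
      qed
      moreover have "B \<subseteq> cspan (insert u F)"
        using complex_vec.span_superset[of B] F(3) mono by blast
      ultimately show "v \<in> cspan (insert u F)" by blast
    qed
    ultimately show ?thesis using F(1) by (metis finite_insert)
  qed
qed

definition finite_projection :: "('i \<Rightarrow> 'a::chilbert_space) \<Rightarrow> 'i set \<Rightarrow> 'a \<Rightarrow> 'a" where
  "finite_projection b F z = (\<Sum>i\<in>F. cinner (b i) z *\<^sub>C b i)"

lemma cinner_finite_projection:
  "cinner (finite_projection b F w) z = cinner w (finite_projection b F z)"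
  unfolding finite_projection_def cinner_sum_left cinner_sum_right cinner_scaleC_left cinner_scaleC_right
  by (intro sum.cong refl) (metis cinner_commute mult.commute)

lemma cinner_finite_projection_self:
  "cinner z (finite_projection b F z) = complex_of_real (\<Sum>i\<in>F. (cmod (cinner (b i) z))\<^sup>2)"
  unfolding finite_projection_def cinner_sum_right cinner_scaleC_right of_real_sum
  by (intro sum.cong refl) (metis cinner_commute complex_norm_square of_real_power)

lemma finite_projection_idem:
  assumes b: "orthonormal_family F b" "finite F"
  shows "finite_projection b F (finite_projection b F z) = finite_projection b F z"
proof -
  have "cinner (b i) (finite_projection b F z) = cinner (b i) z" if i: "i \<in> F" for i
  proof -
    have "cinner (b i) (finite_projection b F z) = (\<Sum>j\<in>F. if i = j then cinner (b i) z else 0)"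
      unfolding finite_projection_def cinner_sum_right cinner_scaleC_right
      using i by (intro sum.cong refl) (auto simp: orthonormal_familyD[OF b(1)])
    then show ?thesis using b(2) i by simp
  qed
  then show ?thesis unfolding finite_projection_def[of b F "finite_projection b F z"]
    by (simp add: finite_projection_def[of b F z])
qed

lemma finite_projection_in_eigenspace:
  assumes "csubspace R" "\<And>i. i \<in> F \<Longrightarrow> b i \<in> eigenspace R a"
  shows "finite_projection b F z \<in> eigenspace R a"
  unfolding finite_projection_def
  by (intro complex_vec.subspace_sum complex_vec.subspace_scale csubspace_eigenspace assms)

lemma op_of_mult: "op_of f \<odot> op_of g = op_of (f \<circ> g)"
  by (auto simp: op_mult_def op_of_def)

lemma has_sum_finite_sum:
  fixes f :: "'j \<Rightarrow> 'a \<Rightarrow> real"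
  assumes "finite G" "\<And>j. (f j has_sum s j) A"
  shows "((\<lambda>x. \<Sum>j\<in>G. f j x) has_sum (\<Sum>j\<in>G. s j)) A"
  using assms(1) by (induction G) (auto intro!: has_sum_add assms(2))

text \<open>\<open>op_trace\<close> evaluates in an unspecified orthonormal basis, not in
  \<open>b\<close>, so matrix elements cannot be read off directly. The diagonal terms are brought
  to multiples of squared moduli of inner products with \<open>c\<close> and summed over
  \<open>c\<close> by Parseval. A single \<open>r\<close> fits because \<open>F\<close> will be the
  system basis at one fixed \<open>x\<close>.\<close>

lemma op_trace_two_time_measurement:
  fixes b :: "'i \<Rightarrow> 'h::chilbert_space"
  assumes b: "orthonormal_family I b" "closure (cspan (b ` I)) = UNIV"
    and F: "finite F" "F \<subseteq> I" and G: "finite G" "G \<subseteq> I"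
    and adj: "\<And>v w. cinner (u v) w = cinner v (u' w)"
    and \<rho>: "\<And>z w w'. (z, w) \<in> \<rho> \<Longrightarrow> (z, w') \<in> \<rho> \<Longrightarrow> w = w'" "csubspace \<rho>"
      "\<And>i. i \<in> F \<Longrightarrow> b i \<in> eigenspace \<rho> (complex_of_real r)"
  shows "op_trace UNIV (\<rho> \<odot> op_of (finite_projection b F) \<odot> op_of u' \<odot> op_of (finite_projection b G)
      \<odot> op_of u \<odot> op_of (finite_projection b F))
    = complex_of_real (r * (\<Sum>i\<in>F. \<Sum>j\<in>G. (cmod (cinner (b j) (u (b i))))\<^sup>2))"
proof -
  define p where "p = finite_projection b F"
  define q where "q = finite_projection b G"
  define C where "C = (SOME B. is_onb (UNIV :: 'h set) B)"
  have inj: "b i \<noteq> b j" if "i \<in> I" "j \<in> I" "i \<noteq> j" for i j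
    using orthonormal_familyD[OF b(1) that(1,2)] orthonormal_familyD[OF b(1) that(1,1)] that(3) by auto
  \<comment> \<open>Exhibiting one orthonormal basis guarantees that the choice \<open>C\<close>
    made by \<open>op_trace\<close> is one too.\<close>
  have "is_onb UNIV (b ` I)"
    unfolding is_onb_def
    using b orthonormal_family_norm[OF b(1)] orthonormal_familyD[OF b(1)] by auto
  then have "is_onb UNIV C" unfolding C_def by (rule someI)
  then have C: "orthonormal_family C (\<lambda>c. c)" "closure (cspan ((\<lambda>c. c) ` C)) = UNIV"
    unfolding is_onb_def orthonormal_family_def by (auto simp: cinner_self)
  let ?A = "\<rho> \<odot> op_of p \<odot> op_of u' \<odot> op_of q \<odot> op_of u \<odot> op_of p"
  define g where "g = p \<circ> u' \<circ> q \<circ> u \<circ> p"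
  have A: "?A = \<rho> \<odot> op_of g" by (simp add: op_of_mult g_def comp_assoc)
  \<comment> \<open>The outermost map in \<open>g\<close> is \<open>p\<close>, whose values lie in
    one eigenspace of \<open>\<rho>\<close>.\<close>
  have app: "op_app ?A c = complex_of_real r *\<^sub>C g c" for c
  proof -
    have "g c \<in> eigenspace \<rho> (complex_of_real r)"
      unfolding g_def p_def by (simp add: finite_projection_in_eigenspace[OF \<rho>(2,3)])
    then have "(g c, complex_of_real r *\<^sub>C g c) \<in> \<rho>" by (simp add: eigenspace_def)
    then show ?thesis
      unfolding A op_app_def using \<rho>(1) by (intro the_equality) (auto simp: op_mult_def op_of_def)
  qed
  \<comment> \<open>Moving \<open>p\<close> and \<open>u'\<close> to the left argument leaves
    \<open>r\<close> times the squared norm of \<open>q (u (p c))\<close>. Moving \<open>u\<close>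
    and \<open>p\<close> off \<open>c\<close> again isolates \<open>c\<close> for Parseval.\<close>
  have diagonal: "cinner c (op_app ?A c) = complex_of_real (r * (\<Sum>j\<in>G. (cmod (cinner c (p (u' (b j)))))\<^sup>2))" for c
  proof -
    have "cinner c (g c) = cinner (p c) (u' (q (u (p c))))"
      by (simp add: g_def p_def cinner_finite_projection)
    also have "\<dots> = cinner (u (p c)) (q (u (p c)))" by (simp add: adj)
    also have "\<dots> = complex_of_real (\<Sum>j\<in>G. (cmod (cinner (b j) (u (p c))))\<^sup>2)"
      by (simp add: q_def cinner_finite_projection_self)
    also have "(\<lambda>j. cmod (cinner (b j) (u (p c)))) = (\<lambda>j. cmod (cinner c (p (u' (b j)))))"
    proof
      fix j
      have "cinner (u (p c)) (b j) = cinner c (p (u' (b j)))"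
        by (simp add: adj p_def cinner_finite_projection)
      then show "cmod (cinner (b j) (u (p c))) = cmod (cinner c (p (u' (b j))))"
        by (subst cmod_cinner_commute) simp
    qed
    finally show ?thesis by (simp add: app cinner_scaleC_right)
  qed
  have norm_p: "(norm (p z))\<^sup>2 = (\<Sum>i\<in>F. (cmod (cinner (b i) z))\<^sup>2)" for z
  proof -
    have "complex_of_real ((norm (p z))\<^sup>2) = cinner z (p (p z))"
      unfolding p_def cinner_self[symmetric] cinner_finite_projection ..
    also have "\<dots> = complex_of_real (\<Sum>i\<in>F. (cmod (cinner (b i) z))\<^sup>2)"
      using finite_projection_idem[OF orthonormal_family_subset[OF b(1) F(2)] F(1)]
      by (simp add: p_def cinner_finite_projection_self)
    finally show ?thesis using of_real_eq_iff by blast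
  qed
  have "((\<lambda>c. (cmod (cinner c (p (u' (b j)))))\<^sup>2) has_sum (norm (p (u' (b j))))\<^sup>2) C" for j
    by (rule parseval_has_sum[OF C(1)]) (simp only: C(2) UNIV_I)
  then have "((\<lambda>c. \<Sum>j\<in>G. (cmod (cinner c (p (u' (b j)))))\<^sup>2) has_sum (\<Sum>j\<in>G. (norm (p (u' (b j))))\<^sup>2)) C"
    by (rule has_sum_finite_sum[OF G(1)])
  then have "((\<lambda>c. complex_of_real (r * (\<Sum>j\<in>G. (cmod (cinner c (p (u' (b j)))))\<^sup>2)))
      has_sum complex_of_real (r * (\<Sum>j\<in>G. (norm (p (u' (b j))))\<^sup>2))) C"
    by (intro has_sum_of_real has_sum_cmult_right)
  then have "op_trace UNIV ?A = complex_of_real (r * (\<Sum>j\<in>G. (norm (p (u' (b j))))\<^sup>2))"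
    unfolding op_trace_def C_def[symmetric] diagonal by (rule infsumI)
  also have "(\<Sum>j\<in>G. (norm (p (u' (b j))))\<^sup>2) = (\<Sum>j\<in>G. \<Sum>i\<in>F. (cmod (cinner (b j) (u (b i))))\<^sup>2)"
    unfolding norm_p
  proof (intro sum.cong refl arg_cong[where f = "\<lambda>x. x\<^sup>2"])
    fix i j
    have "cinner (b i) (u' (b j)) = cinner (u (b i)) (b j)" by (simp add: adj)
    then show "cmod (cinner (b i) (u' (b j))) = cmod (cinner (b j) (u (b i)))"
      by (subst (2) cmod_cinner_commute) simp
  qed
  also have "\<dots> = (\<Sum>i\<in>F. \<Sum>j\<in>G. (cmod (cinner (b j) (u (b i))))\<^sup>2)" by (rule sum.swap)
  finally show ?thesis by (simp add: p_def q_def)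
qed

text \<open>Completeness comes from Parseval, whose moduli do not notice the conjugation; an image
  of spans under an antilinear map is thereby avoided.\<close>

lemma antiunitary_orthonormal_basis:
  assumes T: "antiunitary T" and b: "orthonormal_family I b" "closure (cspan (b ` I)) = UNIV"
  shows "orthonormal_family I (\<lambda>i. T (b i))" "closure (cspan ((\<lambda>i. T (b i)) ` I)) = UNIV"
proof -
  have inner: "cinner (T x) (T y) = cnj (cinner x y)" for x y using T by (simp add: antiunitary_def)
  show orth: "orthonormal_family I (\<lambda>i. T (b i))"
    using b(1) by (simp add: orthonormal_family_def inner)
  show "closure (cspan ((\<lambda>i. T (b i)) ` I)) = UNIV"
  proof (intro equalityI subset_UNIV subsetI in_closure_if_parseval[OF orth])
    fix z
    have "surj T" using T by (simp add: antiunitary_def bij_is_surj)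
    then obtain w where w: "z = T w" by blast
    have "complex_of_real ((norm z)\<^sup>2) = complex_of_real ((norm w)\<^sup>2)"
      using inner[of w w] by (simp add: w cinner_self)
    then have "(norm z)\<^sup>2 = (norm w)\<^sup>2" using of_real_eq_iff by blast
    then show "((\<lambda>i. (cmod (cinner (T (b i)) z))\<^sup>2) has_sum (norm z)\<^sup>2) I"
      using parseval_has_sum[OF b(1), of w] b(2) by (simp add: w inner)
  qed
qed

text \<open>Time reversal turns \<open>\<langle>b i, u b j\<rangle>\<close> into a matrix element of the adjoint in the basis \<open>T b\<close>,
  and passing from the basis \<open>b\<close> to \<open>T b\<close> does not change sums weighted by functions of \<open>s\<close>.\<close>

lemma time_reversal_weighted_sum:
  assumes T: "antiunitary T" and b: "orthonormal_family I b" "closure (cspan (b ` I)) = UNIV"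
    and adj: "\<And>v w. cinner (u v) w = cinner v (u' w)" and rev: "\<And>v. u' (T v) = T (u v)"
    and orth: "\<And>i j. i \<in> I \<Longrightarrow> j \<in> I \<Longrightarrow> s i \<noteq> s j \<Longrightarrow> cinner (b i) (T (b j)) = 0"
    and nonneg: "\<And>\<sigma>. \<alpha> \<sigma> \<ge> 0" "\<And>\<sigma>. \<gamma> \<sigma> \<ge> (0::real)"
  shows "(\<Sum>\<^sub>\<infinity>i\<in>I. \<Sum>\<^sub>\<infinity>j\<in>I. ennreal (\<alpha> (s i) * \<gamma> (s j) * (cmod (cinner (b j) (u (b i))))\<^sup>2))
    = (\<Sum>\<^sub>\<infinity>i\<in>I. \<Sum>\<^sub>\<infinity>j\<in>I. ennreal (\<gamma> (s i) * \<alpha> (s j) * (cmod (cinner (b j) (u (b i))))\<^sup>2))"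
proof -
  define c where "c i = T (b i)" for i
  have c: "orthonormal_family I c" "closure (cspan (c ` I)) = UNIV"
    using antiunitary_orthonormal_basis[OF T b] by (simp_all add: c_def[abs_def])
  have orth': "cinner (b i) (c j) = 0" if "i \<in> I" "j \<in> I" "s i \<noteq> s j" for i j
    using orth[OF that] by (simp add: c_def)
  have swap_basis: "(\<Sum>\<^sub>\<infinity>i\<in>I. ennreal (g (s i) * (cmod (cinner (b i) z))\<^sup>2))
      = (\<Sum>\<^sub>\<infinity>i\<in>I. ennreal (g (s i) * (cmod (cinner (c i) z))\<^sup>2))" if "\<And>\<sigma>. g \<sigma> \<ge> 0" for g z
    by (rule weighted_parseval_independent[OF b c orth' that])
  \<comment> \<open>For fixed \<open>i\<close>, the inner sum is a weighted Parseval sum of the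
    vector \<open>u (b i)\<close>. After exchanging the sums and passing to \<open>u'\<close>, the
    other index is treated in the same way.\<close>
  have "(\<Sum>\<^sub>\<infinity>i\<in>I. \<Sum>\<^sub>\<infinity>j\<in>I. ennreal (\<alpha> (s i) * \<gamma> (s j) * (cmod (cinner (b j) (u (b i))))\<^sup>2))
      = (\<Sum>\<^sub>\<infinity>i\<in>I. \<Sum>\<^sub>\<infinity>j\<in>I. ennreal (\<alpha> (s i) * \<gamma> (s j) * (cmod (cinner (c j) (u (b i))))\<^sup>2))"
    by (intro infsum_cong swap_basis[of "\<lambda>\<sigma>. \<alpha> (s _) * \<gamma> \<sigma>"] mult_nonneg_nonneg nonneg)
  also have "\<dots> = (\<Sum>\<^sub>\<infinity>j\<in>I. \<Sum>\<^sub>\<infinity>i\<in>I. ennreal (\<alpha> (s i) * \<gamma> (s j) * (cmod (cinner (c j) (u (b i))))\<^sup>2))"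
    by (rule infsum_swap_ennreal)
  also have "\<dots> = (\<Sum>\<^sub>\<infinity>j\<in>I. \<Sum>\<^sub>\<infinity>i\<in>I. ennreal (\<gamma> (s j) * \<alpha> (s i) * (cmod (cinner (b i) (u' (c j))))\<^sup>2))"
  proof (intro infsum_cong arg_cong[where f = ennreal])
    fix i j
    have "cmod (cinner (c j) (u (b i))) = cmod (cinner (b i) (u' (c j)))"
      by (subst cmod_cinner_commute) (simp only: adj)
    then show "\<alpha> (s i) * \<gamma> (s j) * (cmod (cinner (c j) (u (b i))))\<^sup>2
        = \<gamma> (s j) * \<alpha> (s i) * (cmod (cinner (b i) (u' (c j))))\<^sup>2" by simp
  qed
  also have "\<dots> = (\<Sum>\<^sub>\<infinity>j\<in>I. \<Sum>\<^sub>\<infinity>i\<in>I. ennreal (\<gamma> (s j) * \<alpha> (s i) * (cmod (cinner (c i) (u' (c j))))\<^sup>2))"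
    by (intro infsum_cong swap_basis[of "\<lambda>\<sigma>. \<gamma> (s _) * \<alpha> \<sigma>"] mult_nonneg_nonneg nonneg)
  also have "\<dots> = (\<Sum>\<^sub>\<infinity>j\<in>I. \<Sum>\<^sub>\<infinity>i\<in>I. ennreal (\<gamma> (s j) * \<alpha> (s i) * (cmod (cinner (b i) (u (b j))))\<^sup>2))"
  proof -
    have "cinner (c i) (u' (c j)) = cnj (cinner (b i) (u (b j)))" for i j
      using T by (simp add: c_def rev antiunitary_def)
    then show ?thesis by simp
  qed
  finally show ?thesis .
qed

text \<open>The trace sums the system indices inside each term while the distribution sums over
  \<open>X\<close> outside; this regroups both into a double sum over full basis indices.\<close>

lemma infsum_prod_finite_ennreal:
  fixes h :: "'f \<times> 'x \<Rightarrow> 'f \<times> 'x \<Rightarrow> ennreal"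
  assumes F: "finite F"
  shows "(\<Sum>\<^sub>\<infinity>(x, y)\<in>X \<times> X. \<Sum>f\<in>F. \<Sum>g\<in>F. h (f, x) (g, y)) = (\<Sum>\<^sub>\<infinity>i\<in>F \<times> X. \<Sum>\<^sub>\<infinity>j\<in>F \<times> X. h i j)"
proof -
  have prod: "(\<Sum>\<^sub>\<infinity>i\<in>F \<times> X. k i) = (\<Sum>\<^sub>\<infinity>x\<in>X. \<Sum>f\<in>F. k (f, x))" for k :: "'f \<times> 'x \<Rightarrow> ennreal"
    using F infsum_swap_ennreal[of "\<lambda>f x. k (f, x)" X F] by (simp add: infsum_Sigma_ennreal)
  have swap: "(\<Sum>f\<in>F. \<Sum>\<^sub>\<infinity>y\<in>X. k f y) = (\<Sum>\<^sub>\<infinity>y\<in>X. \<Sum>f\<in>F. k f y)" for k :: "'f \<Rightarrow> 'x \<Rightarrow> ennreal"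
    using F infsum_swap_ennreal[of k X F] by simp
  have "(\<Sum>\<^sub>\<infinity>(x, y)\<in>X \<times> X. \<Sum>f\<in>F. \<Sum>g\<in>F. h (f, x) (g, y))
      = (\<Sum>\<^sub>\<infinity>x\<in>X. \<Sum>\<^sub>\<infinity>y\<in>X. \<Sum>f\<in>F. \<Sum>g\<in>F. h (f, x) (g, y))"
    by (simp add: infsum_Sigma_ennreal)
  then show ?thesis by (simp only: prod swap)
qed

theorem mainTheorem2:
  fixes K :: "'k set" and d :: nat
    and V :: "'k option \<Rightarrow> 'a::chilbert_space set"
      \<comment> \<open>\<open>V None\<close> is the small system space, \<open>V (Some k)\<close> the space of reservoir \<open>k\<close>\<close>
    and W :: "'k \<Rightarrow> 'b::chilbert_space set"
    and tens :: "('k option \<Rightarrow> 'a) \<Rightarrow> 'h::chilbert_space"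
    and tensR :: "('k option \<Rightarrow> 'a) \<Rightarrow> 'r::chilbert_space"
    and tensI :: "'k \<Rightarrow> ('k option \<Rightarrow> 'a) \<Rightarrow> 'b"
    and H :: "'k \<Rightarrow> 'a operator" and HS :: "'a operator"
    and HI :: "'k \<Rightarrow> 'b operator" and HL :: "'h operator"
    and E :: "'k \<Rightarrow> real set \<Rightarrow> 'a \<Rightarrow> 'a" and EL :: "real set \<Rightarrow> 'h \<Rightarrow> 'h"
    and \<beta> :: "'k \<Rightarrow> real" and lambda :: real and Z :: "'k \<Rightarrow> real"
    and H_ext :: "'k \<Rightarrow> 'h operator" and U :: "real \<Rightarrow> 'h operator"
    and T :: "'h \<Rightarrow> 'h" and \<rho>0 :: "'h operator"
    and X :: "'x set" and ket :: "'x \<Rightarrow> 'r" and e :: "'k \<Rightarrow> 'x \<Rightarrow> real"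
    and P :: "'x \<Rightarrow> 'h operator"
    and F :: "real \<Rightarrow> real \<Rightarrow> ennreal"
  assumes finite_K: "finite K"
    \<comment> \<open>the Hilbert spaces and their tensor products\<close>
    and V_Hilbert: "\<And>i. i \<in> insert None (Some ` K) \<Longrightarrow> closed_csubspace (V i)"
    and V_S_finite_dim: "\<exists>B. finite B \<and> V None = cspan B" "cdim (V None) = d"
    and tens: "tensor_product (insert None (Some ` K)) V tens UNIV"
    and tensR: "tensor_product (Some ` K) V tensR UNIV"
    and tensI: "\<And>k. k \<in> K \<Longrightarrow> tensor_product {None, Some k} V (tensI k) (W k)"
    \<comment> \<open>the reservoirs\<close>
    and H_sa: "\<And>k. k \<in> K \<Longrightarrow> self_adjoint (V (Some k)) (H k)"
    and H_discrete: "\<And>k. k \<in> K \<Longrightarrow> discrete_spectrum (V (Some k)) (H k)"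
    and E: "\<And>k. k \<in> K \<Longrightarrow> spectral_measure_of (V (Some k)) (H k) (E k)"
    and beta_pos: "\<And>k. k \<in> K \<Longrightarrow> \<beta> k > 0"
    and Z_finite: "\<And>k. k \<in> K \<Longrightarrow> positive_trace (V (Some k))
          (spectral_integral (V (Some k)) (E k) (\<lambda>s. exp (- of_real (\<beta> k * s)))) < \<infinity>"
    and Z_eq: "\<And>k. k \<in> K \<Longrightarrow> Z k = enn2real (positive_trace (V (Some k))
          (spectral_integral (V (Some k)) (E k) (\<lambda>s. exp (- of_real (\<beta> k * s)))))"
    and H_ext_eq: "\<And>k. k \<in> K \<Longrightarrow>
          H_ext k = factor_ampliation (insert None (Some ` K)) V tens (Some k) (H k)"
    \<comment> \<open>the coupled dynamics\<close>
    and HS_sa: "self_adjoint (V None) HS"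
    and HI_sa: "\<And>k. k \<in> K \<Longrightarrow> self_adjoint (W k) (HI k)"
    and HL_sa: "self_adjoint UNIV HL"
    and HL_eq: "HL = closure
          (op_add (factor_ampliation (insert None (Some ` K)) V tens None HS)
          (op_add (op_sum K H_ext)
            (op_scale (of_real lambda) (op_sum K (\<lambda>k.
              ampliation (insert None (Some ` K)) V tens {None, Some k} (tensI k) (HI k))))))"
    and EL: "spectral_measure_of UNIV HL EL"
    and U_eq: "\<And>t. U t = spectral_integral UNIV EL (\<lambda>s. exp (- \<i> * of_real t * of_real s))"
    \<comment> \<open>time reversal\<close>
    and T_antiunitary: "antiunitary T"
    and TT: "op_of T \<odot> op_of T = Id"
    and T_H: "\<And>k. k \<in> K \<Longrightarrow> op_commutes (op_of T) (H_ext k)"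
    and T_HL: "op_commutes (op_of T) HL"
    and T_U: "\<And>t. op_of T \<odot> U t \<odot> op_of T = U (- t)"
    \<comment> \<open>the initial state\<close>
    and rho0_eq: "\<rho>0 = tensor_operator (insert None (Some ` K)) V tens
          (case_option (op_scale (1 / of_nat d) (Id_on (V None)))
            (\<lambda>k. op_scale (1 / of_real (Z k))
               (spectral_integral (V (Some k)) (E k) (\<lambda>s. exp (- of_real (\<beta> k * s))))))"
    \<comment> \<open>the joint eigenbasis\<close>
    and X_onb: "inj_on ket X" "is_onb UNIV (ket ` X)"
    and X_eigen: "\<And>x k. x \<in> X \<Longrightarrow> k \<in> K \<Longrightarrow>
          (ket x, of_real (e k x) *\<^sub>C ket x) \<in> factor_ampliation (Some ` K) V tensR (Some k) (H k)"
    and P_eq: "\<And>x. x \<in> X \<Longrightarrow> P x = ampliation (insert None (Some ` K)) V tens (Some ` K) tensR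
          (rank_one_projection (ket x))"
    and F_eq: "\<And>\<kappa> t. F \<kappa> t = tpm_laplace X (entropy_production K \<beta> e) \<rho>0 P U \<kappa> t"
  shows "\<forall>t \<kappa>. F \<kappa> t = F (1 - \<kappa>) t"
proof -

  \<comment> \<open>Setup: tensor structures and spectral measures\<close>
  define I0 where "I0 = insert None (Some ` K)"
  define g where "g k s = (exp (- of_real (\<beta> k * s)) :: complex)" for k and s :: real
  have V: "csubspace (V i)" "closed (V i)" "closed_csubspace (V i)" if "i \<in> I0" for i
    using V_Hilbert[of i] that by (auto simp: I0_def closed_csubspace_def)
  have tens_inner: "cinner (tens x) (tens y) = (\<Prod>i\<in>I0. cinner (x i) (y i))"
    if "x \<in> Pi I0 V" "y \<in> Pi I0 V" for x y
    using tens that unfolding tensor_product_def I0_def by blast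
  have tens_total: "closure (cspan (tens ` Pi I0 V)) = UNIV"
    using tens unfolding tensor_product_def I0_def by blast
  have tensR_inner: "cinner (tensR x) (tensR y) = (\<Prod>i\<in>Some ` K. cinner (x i) (y i))"
    if "x \<in> Pi (Some ` K) V" "y \<in> Pi (Some ` K) V" for x y
    using tensR that unfolding tensor_product_def by blast
  have tensR_total: "closure (cspan (tensR ` Pi (Some ` K) V)) = UNIV"
    using tensR unfolding tensor_product_def by blast
  interpret S: tensor_subset I0 V tens "Some ` K" tensR
    using finite_K V(1) tens_inner tensR_inner by unfold_locales (auto simp: I0_def)
  interpret R: tensor "Some ` K" V tensR
    using finite_K V(1) tensR_inner by unfold_locales (auto simp: I0_def)
  have pvm_E: "pvm (V (Some k)) (E k)" if "k \<in> K" for k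
    using E[OF that] by (simp add: pvm_def spectral_measure_of_def)
  have H_eq: "H k = spectral_integral (V (Some k)) (E k) complex_of_real" if "k \<in> K" for k
    using E[OF that] by (simp add: spectral_measure_of_def)
  have SomeI: "Some k \<in> I0" if "k \<in> K" for k using that by (simp add: I0_def)

  \<comment> \<open>An orthonormal basis of system vectors tensored with kets\<close>
  obtain B where "finite B" "V None = cspan B" using V_S_finite_dim(1) by blast
  then obtain F0 where F0: "finite F0" "orthonormal_family F0 (\<lambda>f. f)" "cspan F0 = V None"
    using finite_orthonormal_basis[of B] by metis
  have F0V: "f \<in> V None" if "f \<in> F0" for f using F0(3) complex_vec.span_base[OF that] by simp
  \<comment> \<open>The graph \<open>S.TW\<close> reads this family at \<open>None\<close> alone;
    the value 0 elsewhere just keeps it inside \<open>Pi I0 V\<close>.\<close>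
  define slot :: "'a \<Rightarrow> 'k option \<Rightarrow> 'a" where "slot f = (\<lambda>i. if i = None then f else 0)" for f
  have slot: "slot f \<in> Pi I0 V" if "f \<in> F0" for f
    using F0V[OF that] complex_vec.subspace_0[OF V(1)] by (auto simp: slot_def)
  define I where "I = F0 \<times> X"
  \<comment> \<open>The tensor product of the system vector with the ket. It is selected from the
    graph because a ket need not be an elementary tensor.\<close>
  define b where "b i = (SOME w. (ket (snd i), w) \<in> S.TW (slot (fst i)))" for i
  have bTW: "(ket x, b (f, x)) \<in> S.TW (slot f)" if "f \<in> F0" for f x
    unfolding b_def fst_conv snd_conv
    by (rule someI_ex[OF S.tensor_with_total[OF slot[OF that] tensR_total]])
  have ket: "cinner (ket x) (ket y) = (if x = y then 1 else 0)" if "x \<in> X" "y \<in> X" for x y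
    using X_onb that unfolding is_onb_def by (auto simp: cinner_self inj_on_eq_iff)
  have diff: "I0 - Some ` K = {None}" by (auto simp: I0_def)
  have b_orth: "orthonormal_family I b"
    unfolding orthonormal_family_def
  proof (intro ballI)
    fix i j assume "i \<in> I" "j \<in> I"
    then obtain f x g y where ij: "i = (f, x)" "j = (g, y)" "f \<in> F0" "g \<in> F0" "x \<in> X" "y \<in> X"
      by (auto simp: I_def)
    have "cinner (b i) (b j) = cinner f g * cinner (ket x) (ket y)"
      using S.cinner_tensor_with[OF slot slot bTW bTW, of f g x y] ij by (simp add: diff slot_def)
    then show "cinner (b i) (b j) = (if i = j then 1 else 0)"
      using orthonormal_familyD[OF F0(2), of f g] ket[of x y] ij by simp
  qed
  define N where "N = closure (cspan (b ` I))"
  have N: "csubspace N" "closed N"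
    by (simp_all add: N_def csubspace_closure)
  have b_total: "closure (cspan (b ` I)) = UNIV"
  proof -
    \<comment> \<open>The kets are total, so tensoring any reservoir vector with a system basis
      vector \<open>f\<close> stays in \<open>N\<close>. Expanding the \<open>None\<close> factor in
      \<open>F0\<close> then covers all elementary tensors.\<close>
    have in_N: "w \<in> N" if "f \<in> F0" "(u, w) \<in> S.TW (slot f)" for f u w
    proof (rule S.tensor_with_closure_cspan[OF slot[OF that(1)] tensR_total N _ _ that(2)])
      show "u \<in> closure (cspan (ket ` X))" using X_onb(2) by (simp add: is_onb_def)
      fix u w assume "u \<in> ket ` X" and w: "(u, w) \<in> S.TW (slot f)"
      then obtain x where "x \<in> X" "u = ket x" by blast
      with w have "w = b (f, x)"
        using S.tensor_with_unique[OF slot[OF that(1)] _ bTW[OF that(1)]] by blast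
      then show "w \<in> N"
        unfolding N_def using \<open>x \<in> X\<close> that(1)
        by (intro closure_subset[THEN subsetD] complex_vec.span_base) (auto simp: I_def)
    qed
    have "tens y \<in> N" if y: "y \<in> Pi I0 V" for y
    proof -
      have "y None \<in> cspan F0" using y F0(3) by (auto simp: I0_def)
      then obtain c where c: "y None = (\<Sum>f\<in>F0. c f *\<^sub>C f)"
        using complex_vec.span_finite[OF F0(1)] by auto
      have "tens (y(None := f)) \<in> N" if f: "f \<in> F0" for f
      proof -
        have "tens (y(None := f)) = tens (override_on (slot f) y (Some ` K))"
          using y F0V[OF f] by (intro S.tensor_cong) (auto simp: I0_def slot_def override_on_def)
        moreover have "y \<in> Pi (Some ` K) V" using y by (auto simp: I0_def)
        ultimately show ?thesis using in_N[OF f S.tensor_with_elementary] by simp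
      qed
      moreover have "tens (y(None := \<Sum>f\<in>F0. c f *\<^sub>C f)) = (\<Sum>f\<in>F0. c f *\<^sub>C tens (y(None := f)))"
        by (rule S.tensor_slot_sum[OF _ y F0(1) F0V]) (simp add: I0_def)
      moreover have "y(None := \<Sum>f\<in>F0. c f *\<^sub>C f) = y" using c by auto
      ultimately show ?thesis
        using N(1) by (simp add: complex_vec.subspace_sum complex_vec.subspace_scale)
    qed
    then have "z \<in> N" for z
      using tens_total by (intro cspan_closure_induct[OF _ N, of z "tens ` Pi I0 V"]) auto
    then show ?thesis by (auto simp: N_def)
  qed

  \<comment> \<open>Eigenvalue relations on the basis\<close>
  define G where "G x = {v \<in> Pi I0 V. \<forall>k\<in>K. v (Some k) \<in> eigenspace (H k) (of_real (e k x))}" for x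
  have b_closure: "b (f, x) \<in> closure (cspan (tens ` G x))" if f: "f \<in> F0" and x: "x \<in> X" for f x
  proof (rule S.tensor_with_closure_cspan[OF slot[OF f] tensR_total _ _ _ _ bTW[OF f]])
    define J where "J = (\<Pi> i\<in>Some ` K. eigenspace (H (the i)) (of_real (e (the i) x)))"
    show "ket x \<in> closure (cspan (tensR ` J))"
      unfolding J_def
      by (rule R.joint_eigenvector_in_product_eigenspace[where A = "\<lambda>i. H (the i)" and a = "\<lambda>i. e (the i) x"])
        (use V SomeI tensR_total H_sa X_eigen[OF x] in auto)
    fix u w assume "u \<in> tensR ` J" and w: "(u, w) \<in> S.TW (slot f)"
    then obtain v where v: "v \<in> J" "u = tensR v" by blast
    have eig: "v (Some k) \<in> eigenspace (H k) (of_real (e k x))" if "k \<in> K" for k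
      using v(1) that by (auto simp: J_def Pi_iff)
    have "v (Some k) \<in> V (Some k)" if "k \<in> K" for k
      using eig[OF that] H_sa[OF that] by (auto simp: eigenspace_def self_adjoint_def linear_operator_def)
    then have vV: "v \<in> Pi (Some ` K) V" by auto
    have "w = tens (override_on (slot f) v (Some ` K))"
      using S.tensor_with_unique[OF slot[OF f] _ S.tensor_with_elementary[OF vV]] w v(2) by blast
    moreover have "override_on (slot f) v (Some ` K) \<in> G x"
      using S.override_Pi[OF slot[OF f] vV] eig by (simp add: G_def)
    ultimately show "w \<in> closure (cspan (tens ` G x))"
      by (intro closure_subset[THEN subsetD] complex_vec.span_base) auto
  qed (simp_all add: csubspace_closure)
  \<comment> \<open>Eigenspaces of closed linear graphs are closed subspaces, so a relation checked
    on the products in \<open>G x\<close> holds for \<open>b (f, x)\<close>. It is applied to each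
    \<open>H_ext k\<close> and to \<open>\<rho>0\<close>.\<close>
  have b_eigen: "b (f, x) \<in> eigenspace A a"
    if "f \<in> F0" "x \<in> X" "csubspace A" "closed A" "\<And>v. v \<in> G x \<Longrightarrow> (tens v, a *\<^sub>C tens v) \<in> A" for f x A a
    by (rule cspan_closure_induct[OF b_closure[OF that(1,2)] csubspace_eigenspace[OF that(3)]
          closed_eigenspace[OF that(4)]]) (use that(5) in \<open>auto simp: eigenspace_def\<close>)
  have b_H: "b (f, x) \<in> eigenspace (H_ext k) (of_real (e k x))" if "f \<in> F0" "x \<in> X" "k \<in> K" for f x k
  proof (rule b_eigen[OF that(1,2)])
    fix v assume "v \<in> G x"
    then have v: "v \<in> Pi I0 V" "(v (Some k), of_real (e k x) *\<^sub>C v (Some k)) \<in> H k"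
      using that(3) by (auto simp: G_def eigenspace_def)
    have vk: "v (Some k) \<in> V (Some k)" using v(1) SomeI[OF that(3)] by auto
    have "(tens (v(Some k := v (Some k))), tens (v(Some k := of_real (e k x) *\<^sub>C v (Some k))))
        \<in> factor_ampliation I0 V tens (Some k) (H k)"
      by (rule S.factor_ampliation_mem[OF SomeI[OF that(3)] v(1) v(2) vk
            complex_vec.subspace_scale[OF V(1)[OF SomeI[OF that(3)]] vk]])
    then show "(tens v, of_real (e k x) *\<^sub>C tens v) \<in> H_ext k"
      using S.tensor_slot_scale[OF SomeI[OF that(3)] v(1) vk, of "of_real (e k x)"]
      by (simp add: H_ext_eq[OF that(3)] I0_def)
  qed (simp_all add: H_ext_eq[OF that(3)] factor_ampliation_def csubspace_ampliation closed_ampliation)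

  \<comment> \<open>The initial state\<close>
  define A where "A = case_option (op_scale (1 / of_nat d) (Id_on (V None)))
    (\<lambda>k. op_scale (1 / of_real (Z k)) (spectral_integral (V (Some k)) (E k) (g k)))"
  have \<rho>0: "\<rho>0 = tensor_operator I0 V tens A"
    unfolding rho0_eq I0_def A_def g_def ..
  \<comment> \<open>Collects the normalisations of all factors; its nonnegativity lets
    \<open>ennreal\<close> distribute over the products and sums below.\<close>
  define C where "C = 1 / real d * (\<Prod>k\<in>K. 1 / Z k)"
  have C: "C \<ge> 0" unfolding C_def using Z_eq by (intro mult_nonneg_nonneg prod_nonneg) auto
  define s where "s x = (\<Sum>k\<in>K. \<beta> k * e k x)" for x
  have b_\<rho>: "b (f, x) \<in> eigenspace \<rho>0 (of_real (C * exp (- s x)))" if "f \<in> F0" "x \<in> X" for f x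
  proof (rule b_eigen[OF that])
    fix v assume vG: "v \<in> G x"
    then have v: "v \<in> Pi I0 V" by (simp add: G_def)
    define c where "c = case_option (1 / of_nat d :: complex) (\<lambda>k. 1 / of_real (Z k) * g k (e k x))"
    have "(v i, c i *\<^sub>C v i) \<in> A i" if i: "i \<in> I0" for i
    proof (cases i)
      case None
      then show ?thesis using v i by (auto simp: A_def c_def op_scale_def)
    next
      case (Some k)
      then have k: "k \<in> K" using i by (auto simp: I0_def)
      have "(v i, of_real (e k x) *\<^sub>C v i) \<in> H k" using vG k Some by (auto simp: G_def eigenspace_def)
      then have "(v i, g k (e k x) *\<^sub>C v i) \<in> spectral_integral (V (Some k)) (E k) (g k)"
        unfolding H_eq[OF k] by (rule pvm.spectral_integral_eigenvector[OF pvm_E[OF k]])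
      then show ?thesis using Some by (force simp: A_def c_def op_scale_def scaleC_scaleC)
    qed
    moreover have "(\<lambda>i. c i *\<^sub>C v i) \<in> Pi I0 V"
      using v complex_vec.subspace_scale[OF V(1)] by (fastforce simp: Pi_iff)
    ultimately have "(tens v, tens (\<lambda>i. c i *\<^sub>C v i)) \<in> \<rho>0"
      unfolding \<rho>0 tensor_operator_def using v
      by (intro closure_subset[THEN subsetD] complex_vec.span_base) blast
    moreover have "(\<Prod>i\<in>I0. c i) = of_real (C * exp (- s x))"
    proof -
      have "(\<Prod>i\<in>I0. c i) = 1 / of_nat d * (\<Prod>k\<in>K. 1 / of_real (Z k) * g k (e k x))"
        using finite_K by (simp add: I0_def c_def prod.reindex)
      also have "(\<Prod>k\<in>K. 1 / of_real (Z k) * g k (e k x)) = (\<Prod>k\<in>K. of_real (1 / Z k * exp (- (\<beta> k * e k x))))"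
        by (simp add: g_def flip: exp_of_real)
      also have "1 / of_nat d * \<dots> = of_real (C * exp (- s x))"
        using finite_K by (simp add: C_def s_def prod.distrib exp_sum sum_negf[symmetric] prod_dividef)
      finally show ?thesis .
    qed
    ultimately show "(tens v, of_real (C * exp (- s x)) *\<^sub>C tens v) \<in> \<rho>0"
      using S.tensor_scale_all[OF v, of c] by simp
  qed (simp_all add: \<rho>0 csubspace_tensor_operator closed_tensor_operator)
  have g_meas: "g k \<in> borel_measurable borel" for k
    unfolding g_def by (intro borel_measurable_continuous_onI continuous_intros)
  have sym_A: "symmetric_operator (A i)" if "i \<in> I0" for i
  proof (cases i)
    case None
    have "symmetric_operator (Id_on (V None))" by (rule symmetric_operatorI) auto
    from symmetric_operator_scale[OF this, of "1 / real d"] show ?thesis by (simp add: A_def None)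
  next
    case (Some k)
    then have k: "k \<in> K" using that by (auto simp: I0_def)
    have "symmetric_operator (spectral_integral (V (Some k)) (E k) (g k))"
      by (rule pvm.symmetric_real_spectral_integral[OF pvm_E[OF k] g_meas]) (simp add: g_def exp_cnj)
    from symmetric_operator_scale[OF this, of "1 / Z k"] show ?thesis by (simp add: A_def Some)
  qed
  \<comment> \<open>\<open>op_app\<close> reads values through a definite description, so the
    closure defining \<open>\<rho>0\<close> must be single-valued. Its symmetric factors are
    everywhere defined, hence every elementary tensor lies in its domain.\<close>
  have \<rho>0_unique: "w = w'" if "(z, w) \<in> \<rho>0" "(z, w') \<in> \<rho>0" for z w w'
  proof (rule symmetric_operator_unique[OF _ _ tens_total that])
    show "symmetric_operator \<rho>0" unfolding \<rho>0 by (rule S.symmetric_tensor_operator[OF sym_A])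
    show "tens ` Pi I0 V \<subseteq> Domain \<rho>0"
    proof (rule image_subsetI)
      fix v assume v: "v \<in> Pi I0 V"
      have "\<exists>y. y \<in> V i \<and> (v i, y) \<in> A i" if i: "i \<in> I0" for i
      proof (cases i)
        case None
        have "v None \<in> V None" using v i None by auto
        then show ?thesis
          using V(1)[OF i] None complex_vec.subspace_scale by (auto simp: A_def op_scale_def)
      next
        case (Some k)
        then have k: "k \<in> K" using i by (auto simp: I0_def)
        let ?D = "spectral_integral (V (Some k)) (E k) (g k)"
        \<comment> \<open>\<open>positive_trace\<close> is infinite for an operator that is not
          everywhere defined, so finiteness of the partition function settles the domain.\<close>
        have "Domain ?D = V (Some k)"
          using Z_finite[OF k] unfolding g_def[abs_def] positive_trace_def by (auto split: if_splits)
        then obtain y where y: "(v i, y) \<in> ?D" using v i Some by auto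
        have "y \<in> V i"
          using pvm.spectral_integral_subset(2)[OF pvm_E[OF k] V(3)[OF SomeI[OF k]] y] Some by simp
        then show ?thesis
          using y Some complex_vec.subspace_scale[OF V(1)[OF i]] by (auto simp: A_def op_scale_def)
      qed
      then obtain y where y: "\<And>i. i \<in> I0 \<Longrightarrow> y i \<in> V i \<and> (v i, y i) \<in> A i" by metis
      then have "(tens v, tens y) \<in> \<rho>0"
        unfolding \<rho>0 tensor_operator_def using v
        by (intro closure_subset[THEN subsetD] complex_vec.span_base) blast
      then show "tens v \<in> Domain \<rho>0" by blast
    qed
  qed
  have \<rho>0_sub: "csubspace \<rho>0" by (simp add: \<rho>0 csubspace_tensor_operator)

  \<comment> \<open>The measurement projections\<close>
  have P: "P x = op_of (finite_projection b (F0 \<times> {x}))" if x: "x \<in> X" for x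
  proof -
    have Px: "P x = ampliation I0 V tens (Some ` K) tensR (rank_one_projection (ket x))"
      using P_eq[OF x] by (simp add: I0_def)
    show ?thesis
      unfolding finite_projection_def[abs_def]
    proof (rule symmetric_operator_finite_projection[OF _ _ _ b_orth b_total])
      show "symmetric_operator (P x)"
        unfolding Px by (rule S.symmetric_ampliation[OF symmetric_rank_one_projection])
      fix i assume "i \<in> I"
      then obtain f y where i: "i = (f, y)" "f \<in> F0" "y \<in> X" by (auto simp: I_def)
      define a where "a = cinner (ket x) (ket y)"
      \<comment> \<open>The rank-one projection sends \<open>ket y\<close> to
        \<open>a *\<^sub>C ket x\<close>; tensoring both with the same \<open>f\<close> gives this
        pair, and \<open>a\<close> is 1 or 0 by orthonormality.\<close>
      have "(b (f, y), a *\<^sub>C b (f, x)) \<in> P x"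
        unfolding Px
        by (rule S.ampliation_mem[OF slot[OF i(2)] _ bTW[OF i(2)] S.tensor_with_scale[OF bTW[OF i(2)]]])
          (auto simp: rank_one_projection_def op_of_def a_def)
      then show "(b i, if i \<in> F0 \<times> {x} then b i else 0) \<in> P x"
        using ket[OF x i(3)] i by (auto simp: a_def scaleC_one split: if_splits)
    qed (use F0(1) x in \<open>auto simp: I_def Px csubspace_ampliation closed_ampliation\<close>)
  qed

  \<comment> \<open>The unitary group and time reversal\<close>
  have "projection_valued_measure UNIV EL" using EL by (simp add: spectral_measure_of_def)
  from unitary_group_functions[OF this U_eq]
  obtain u where u: "\<And>t. U t = op_of (u t)" and adj: "\<And>t v w. cinner (u t v) w = cinner v (u (- t) w)"
    by blast
  have op_of_inject: "f = g" if "op_of f = op_of g" for f g :: "'h \<Rightarrow> 'h"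
    using that by (fastforce simp: op_of_def)
  have TT': "T (T v) = v" for v
  proof -
    have "(v, T (T v)) \<in> op_of T \<odot> op_of T" by (auto simp: op_mult_def op_of_def)
    then show ?thesis using TT by simp
  qed
  have rev: "u (- t) (T v) = T (u t v)" for t v
  proof -
    have "T \<circ> u t \<circ> T = u (- t)"
      using T_U[of t] by (intro op_of_inject) (simp add: u op_of_mult comp_assoc)
    then have "u (- t) (T v) = T (u t (T (T v)))" by (metis comp_apply)
    then show ?thesis by (simp add: TT')
  qed
  have T_H_eigen: "T z \<in> eigenspace (H_ext k) (of_real r)"
    if "k \<in> K" "z \<in> eigenspace (H_ext k) (of_real r)" for k z r
  proof -
    have "(z, T (of_real r *\<^sub>C z)) \<in> op_of T \<odot> H_ext k"
      using that(2) by (auto simp: op_mult_def op_of_def eigenspace_def)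
    then have "(T z, T (of_real r *\<^sub>C z)) \<in> H_ext k"
      using T_H[OF that(1)] unfolding op_commutes_def by (auto simp: op_mult_def op_of_def)
    \<comment> \<open>The eigenvalue is real, so the conjugation in the antilinearity of
      \<open>T\<close> leaves it unchanged.\<close>
    then show ?thesis using T_antiunitary by (simp add: eigenspace_def antiunitary_def)
  qed
  have sym_H: "symmetric_operator (H_ext k)" if "k \<in> K" for k
    using S.symmetric_factor_ampliation[OF SomeI[OF that] symmetric_self_adjoint[OF H_sa[OF that]]]
    by (simp add: H_ext_eq[OF that] I0_def)
  have orth: "cinner (b i) (T (b j)) = 0" if ij: "i \<in> I" "j \<in> I" "s (snd i) \<noteq> s (snd j)" for i j
  proof -
    \<comment> \<open>Different values of \<open>s\<close> force some \<open>H_ext k\<close> to have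
      different eigenvalues on the two vectors, and eigenvectors of a symmetric operator with
      distinct real eigenvalues are orthogonal.\<close>
    obtain k where k: "k \<in> K" "e k (snd i) \<noteq> e k (snd j)"
      using ij(3) unfolding s_def by (metis (no_types, lifting) sum.cong)
    have "b i \<in> eigenspace (H_ext k) (of_real (e k (snd i)))" "b j \<in> eigenspace (H_ext k) (of_real (e k (snd j)))"
      using b_H[of "fst i" "snd i" k] b_H[of "fst j" "snd j" k] ij(1,2) k(1) by (auto simp: I_def)
    then have "cinner (b i) (of_real (e k (snd j)) *\<^sub>C T (b j)) = cinner (of_real (e k (snd i)) *\<^sub>C b i) (T (b j))"
      using T_H_eigen[OF k(1)] symmetric_operatorD[OF sym_H[OF k(1)]] by (simp add: eigenspace_def)
    then show ?thesis using k(2) by (simp add: cinner_scaleC_left cinner_scaleC_right)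
  qed

  \<comment> \<open>The Laplace transform as a double sum, and its symmetry\<close>
  \<comment> \<open>The two weights are kept as parameters, so that time reversal becomes the
    exchange of \<open>\<alpha>\<close> and \<open>\<gamma>\<close>.\<close>
  define \<Phi> where "\<Phi> \<alpha> \<gamma> t = (\<Sum>\<^sub>\<infinity>i\<in>I. \<Sum>\<^sub>\<infinity>j\<in>I.
    ennreal (\<alpha> (s (snd i)) * \<gamma> (s (snd j)) * (cmod (cinner (b j) (u t (b i))))\<^sup>2))" for \<alpha> \<gamma> t
  have F: "F \<kappa> t = \<Phi> (\<lambda>\<sigma>. C * exp (- (1 - \<kappa>) * \<sigma>)) (\<lambda>\<sigma>. exp (- \<kappa> * \<sigma>)) t" for \<kappa> t
  proof -
    have summand: "tpm_probability \<rho>0 P U t x y * ennreal (exp (- \<kappa> * entropy_production K \<beta> e x y))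
        = (\<Sum>f\<in>F0. \<Sum>f'\<in>F0. ennreal (C * exp (- (1 - \<kappa>) * s x) * exp (- \<kappa> * s y)
            * (cmod (cinner (b (f', y)) (u t (b (f, x)))))\<^sup>2))" if x: "x \<in> X" and y: "y \<in> X" for x y
    proof -
      define M where "M f f' = (cmod (cinner (b (f', y)) (u t (b (f, x)))))\<^sup>2" for f f'
      have "op_trace UNIV (\<rho>0 \<odot> P x \<odot> U (- t) \<odot> P y \<odot> U t \<odot> P x)
          = of_real (C * exp (- s x) * (\<Sum>i\<in>F0 \<times> {x}. \<Sum>j\<in>F0 \<times> {y}. (cmod (cinner (b j) (u t (b i))))\<^sup>2))"
        unfolding P[OF x] P[OF y] u
        using F0(1) x y b_\<rho>
        by (intro op_trace_two_time_measurement[OF b_orth b_total _ _ _ _ adj \<rho>0_unique \<rho>0_sub])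
          (auto simp: I_def)
      also have "(\<Sum>i\<in>F0 \<times> {x}. \<Sum>j\<in>F0 \<times> {y}. (cmod (cinner (b j) (u t (b i))))\<^sup>2) = (\<Sum>f\<in>F0. \<Sum>f'\<in>F0. M f f')"
      proof -
        have "(\<Sum>i\<in>F0 \<times> {z}. h i) = (\<Sum>f\<in>F0. h (f, z))" for h :: "'a \<times> 'x \<Rightarrow> real" and z
          by (rule sum.reindex_bij_witness[of _ "\<lambda>f. (f, z)" fst]) auto
        then show ?thesis by (simp add: M_def)
      qed
      finally have "tpm_probability \<rho>0 P U t x y = ennreal (C * exp (- s x) * (\<Sum>f\<in>F0. \<Sum>f'\<in>F0. M f f'))"
        by (simp add: tpm_probability_def del: of_real_mult)
      moreover have "entropy_production K \<beta> e x y = s y - s x"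
        by (simp add: entropy_production_def s_def right_diff_distrib sum_subtractf)
      ultimately have "tpm_probability \<rho>0 P U t x y * ennreal (exp (- \<kappa> * entropy_production K \<beta> e x y))
          = ennreal ((C * exp (- s x) * (\<Sum>f\<in>F0. \<Sum>f'\<in>F0. M f f')) * exp (- \<kappa> * (s y - s x)))"
        using C by (simp add: ennreal_mult' M_def sum_nonneg)
      also have "(C * exp (- s x) * (\<Sum>f\<in>F0. \<Sum>f'\<in>F0. M f f')) * exp (- \<kappa> * (s y - s x))
          = (\<Sum>f\<in>F0. \<Sum>f'\<in>F0. C * exp (- (1 - \<kappa>) * s x) * exp (- \<kappa> * s y) * M f f')"
      proof -
        \<comment> \<open>The Gibbs weight of the first outcome absorbs its share of the entropy
          production; this is where \<open>1 - \<kappa>\<close> appears.\<close>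
        have "exp (- s x) * exp (- \<kappa> * (s y - s x)) = exp (- (1 - \<kappa>) * s x) * exp (- \<kappa> * s y)"
          by (simp add: exp_add[symmetric] algebra_simps)
        then have *: "(C * exp (- s x) * Q) * exp (- \<kappa> * (s y - s x))
            = (C * exp (- (1 - \<kappa>) * s x) * exp (- \<kappa> * s y)) * Q" for Q
          by (simp only: mult_ac)
        show ?thesis unfolding * by (simp only: sum_distrib_left)
      qed
      also have "ennreal \<dots> = (\<Sum>f\<in>F0. \<Sum>f'\<in>F0. ennreal (C * exp (- (1 - \<kappa>) * s x) * exp (- \<kappa> * s y) * M f f'))"
        using C by (simp add: M_def sum_nonneg)
      finally show ?thesis by (simp add: M_def)
    qed
    have "F \<kappa> t = (\<Sum>\<^sub>\<infinity>(x, y)\<in>X \<times> X. \<Sum>f\<in>F0. \<Sum>f'\<in>F0.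
        ennreal (C * exp (- (1 - \<kappa>) * s x) * exp (- \<kappa> * s y) * (cmod (cinner (b (f', y)) (u t (b (f, x)))))\<^sup>2))"
      unfolding F_eq tpm_laplace_def by (rule infsum_cong) (use summand in auto)
    also have "\<dots> = \<Phi> (\<lambda>\<sigma>. C * exp (- (1 - \<kappa>) * \<sigma>)) (\<lambda>\<sigma>. exp (- \<kappa> * \<sigma>)) t"
      unfolding \<Phi>_def I_def
      using infsum_prod_finite_ennreal[OF F0(1), where X = X and h = "\<lambda>i j. ennreal (C * exp (- (1 - \<kappa>) * s (snd i))
          * exp (- \<kappa> * s (snd j)) * (cmod (cinner (b j) (u t (b i))))\<^sup>2)"]
      by simp
    finally show ?thesis .
  qed
  have "F \<kappa> t = F (1 - \<kappa>) t" for \<kappa> t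
  proof -
    have "F \<kappa> t = \<Phi> (\<lambda>\<sigma>. exp (- \<kappa> * \<sigma>)) (\<lambda>\<sigma>. C * exp (- (1 - \<kappa>) * \<sigma>)) t"
      unfolding F \<Phi>_def
      by (rule time_reversal_weighted_sum[where s = "\<lambda>i. s (snd i)", OF T_antiunitary b_orth b_total adj rev orth])
        (use C in auto)
    \<comment> \<open>With \<open>1 - \<kappa>\<close> as argument the weights have exponents
      \<open>- \<kappa> * \<sigma>\<close> and \<open>- (1 - \<kappa>) * \<sigma>\<close>, matching
      the exchanged ones; the constant \<open>C\<close> merely moves from one factor to the
      other.\<close>
    also have "\<dots> = F (1 - \<kappa>) t" unfolding F \<Phi>_def by (simp add: mult_ac)
    finally show ?thesis .
  qed
  then show ?thesis by blast
qed

end
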